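(* Let $W$ be a finite complex reflection group with set of reflections $\mathcal{R}$. For $m\in\mathbb{C}$ let $V$ be the complex vector space with basis $(v_s)_{s\in\mathcal{R}}$ and define $t_s\in\mathfrak{gl}(V)$ $(s\in\mathcal{R})$ by $$t_s.v_s=m\,v_s,\qquad t_s.v_u=v_{sus}-\alpha(s,u)\,v_s\quad (u\in\mathcal{R},\ u\neq s),$$ where $\alpha(s,u)=\#\{y\in\mathcal{R}\mid ysy=u\}$. Then for all $m\in\mathbb{C}$ the 1-form $\omega=h\sum_{s\in\mathcal{R}}t_s\,\omega_s$ on $X$ is integrable. Moreover, for all but a finite set of values of $m$: (1) the monodromy representation $R$ of $B$ associated to $\omega$ is semisimple; (2) there is a natural bijection $c\mapsto R_c$ between the conjugacy classes $c$ of reflections in $W$ and the irreducible components $R_c$ of $R$ (that is, $R=\bigoplus_c R_c$ with each $R_c$ irreducible); (3) for all $c$, $R_c(B)$ is Zariski-dense in the corresponding general linear group; (4) $R(P)$ is residually torsion-free nilpotent.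
   Context: A reflection of a finite-dimensional complex vector space $E$ is an element $s\in \mathrm{GL}(E)$ with $s^2=1$ and $\mathrm{Ker}(s-1)$ a hyperplane; a finite complex reflection group is a finite subgroup $W\subset\mathrm{GL}(E)$ generated by reflections, $\mathcal{R}$ is the set of all reflections in $W$, $\mathcal{A}=\{\mathrm{Ker}(s-1): s\in\mathcal{R}\}$, $X=E\setminus\bigcup\mathcal{A}$, $P=\pi_1(X)$, $B=\pi_1(X/W)$. For $s\in\mathcal{R}$, $\omega_s=\frac{1}{\mathrm{i}\pi}\,\mathrm{d}b_s/b_s$ with $b_s$ a linear form with kernel $\mathrm{Ker}(s-1)$. $h$ is a formal parameter, $A=\mathbb{C}[[h]]$, $K=\mathbb{C}((h))$. Integrable means $\left(\sum_s t_s\omega_s\right)\wedge\left(\sum_s t_s\omega_s\right)=0$. $W$ acts on $V$ by $w.v_s=v_{wsw^{-1}}$, and $wt_sw^{-1}=t_{wsw^{-1}}$. Monodromy: fix $\underline{z}\in X$. For a path $\gamma$ in $X$ from $\underline{z}$ to $w^{-1}\underline{z}$ $(w\in W)$, let $T_\gamma\in\mathrm{GL}(V\otimes A)$ be the endpoint value of the solution along $\gamma$ of $\mathrm{d}F=\omega F$ with $F(\underline{z})=\mathrm{Id}$. The representation $R:B\to\mathrm{GL}(V\otimes K)$ sends the class of $\gamma$ to $wT_\gamma$ (products of paths read from right to left, so that $R$ is a homomorphism). For a conjugacy class $c$ of reflections, $V_c\subset V$ is the span of the $v_s$, $s\in c$; it is stable under $W$ and all $t_s$, and $R_c:B\to\mathrm{GL}(V_c\otimes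 K)$ is the restriction of $R$, i.e. the monodromy representation obtained from the action of the $t_s$ on $V_c$. The general linear group in (3) is $\mathrm{GL}(V_c\otimes K)$. A group $\Gamma$ is residually torsion-free nilpotent if for every $g\in\Gamma\setminus\{1\}$ there is a surjection from $\Gamma$ onto a torsion-free nilpotent group not killing $g$. *)

theory Defs
  imports
    "HOL-Analysis.Analysis"
    "HOL-Algebra.Generated_Groups"
    "HOL-Library.Function_Algebras"
    "HOL-Computational_Algebra.Formal_Laurent_Series"
begin

section \<open>Finite complex reflection groups\<close>

definition GL_group :: "(complex^'n^'n) monoid" where
  "GL_group = \<lparr>carrier = {A. invertible A}, monoid.mult = (**), one = mat 1\<rparr>"

definition fixed_space :: "complex^'n^'n \<Rightarrow> (complex^'n) set" where
  "fixed_space s = {x. (s - mat 1) *v x = 0}"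

definition is_reflection :: "complex^'n^'n \<Rightarrow> bool" where
  "is_reflection s \<longleftrightarrow> s ** s = mat 1 \<and> vec.dim (fixed_space s) + 1 = CARD('n)"

definition reflections :: "(complex^'n^'n) set \<Rightarrow> (complex^'n^'n) set" where
  "reflections W = {s \<in> W. is_reflection s}"

definition complex_reflection_group :: "(complex^'n^'n) set \<Rightarrow> bool" where
  "complex_reflection_group W \<longleftrightarrow>
     finite W \<and> subgroup W GL_group \<and> generate GL_group (reflections W) = W"

definition hyperplane_complement :: "(complex^'n^'n) set \<Rightarrow> (complex^'n) set" where
  "hyperplane_complement W = UNIV - (\<Union>s\<in>reflections W. fixed_space s)"

definition conj_by :: "complex^'n^'n \<Rightarrow> complex^'n^'n \<Rightarrow> complex^'n^'n" where
  "conj_by w s = w ** s ** matrix_inv w"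

definition reflection_classes :: "(complex^'n^'n) set \<Rightarrow> (complex^'n^'n) set set" where
  "reflection_classes W = (\<lambda>s. (\<lambda>w. conj_by w s) ` W) ` reflections W"


section \<open>Fundamental groups of topological spaces and orbit spaces\<close>

definition path_class :: "'a topology \<Rightarrow> (real \<Rightarrow> 'a) \<Rightarrow> (real \<Rightarrow> 'a) set" where
  "path_class T g =
     {f. homotopic_with (\<lambda>r. r 0 = g 0 \<and> r 1 = g 1) (top_of_set {0..1}) T g f}"

text \<open>Products of paths are read from right to left: \<open>path_prod g f\<close> runs through \<open>f\<close> first.\<close>

definition path_prod :: "(real \<Rightarrow> 'a) \<Rightarrow> (real \<Rightarrow> 'a) \<Rightarrow> real \<Rightarrow> 'a" where
  "path_prod g f = (\<lambda>t. if t \<le> 1/2 then f (2 * t) else g (2 * t - 1))"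

definition fundamental_group :: "'a topology \<Rightarrow> 'a \<Rightarrow> (real \<Rightarrow> 'a) set monoid" where
  "fundamental_group T p =
     \<lparr>carrier = {path_class T g | g. pathin T g \<and> g 0 = p \<and> g 1 = p},
      monoid.mult = (\<lambda>a b. \<Union>g\<in>a. \<Union>f\<in>b. path_class T (path_prod g f)),
      one = path_class T (\<lambda>_. p)\<rparr>"

definition quotient_topology :: "'a topology \<Rightarrow> ('a \<Rightarrow> 'b) \<Rightarrow> 'b topology" where
  "quotient_topology T f =
     topology (\<lambda>U. U \<subseteq> f ` topspace T \<and> openin T {x \<in> topspace T. f x \<in> U})"

lemma openin_quotient_topology:
  "openin (quotient_topology T f) U \<longleftrightarrow>
     U \<subseteq> f ` topspace T \<and> openin T {x \<in> topspace T. f x \<in> U}"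
proof -
  have "istopology (\<lambda>U. U \<subseteq> f ` topspace T \<and> openin T {x \<in> topspace T. f x \<in> U})"
    unfolding istopology_def
  proof (intro conjI allI impI)
    fix S S' assume S: "S \<subseteq> f ` topspace T \<and> openin T {x \<in> topspace T. f x \<in> S}"
      and S': "S' \<subseteq> f ` topspace T \<and> openin T {x \<in> topspace T. f x \<in> S'}"
    show "S \<inter> S' \<subseteq> f ` topspace T" using S by blast
    have "{x \<in> topspace T. f x \<in> S \<inter> S'} =
          {x \<in> topspace T. f x \<in> S} \<inter> {x \<in> topspace T. f x \<in> S'}" by blast
    then show "openin T {x \<in> topspace T. f x \<in> S \<inter> S'}" using S S' by auto
  next
    fix \<K> assume K: "\<forall>K\<in>\<K>. K \<subseteq> f ` topspace T \<and> openin T {x \<in> topspace T. f x \<in> K}"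
    show "\<Union>\<K> \<subseteq> f ` topspace T" using K by blast
    have "{x \<in> topspace T. f x \<in> \<Union>\<K>} = (\<Union>K\<in>\<K>. {x \<in> topspace T. f x \<in> K})" by blast
    then show "openin T {x \<in> topspace T. f x \<in> \<Union>\<K>}" using K by auto
  qed
  then show ?thesis by (simp add: quotient_topology_def)
qed

lemma topspace_quotient_topology: "topspace (quotient_topology T f) = f ` topspace T"
proof
  show "topspace (quotient_topology T f) \<subseteq> f ` topspace T"
    by (metis openin_quotient_topology openin_topspace)
  have "{x \<in> topspace T. f x \<in> f ` topspace T} = topspace T" by blast
  then have "openin (quotient_topology T f) (f ` topspace T)"
    by (simp add: openin_quotient_topology)
  then show "f ` topspace T \<subseteq> topspace (quotient_topology T f)" by (rule openin_subset)
qed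

lemma quotient_map_quotient_topology: "quotient_map T (quotient_topology T f) f"
  by (auto simp: quotient_map_def topspace_quotient_topology openin_quotient_topology)

definition orbit_of :: "(complex^'n^'n) set \<Rightarrow> complex^'n \<Rightarrow> (complex^'n) set" where
  "orbit_of W x = (\<lambda>w. w *v x) ` W"

definition orbit_space :: "(complex^'n^'n) set \<Rightarrow> (complex^'n) set topology" where
  "orbit_space W = quotient_topology (top_of_set (hyperplane_complement W)) (orbit_of W)"

definition pure_braid_group ::
  "(complex^'n^'n) set \<Rightarrow> complex^'n \<Rightarrow> (real \<Rightarrow> complex^'n) set monoid" where
  "pure_braid_group W z = fundamental_group (top_of_set (hyperplane_complement W)) z"

definition braid_group ::
  "(complex^'n^'n) set \<Rightarrow> complex^'n \<Rightarrow> (real \<Rightarrow> (complex^'n) set) set monoid" where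
  "braid_group W z = fundamental_group (orbit_space W) (orbit_of W z)"


section \<open>Vectors and matrices with entries indexed by a finite set\<close>

text \<open>
  The free module with basis indexed by a finite set \<open>I\<close> consists of the functions vanishing
  outside \<open>I\<close>; an endomorphism is a matrix vanishing outside \<open>I \<times> I\<close> (column \<open>j\<close> is the image
  of the basis vector \<open>j\<close>). Extension of scalars acts on coordinates.
\<close>

type_synonym ('i, 'a) fvec = "'i \<Rightarrow> 'a"
type_synonym ('i, 'a) fmat = "'i \<Rightarrow> 'i \<Rightarrow> 'a"

definition fscale :: "'a::field \<Rightarrow> ('i, 'a) fvec \<Rightarrow> ('i, 'a) fvec" where
  "fscale c x = (\<lambda>i. c * x i)"

global_interpretation fvs: vector_space fscale
  by unfold_locales (auto simp: fscale_def algebra_simps fun_eq_iff)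

definition unit_vec :: "'i \<Rightarrow> ('i, 'a::zero_neq_one) fvec" where
  "unit_vec i = (\<lambda>j. if j = i then 1 else 0)"

definition free_space :: "'i set \<Rightarrow> ('i, 'a::field) fvec set" where
  "free_space I = fvs.span (unit_vec ` I)"

definition fmats :: "'i set \<Rightarrow> ('i, 'a::zero) fmat set" where
  "fmats I = {M. \<forall>i j. i \<notin> I \<or> j \<notin> I \<longrightarrow> M i j = 0}"

definition fmat_mult ::
  "'i set \<Rightarrow> ('i, 'a::semiring_0) fmat \<Rightarrow> ('i, 'a) fmat \<Rightarrow> ('i, 'a) fmat" where
  "fmat_mult I M N = (\<lambda>i j. \<Sum>k\<in>I. M i k * N k j)"

definition fmat_one :: "'i set \<Rightarrow> ('i, 'a::zero_neq_one) fmat" where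
  "fmat_one I = (\<lambda>i j. if i \<in> I \<and> i = j then 1 else 0)"

definition fmat_vec ::
  "'i set \<Rightarrow> ('i, 'a::semiring_0) fmat \<Rightarrow> ('i, 'a) fvec \<Rightarrow> ('i, 'a) fvec" where
  "fmat_vec I M x = (\<lambda>i. \<Sum>j\<in>I. M i j * x j)"

definition mat_of_columns :: "'i set \<Rightarrow> ('i \<Rightarrow> ('i, 'a::zero) fvec) \<Rightarrow> ('i, 'a) fmat" where
  "mat_of_columns I col = (\<lambda>i j. if j \<in> I then col j i else 0)"

definition GL_on :: "'i set \<Rightarrow> ('i, 'a::comm_ring_1) fmat monoid" where
  "GL_on I = units_of \<lparr>carrier = fmats I, monoid.mult = fmat_mult I, one = fmat_one I\<rparr>"

text \<open>For \<open>J \<subseteq> I\<close>, if \<open>M\<close> preserves the span of the basis vectors in \<open>J\<close>, then its restriction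
  to that span has the \<open>J \<times> J\<close> block of \<open>M\<close> as its matrix.\<close>

definition restrict_fmat :: "'i set \<Rightarrow> ('i, 'a::zero) fmat \<Rightarrow> ('i, 'a) fmat" where
  "restrict_fmat J M = (\<lambda>i j. if i \<in> J \<and> j \<in> J then M i j else 0)"


section \<open>The endomorphisms attached to the reflections and the 1-form\<close>

definition \<alpha>_count ::
  "(complex^'n^'n) set \<Rightarrow> complex^'n^'n \<Rightarrow> complex^'n^'n \<Rightarrow> nat" where
  "\<alpha>_count W s u = card {y \<in> reflections W. y ** s ** y = u}"

definition t_op ::
  "(complex^'n^'n) set \<Rightarrow> complex \<Rightarrow> complex^'n^'n \<Rightarrow> (complex^'n^'n, complex) fmat" where
  "t_op W m s = mat_of_columns (reflections W) (\<lambda>u.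
     if u = s then fscale m (unit_vec s)
     else unit_vec (s ** u ** s) - fscale (of_nat (\<alpha>_count W s u)) (unit_vec s))"

definition W_op ::
  "(complex^'n^'n) set \<Rightarrow> complex^'n^'n \<Rightarrow> (complex^'n^'n, 'a::zero_neq_one) fmat" where
  "W_op W w = mat_of_columns (reflections W) (\<lambda>s. unit_vec (conj_by w s))"

definition defining_form :: "complex^'n^'n \<Rightarrow> (complex^'n \<Rightarrow> complex) \<Rightarrow> bool" where
  "defining_form s b \<longleftrightarrow>
     Vector_Spaces.linear (*s) (*) b \<and> {x. b x = 0} = fixed_space s"

text \<open>A 1-form is a function of a point \<open>x\<close> and a tangent vector \<open>v\<close>. The form \<open>db/b\<close> of a
  linear form \<open>b\<close> takes the value \<open>b v / b x\<close>.\<close>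

definition log_form :: "(complex^'n \<Rightarrow> complex) \<Rightarrow> complex^'n \<Rightarrow> complex^'n \<Rightarrow> complex" where
  "log_form b x v = 1 / (\<i> * of_real pi) * (b v / b x)"

definition kz_form ::
  "(complex^'n^'n) set \<Rightarrow> (complex^'n^'n \<Rightarrow> complex^'n \<Rightarrow> complex) \<Rightarrow> complex \<Rightarrow>
   complex^'n \<Rightarrow> complex^'n \<Rightarrow> (complex^'n^'n, complex) fmat" where
  "kz_form W b m x v =
     (\<lambda>i j. \<Sum>s\<in>reflections W. t_op W m s i j * log_form (b s) x v)"

text \<open>The form \<open>h (\<Sum>\<^sub>s t\<^sub>s \<omega>\<^sub>s)\<close> with the formal parameter \<open>h\<close>.\<close>

definition h_kz_form ::
  "(complex^'n^'n) set \<Rightarrow> (complex^'n^'n \<Rightarrow> complex^'n \<Rightarrow> complex) \<Rightarrow> complex \<Rightarrow>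
   complex^'n \<Rightarrow> complex^'n \<Rightarrow> (complex^'n^'n, complex fps) fmat" where
  "h_kz_form W b m x v = (\<lambda>i j. fps_X * fps_const (kz_form W b m x v i j))"

definition wedge ::
  "'i set \<Rightarrow> ('e \<Rightarrow> 'e \<Rightarrow> ('i, 'a::ring) fmat) \<Rightarrow> ('e \<Rightarrow> 'e \<Rightarrow> ('i, 'a) fmat) \<Rightarrow>
   'e \<Rightarrow> 'e \<Rightarrow> 'e \<Rightarrow> ('i, 'a) fmat" where
  "wedge I \<eta> \<theta> x v w =
     fmat_mult I (\<eta> x v) (\<theta> x w) - fmat_mult I (\<eta> x w) (\<theta> x v)"

definition integrable_form ::
  "'i set \<Rightarrow> 'e set \<Rightarrow> ('e \<Rightarrow> 'e \<Rightarrow> ('i, 'a::ring) fmat) \<Rightarrow> bool" where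
  "integrable_form I X \<eta> \<longleftrightarrow> (\<forall>x\<in>X. \<forall>v w. wedge I \<eta> \<eta> x v w = 0)"


section \<open>Monodromy\<close>

text \<open>\<open>d\<Phi> = \<omega> \<Phi>\<close> on an open set, where \<open>\<Phi>\<close> has formal power series entries and is
  differentiated coefficientwise.\<close>

definition solves_on ::
  "'i set \<Rightarrow> ('e::real_normed_vector \<Rightarrow> 'e \<Rightarrow> ('i, complex fps) fmat) \<Rightarrow> 'e set \<Rightarrow>
   ('e \<Rightarrow> ('i, complex fps) fmat) \<Rightarrow> bool" where
  "solves_on I \<omega> U \<Phi> \<longleftrightarrow>
     (\<forall>x\<in>U. \<Phi> x \<in> fmats I) \<and>
     (\<forall>x\<in>U. \<forall>i\<in>I. \<forall>j\<in>I. \<forall>k.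
        ((\<lambda>y. fps_nth (\<Phi> y i j) k) has_derivative
         (\<lambda>v. fps_nth (fmat_mult I (\<omega> x v) (\<Phi> x) i j) k)) (at x))"

text \<open>\<open>F\<close> is a solution along the continuous path \<open>\<gamma>\<close> in the open set \<open>X\<close>, i.e. it is given near
  each parameter by a local solution: analytic continuation along \<open>\<gamma>\<close>.\<close>

definition solution_along ::
  "'i set \<Rightarrow> ('e::real_normed_vector \<Rightarrow> 'e \<Rightarrow> ('i, complex fps) fmat) \<Rightarrow> 'e set \<Rightarrow>
   (real \<Rightarrow> 'e) \<Rightarrow> (real \<Rightarrow> ('i, complex fps) fmat) \<Rightarrow> bool" where
  "solution_along I \<omega> X \<gamma> F \<longleftrightarrow>
     (\<forall>t\<in>{0..1}. \<exists>U \<Phi>. open U \<and> \<gamma> t \<in> U \<and> U \<subseteq> X \<and> solves_on I \<omega> U \<Phi> \<and>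
        (\<exists>e>0. \<forall>\<tau>\<in>{0..1} \<inter> ball t e. \<gamma> \<tau> \<in> U \<and> F \<tau> = \<Phi> (\<gamma> \<tau>)))"

text \<open>\<open>T\<close> is the endpoint value along \<open>\<gamma>\<close> of the solution with value the identity at the start.\<close>

definition transport ::
  "(complex^'n^'n) set \<Rightarrow> (complex^'n^'n \<Rightarrow> complex^'n \<Rightarrow> complex) \<Rightarrow> complex \<Rightarrow>
   (real \<Rightarrow> complex^'n) \<Rightarrow> (complex^'n^'n, complex fps) fmat \<Rightarrow> bool" where
  "transport W b m \<gamma> T \<longleftrightarrow>
     (\<exists>F. solution_along (reflections W) (h_kz_form W b m) (hyperplane_complement W) \<gamma> F \<and>
        F 0 = fmat_one (reflections W) \<and> F 1 = T)"

definition scalars_to_fls :: "('i, complex fps) fmat \<Rightarrow> ('i, complex fls) fmat" where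
  "scalars_to_fls M = (\<lambda>i j. fps_to_fls (M i j))"

text \<open>
  The monodromy representation of the braid group \<open>\<pi>\<^sub>1(X/W)\<close>, given by its graph: the class of a
  path \<open>\<gamma>\<close> in \<open>X\<close> from \<open>z\<close> to \<open>w\<^sup>-\<^sup>1 z\<close>, i.e. of the loop that it induces in \<open>X/W\<close>, is sent to
  \<open>w T\<^sub>\<gamma>\<close>. It is a function since \<open>W\<close> acts freely on \<open>X\<close>, every loop in \<open>X/W\<close> lifts to \<open>X\<close> and
  the form is integrable. The image of the representation is the image \<open>R `` carrier B\<close>.
\<close>

definition monodromy_rep ::
  "(complex^'n^'n) set \<Rightarrow> (complex^'n^'n \<Rightarrow> complex^'n \<Rightarrow> complex) \<Rightarrow> complex \<Rightarrow> complex^'n \<Rightarrow>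
   ((real \<Rightarrow> (complex^'n) set) set \<times> (complex^'n^'n, complex fls) fmat) set" where
  "monodromy_rep W b m z =
     {(path_class (orbit_space W) (orbit_of W \<circ> \<gamma>),
       fmat_mult (reflections W) (W_op W w) (scalars_to_fls T)) | w \<gamma> T.
        w \<in> W \<and> pathin (top_of_set (hyperplane_complement W)) \<gamma> \<and>
        \<gamma> 0 = z \<and> \<gamma> 1 = matrix_inv w *v z \<and> transport W b m \<gamma> T}"

text \<open>Its restriction to \<open>\<pi>\<^sub>1(X)\<close>: loops in \<open>X\<close> are the paths with \<open>w = 1\<close>.\<close>

definition pure_monodromy_rep ::
  "(complex^'n^'n) set \<Rightarrow> (complex^'n^'n \<Rightarrow> complex^'n \<Rightarrow> complex) \<Rightarrow> complex \<Rightarrow> complex^'n \<Rightarrow>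
   ((real \<Rightarrow> complex^'n) set \<times> (complex^'n^'n, complex fls) fmat) set" where
  "pure_monodromy_rep W b m z =
     {(path_class (top_of_set (hyperplane_complement W)) \<gamma>, scalars_to_fls T) | \<gamma> T.
        pathin (top_of_set (hyperplane_complement W)) \<gamma> \<and>
        \<gamma> 0 = z \<and> \<gamma> 1 = z \<and> transport W b m \<gamma> T}"


text \<open>\<open>V \<otimes> K\<close> for \<open>I\<close> the set of all reflections, \<open>V\<^sub>c \<otimes> K\<close> for \<open>I = c\<close> a class of reflections,
  where \<open>K\<close> is the field of formal Laurent series.\<close>

definition V_K :: "(complex^'n^'n) set \<Rightarrow> (complex^'n^'n, complex fls) fvec set" where
  "V_K I = free_space I"


section \<open>Semisimplicity and irreducibility of representations\<close>

text \<open>A representation on the free space over \<open>I\<close> enters through its image, a set \<open>G\<close> of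
  matrices.\<close>

definition subrep :: "'i set \<Rightarrow> ('i, 'a::field) fmat set \<Rightarrow> ('i, 'a) fvec set \<Rightarrow> bool" where
  "subrep I G U \<longleftrightarrow>
     fvs.subspace U \<and> U \<subseteq> free_space I \<and> (\<forall>g\<in>G. \<forall>x\<in>U. fmat_vec I g x \<in> U)"

definition irreducible_subrep ::
  "'i set \<Rightarrow> ('i, 'a::field) fmat set \<Rightarrow> ('i, 'a) fvec set \<Rightarrow> bool" where
  "irreducible_subrep I G U \<longleftrightarrow>
     subrep I G U \<and> U \<noteq> {0} \<and> (\<forall>U'. subrep I G U' \<and> U' \<subseteq> U \<longrightarrow> U' = {0} \<or> U' = U)"

definition semisimple_rep :: "'i set \<Rightarrow> ('i, 'a::field) fmat set \<Rightarrow> bool" where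
  "semisimple_rep I G \<longleftrightarrow>
     (\<forall>U. subrep I G U \<longrightarrow>
        (\<exists>U'. subrep I G U' \<and> U \<inter> U' = {0} \<and> {x + y | x y. x \<in> U \<and> y \<in> U'} = free_space I))"

definition internal_direct_sum ::
  "('i, 'a::field) fvec set \<Rightarrow> ('c \<Rightarrow> ('i, 'a) fvec set) \<Rightarrow> 'c set \<Rightarrow> bool" where
  "internal_direct_sum V U C \<longleftrightarrow>
     finite C \<and> (\<forall>c\<in>C. fvs.subspace (U c)) \<and> V = fvs.span (\<Union>c\<in>C. U c) \<and>
     (\<forall>x. (\<forall>c\<in>C. x c \<in> U c) \<and> (\<Sum>c\<in>C. x c) = 0 \<longrightarrow> (\<forall>c\<in>C. x c = 0))"


section \<open>Zariski density\<close>

inductive_set poly_functions :: "'i set \<Rightarrow> (('i, 'a::field) fmat \<Rightarrow> 'a) set"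
  for I :: "'i set" where
  const: "(\<lambda>_. a) \<in> poly_functions I"
| entry: "i \<in> I \<Longrightarrow> j \<in> I \<Longrightarrow> (\<lambda>M. M i j) \<in> poly_functions I"
| add: "p \<in> poly_functions I \<Longrightarrow> q \<in> poly_functions I \<Longrightarrow> (\<lambda>M. p M + q M) \<in> poly_functions I"
| mult: "p \<in> poly_functions I \<Longrightarrow> q \<in> poly_functions I \<Longrightarrow> (\<lambda>M. p M * q M) \<in> poly_functions I"

text \<open>Allowing in addition the inverse of the determinant as a regular function would not change
  the closed subsets of the general linear group.\<close>

definition zariski_closed :: "'i set \<Rightarrow> ('i, 'a::field) fmat set \<Rightarrow> bool" where
  "zariski_closed I Z \<longleftrightarrow>
     (\<exists>Q. Q \<subseteq> poly_functions I \<and> Z = {M \<in> carrier (GL_on I). \<forall>q\<in>Q. q M = 0})"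

definition zariski_dense :: "'i set \<Rightarrow> ('i, 'a::field) fmat set \<Rightarrow> bool" where
  "zariski_dense I S \<longleftrightarrow>
     S \<subseteq> carrier (GL_on I) \<and>
     (\<forall>Z. zariski_closed I Z \<and> S \<subseteq> Z \<longrightarrow> Z = carrier (GL_on I))"


section \<open>Residually torsion-free nilpotent groups\<close>

fun lower_central :: "('g, 'x) monoid_scheme \<Rightarrow> nat \<Rightarrow> 'g set" where
  "lower_central G 0 = carrier G"
| "lower_central G (Suc n) = generate G
     {x \<otimes>\<^bsub>G\<^esub> y \<otimes>\<^bsub>G\<^esub> inv\<^bsub>G\<^esub> x \<otimes>\<^bsub>G\<^esub> inv\<^bsub>G\<^esub> y | x y. x \<in> carrier G \<and> y \<in> lower_central G n}"

definition nilpotent_group :: "('g, 'x) monoid_scheme \<Rightarrow> bool" where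
  "nilpotent_group G \<longleftrightarrow> group G \<and> (\<exists>n. lower_central G n = {\<one>\<^bsub>G\<^esub>})"

definition torsion_free_group :: "('g, 'x) monoid_scheme \<Rightarrow> bool" where
  "torsion_free_group G \<longleftrightarrow>
     group G \<and> (\<forall>x\<in>carrier G. \<forall>n::nat. n > 0 \<and> x [^]\<^bsub>G\<^esub> n = \<one>\<^bsub>G\<^esub> \<longrightarrow> x = \<one>\<^bsub>G\<^esub>)"

text \<open>Every quotient of \<open>G\<close> is isomorphic to a group whose elements are cosets, so it is no
  restriction to take target groups of type \<open>'g set monoid\<close>.\<close>

definition residually_torsion_free_nilpotent :: "'g monoid \<Rightarrow> bool" where
  "residually_torsion_free_nilpotent G \<longleftrightarrow>
     group G \<and>
     (\<forall>g\<in>carrier G - {\<one>\<^bsub>G\<^esub>}. \<exists>(H :: 'g set monoid) \<phi>.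
        nilpotent_group H \<and> torsion_free_group H \<and> \<phi> \<in> epi G H \<and> \<phi> g \<noteq> \<one>\<^bsub>H\<^esub>)"

end

theory Submission
  imports Defs
begin

text \<open>
  Write \<open>t\<^sub>s = s - p\<^sub>s\<close>, where \<open>s\<close> permutes the basis by conjugation and \<open>p\<^sub>s\<close> is the rank one map
  \<open>v\<^sub>u \<mapsto> (gram s u) v\<^sub>s\<close>. Since \<open>t\<^sub>s\<close> is self-adjoint for the invariant form \<open>gram\<close>, the sum of the \<open>t\<^sub>s\<close>
  over the reflections of a flat of codimension two commutes with each of them, which is the
  integrability condition.

  The coefficients of the leading powers of \<open>m\<close> in iterated brackets of the \<open>t\<^sub>s\<close> include all matrix
  units of \<open>gl(V\<^sub>c)\<close>; hence, for \<open>m\<close> outside a finite set, the \<open>t\<^sub>s\<close> generate \<open>gl(V\<^sub>c)\<close> as a Lie algebra.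

  Integrability and the Poincare lemma, applied to one power of \<open>h\<close> at a time, give local fundamental
  solutions. A loop round the hyperplane of \<open>s\<close> yields an element \<open>1 + 2 h t\<^sub>s + O(h\<^sup>2)\<close> of \<open>R(P)\<close>.
  Therefore the reductions modulo \<open>h\<close> of the polynomials with coefficients in \<open>A\<close> that vanish on \<open>R(P)\<close>
  are stable under the derivations along the \<open>t\<^sub>s\<close>, hence under all of \<open>gl(V\<^sub>c)\<close>; as they also vanish at
  the identity, they are zero. So \<open>R(P)\<close> is Zariski-dense on each \<open>V\<^sub>c\<close>, which implies irreducibility
  and semisimplicity. Finally \<open>R(P)\<close> consists of matrices congruent to \<open>1\<close> modulo \<open>h\<close>, and the
  filtration by the congruence subgroups has torsion-free quotients.
\<close>

section \<open>Reflections and their hyperplanes\<close>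

text \<open>The entry of \<open>t\<^sub>s\<close> at \<open>(s, s)\<close> is \<open>m\<close>, and
  no other entry contains \<open>m\<close>. With \<open>m\<close> treated as an indeterminate, the
  diagonal matrix units of \<open>gl(V\<^sub>c)\<close> are therefore leading coefficients at once,
  and they form a torus whose weights isolate any off-diagonal position. The exceptional
  \<open>m\<close> are roots of finitely many polynomials left over from an elimination, so
  finiteness results without naming the set. All claims on the monodromy concern the sets
  \<open>R(B)\<close> and \<open>R(P)\<close> of endpoint values over all paths. The proof thus
  works with paths, their concatenation and their reversal, and integrability is spent on solving
  \<open>dF = \<omega> F\<close> on balls. For density, elements \<open>1 + h N\<close> of the image
  allow a difference quotient by \<open>h\<close>, which turns invariance under right translation
  into invariance under a derivation; this takes the place of the Lie algebra of the Zariski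
  closure. Division by \<open>h\<close> also arranges that a nonzero polynomial over
  \<open>K\<close> has a nonzero reduction.\<close>

locale reflection_group =
  fixes W :: "(complex^'n^'n) set"
  assumes crg: "complex_reflection_group W"
begin

abbreviation "\<R> \<equiv> reflections W"

lemma finite_W: "finite W"
  using crg by (simp add: complex_reflection_group_def)

lemma finite_R: "finite \<R>"
  using finite_W by (auto simp: reflections_def)

lemma subgroup_W: "subgroup W GL_group"
  using crg by (simp add: complex_reflection_group_def)

lemma one_W: "mat 1 \<in> W"
  using subgroup.one_closed[OF subgroup_W] by (simp add: GL_group_def)

lemma mult_W: "v \<in> W \<Longrightarrow> w \<in> W \<Longrightarrow> v ** w \<in> W"
  using subgroup.m_closed[OF subgroup_W, of v w] by (simp add: GL_group_def)

lemma invertible_W: "w \<in> W \<Longrightarrow> invertible w"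
  using subgroup.subset[OF subgroup_W] by (auto simp: GL_group_def)

lemma matrix_inv_W [simp]:
  assumes "w \<in> W" shows "w ** matrix_inv w = mat 1" "matrix_inv w ** w = mat 1"
  using someI_ex[OF invertible_W[OF assms, unfolded invertible_def]] by (auto simp: matrix_inv_def)

lemma group_GL: "group GL_group"
  apply (rule groupI)
  by (auto simp: GL_group_def invertible_mult matrix_mul_assoc) (auto simp: invertible_def)

lemma inv_GL: "w \<in> W \<Longrightarrow> inv\<^bsub>GL_group\<^esub> w = matrix_inv w"
proof -
  assume w: "w \<in> W"
  have "invertible (matrix_inv w)" unfolding invertible_def using matrix_inv_W[OF w] by blast
  then show ?thesis
    using invertible_W[OF w] matrix_inv_W[OF w]
    by (intro group.inv_equality[OF group_GL]) (simp_all add: GL_group_def)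
qed

lemma inv_W: "w \<in> W \<Longrightarrow> matrix_inv w \<in> W"
  using subgroup.m_inv_closed[OF subgroup_W, of w] inv_GL by simp

lemma R_W: "s \<in> \<R> \<Longrightarrow> s \<in> W"
  by (simp add: reflections_def)

lemma R_sq [simp]: "s \<in> \<R> \<Longrightarrow> s ** s = mat 1"
  by (simp add: reflections_def is_reflection_def)

lemma R_sq_left [simp]: "s \<in> \<R> \<Longrightarrow> s ** (s ** A) = A"
  by (simp add: matrix_mul_assoc)

lemma R_sq_right [simp]: "s \<in> \<R> \<Longrightarrow> A ** s ** s = A"
  by (simp add: matrix_mul_assoc[symmetric])

lemma R_inv: "s \<in> \<R> \<Longrightarrow> matrix_inv s = s"
proof -
  assume s: "s \<in> \<R>"
  have "matrix_inv s ** (s ** s) = s" using matrix_inv_W(2)[OF R_W[OF s]] by (simp only: matrix_mul_assoc matrix_mul_lid)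
  then show ?thesis using s by (simp only: R_sq matrix_mul_rid)
qed

lemma conj_by_R: "s \<in> \<R> \<Longrightarrow> conj_by s u = s ** u ** s"
  by (simp add: conj_by_def R_inv)

lemma conj_by_mult: "v \<in> W \<Longrightarrow> w \<in> W \<Longrightarrow> conj_by (v ** w) s = conj_by v (conj_by w s)"
proof -
  assume vw: "v \<in> W" "w \<in> W"
  have "(matrix_inv w ** matrix_inv v) = matrix_inv (v ** w)"
  proof -
    have "(matrix_inv w ** matrix_inv v) ** (v ** w) = matrix_inv w ** ((matrix_inv v ** v) ** w)"
      by (simp only: matrix_mul_assoc)
    then have "(matrix_inv w ** matrix_inv v) ** (v ** w) = mat 1"
      using vw by (simp only: matrix_inv_W matrix_mul_lid)
    then have "(matrix_inv w ** matrix_inv v) ** ((v ** w) ** matrix_inv (v ** w)) = matrix_inv (v ** w)"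
      by (simp only: matrix_mul_assoc matrix_mul_lid)
    then show ?thesis using mult_W[OF vw] by (simp only: matrix_inv_W matrix_mul_rid)
  qed
  then show ?thesis by (simp add: conj_by_def matrix_mul_assoc[symmetric])
qed

lemma matrix_inv_one: "matrix_inv (mat 1 :: complex^'n^'n) = mat 1"
  using matrix_inv_W(1)[OF one_W] by (simp only: matrix_mul_lid)

lemma conj_by_one [simp]: "conj_by (mat 1) (s :: complex^'n^'n) = s"
  by (simp add: conj_by_def matrix_inv_one)

lemma conj_by_inv: "w \<in> W \<Longrightarrow> conj_by (matrix_inv w) (conj_by w s) = s"
  using conj_by_mult[of "matrix_inv w" w s] by (simp add: inv_W)

lemma fixed_space_iff: "x \<in> fixed_space s \<longleftrightarrow> s *v x = x"
  by (simp add: fixed_space_def matrix_vector_mult_diff_rdistrib)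

text \<open>The hyperplane of \<open>conj_by w s\<close> is the \<open>w\<close>-translate of the
  hyperplane of \<open>s\<close>, and \<open>w\<close> preserves dimensions.\<close>

lemma conj_R: "w \<in> W \<Longrightarrow> s \<in> \<R> \<Longrightarrow> conj_by w s \<in> \<R>"
proof -
  assume w: "w \<in> W" and s: "s \<in> \<R>"
  have 1: "conj_by w s ** conj_by w s = mat 1"
  proof -
    have "conj_by w s ** conj_by w s = w ** (s ** ((matrix_inv w ** w) ** (s ** matrix_inv w)))"
      by (simp add: conj_by_def matrix_mul_assoc)
    then show ?thesis using w s by simp
  qed
  have 2: "fixed_space (conj_by w s) = (*v) w ` fixed_space s"
  proof (intro subset_antisym subsetI)
    fix x assume "x \<in> fixed_space (conj_by w s)"
    then have "w *v (s *v (matrix_inv w *v x)) = x"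
      by (simp add: fixed_space_iff conj_by_def matrix_vector_mul_assoc matrix_mul_assoc)
    then have "matrix_inv w *v (w *v (s *v (matrix_inv w *v x))) = matrix_inv w *v x" by simp
    then have "s *v (matrix_inv w *v x) = matrix_inv w *v x"
      using w by (simp add: matrix_vector_mul_assoc[of "matrix_inv w" w])
    moreover have "x = w *v (matrix_inv w *v x)" using w by (simp add: matrix_vector_mul_assoc)
    ultimately show "x \<in> (*v) w ` fixed_space s" by (auto simp: fixed_space_iff)
  next
    fix x assume "x \<in> (*v) w ` fixed_space s"
    then obtain y where y: "x = w *v y" "s *v y = y" by (auto simp: fixed_space_iff)
    have "conj_by w s *v x = w *v (s *v ((matrix_inv w ** w) *v y))"
      by (simp add: conj_by_def y(1) matrix_vector_mul_assoc matrix_mul_assoc)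
    then show "x \<in> fixed_space (conj_by w s)" using w y by (simp add: fixed_space_iff)
  qed
  have inj: "inj_on ((*v) w) A" for A
    using w by (metis (no_types, lifting) inj_onI matrix_inv_W(2) matrix_vector_mul_assoc matrix_vector_mul_lid)
  have "vec.dim (fixed_space (conj_by w s)) = vec.dim (fixed_space s)"
    unfolding 2 by (rule vec.dim_image_eq[OF matrix_vector_mul_linear_gen inj])
  moreover have "conj_by w s \<in> W"
    unfolding conj_by_def by (intro mult_W inv_W w R_W[OF s])
  ultimately show ?thesis using s 1 unfolding reflections_def is_reflection_def by (simp del: R_sq R_sq_left R_sq_right)
qed

lemma sus_R [simp]: "s \<in> \<R> \<Longrightarrow> u \<in> \<R> \<Longrightarrow> s ** u ** s \<in> \<R>"
  using conj_R[of s u] R_W[of s] by (simp add: conj_by_R)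

lemma sus_eq_iff: "s \<in> \<R> \<Longrightarrow> s ** u ** s = v \<longleftrightarrow> u = s ** v ** s"
proof -
  assume s: "s \<in> \<R>"
  have "s ** (s ** x ** s) ** s = x" for x
    using s by (simp only: matrix_mul_assoc R_sq R_sq_right matrix_mul_lid)
  from this[of u] this[of v] show ?thesis by auto
qed

text \<open>Reflections are involutions, so the inverse case of \<open>generate\<close> coincides
  with \<open>incl\<close>.\<close>

lemma W_induct [consumes 1, case_names one incl mult]:
  assumes "w \<in> W" "P (mat 1)" "\<And>s. s \<in> \<R> \<Longrightarrow> P s" "\<And>v w. v \<in> W \<Longrightarrow> w \<in> W \<Longrightarrow> P v \<Longrightarrow> P w \<Longrightarrow> P (v ** w)"
  shows "P w"
proof -
  have gen: "generate GL_group \<R> = W" using crg by (simp add: complex_reflection_group_def)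
  have "w \<in> generate GL_group \<R>" unfolding gen by fact
  then show ?thesis
  proof (induction rule: generate.induct)
    case one then show ?case using assms(2) by (simp add: GL_group_def)
  next
    case (incl h) then show ?case using assms(3) by simp
  next
    case (inv h) then show ?case using assms(3) by (simp add: inv_GL R_W R_inv)
  next
    case (eng h1 h2) then show ?case using assms(4)[of h1 h2] gen by (simp add: GL_group_def)
  qed
qed

text \<open>Lets a property spread over a whole conjugacy class by single steps from
  \<open>x\<close> to \<open>sxs\<close>.\<close>

lemma conj_closed:
  assumes "\<And>s x. s \<in> \<R> \<Longrightarrow> x \<in> C \<Longrightarrow> s ** x ** s \<in> C" "w \<in> W" "x \<in> C"
  shows "conj_by w x \<in> C"
  using assms(2) assms(3)
  by (induction arbitrary: x rule: W_induct) (auto simp: conj_by_R conj_by_mult assms(1))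

end

section \<open>Linear forms and the hyperplanes that they cut out\<close>

lemma linear_form_simps:
  fixes f :: "complex^'n \<Rightarrow> complex"
  assumes "Vector_Spaces.linear (*s) (*) f"
  shows "f (x + y) = f x + f y" "f (c *s x) = c * f x" "f (x - y) = f x - f y" "f 0 = 0" "f (- x) = - f x"
    "f (\<Sum>i\<in>A. g i) = (\<Sum>i\<in>A. f (g i))"
proof -
  interpret Vector_Spaces.linear "(*s)" "(*)" f by fact
  show "f (x + y) = f x + f y" "f (c *s x) = c * f x" "f (x - y) = f x - f y" "f 0 = 0" "f (- x) = - f x"
    "f (\<Sum>i\<in>A. g i) = (\<Sum>i\<in>A. f (g i))"
    by (simp_all add: add scale diff zero neg sum)
qed

lemma linear_form_proportional:
  fixes f g :: "complex^'n \<Rightarrow> complex"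
  assumes f: "Vector_Spaces.linear (*s) (*) f" and g: "Vector_Spaces.linear (*s) (*) g"
    and "\<And>x. g x = 0 \<Longrightarrow> f x = 0"
  shows "\<exists>c. \<forall>x. f x = c * g x"
proof (cases "\<forall>x. g x = 0")
  case True then show ?thesis using assms(3) by auto
next
  case False
  then obtain e where e: "g e \<noteq> 0" by auto
  have "f x = f e / g e * g x" for x
  proof -
    have "g (x - (g x / g e) *s e) = 0" using e by (simp add: linear_form_simps[OF g])
    then have "f (x - (g x / g e) *s e) = 0" by (rule assms(3))
    then show ?thesis by (simp add: linear_form_simps[OF f])
  qed
  then show ?thesis by blast
qed

locale reflection_arrangement = reflection_group W for W :: "(complex^'n^'n) set" +
  fixes b :: "complex^'n^'n \<Rightarrow> complex^'n \<Rightarrow> complex"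
  assumes b: "\<And>s. s \<in> reflections W \<Longrightarrow> defining_form s (b s)"
begin

lemma b_linear: "s \<in> \<R> \<Longrightarrow> Vector_Spaces.linear (*s) (*) (b s)"
  using b by (simp add: defining_form_def)

lemmas b_simps = linear_form_simps[OF b_linear]

lemma b_zero_iff: "s \<in> \<R> \<Longrightarrow> b s x = 0 \<longleftrightarrow> s *v x = x"
proof -
  assume "s \<in> \<R>"
  then have "{x. b s x = 0} = fixed_space s" using b by (simp add: defining_form_def)
  then have "x \<in> {x. b s x = 0} \<longleftrightarrow> x \<in> fixed_space s" by (rule arg_cong)
  then show ?thesis by (simp add: fixed_space_iff)
qed

lemma b_zero_iff': "s \<in> \<R> \<Longrightarrow> b s x = 0 \<longleftrightarrow> x \<in> fixed_space s"
  by (simp add: b_zero_iff fixed_space_iff)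

lemma b_nonzero:
  assumes "s \<in> \<R>" obtains e where "b s e = 1"
proof -
  have "fixed_space s \<noteq> UNIV"
  proof
    assume "fixed_space s = UNIV"
    then have "vec.dim (UNIV :: (complex^'n) set) + 1 = CARD('n)"
      using assms unfolding reflections_def is_reflection_def by simp
    then show False unfolding vec_dim_card by simp
  qed
  then obtain v where "b s v \<noteq> 0" using b_zero_iff'[OF assms] by auto
  then have "b s ((1 / b s v) *s v) = 1" using assms by (simp add: b_simps)
  then show ?thesis by (rule that)
qed

lemma X_iff: "x \<in> hyperplane_complement W \<longleftrightarrow> (\<forall>s\<in>\<R>. b s x \<noteq> 0)"
  by (auto simp: hyperplane_complement_def b_zero_iff')

text \<open>\<open>s - 1\<close> vanishes on the hyperplane, hence factors through
  \<open>b s\<close>. Applying \<open>s\<close> twice to a vector with \<open>b s e = 1\<close>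
  gives \<open>(2 + b s a) *s a = 0\<close>, and \<open>a\<close> is nonzero because
  \<open>e\<close> is not fixed.\<close>

lemma reflection_formula:
  assumes "s \<in> \<R>"
  obtains a where "\<And>x. s *v x = x + b s x *s a" "b s a = -2"
proof -
  obtain e where e: "b s e = 1" using b_nonzero[OF assms] .
  define a where "a = s *v e - e"
  have 1: "s *v x = x + b s x *s a" for x
  proof -
    have "b s (x - b s x *s e) = 0" using e assms by (simp add: b_simps)
    then have "s *v (x - b s x *s e) = x - b s x *s e" using b_zero_iff[OF assms] by simp
    then have "s *v x - b s x *s (s *v e) = x - b s x *s e"
      by (simp add: matrix_vector_mult_diff_distrib vector_scalar_commute)
    then show ?thesis by (simp add: a_def vector_ssub_ldistrib algebra_simps)
  qed
  have "s *v (s *v e) = e" using assms by (simp add: matrix_vector_mul_assoc)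
  then have "e + a + (1 + b s a) *s a = e" using e assms by (simp add: 1 b_simps)
  then have eq: "(2 + b s a) *s a = 0"
    by (simp add: vec_eq_iff algebra_simps)
  have "a \<noteq> 0" using e b_zero_iff[OF assms, of e] by (auto simp: a_def)
  then have "2 + b s a = 0" using eq unfolding vector_mul_eq_0 by simp
  then have "b s a = -2" by (simp add: add_eq_0_iff)
  then show ?thesis using 1 that by blast
qed

text \<open>Two reflections with the same hyperplane differ by a transvection, which has infinite order
  unless it is trivial.\<close>

lemma fixed_space_inj:
  assumes s: "s \<in> \<R>" and u: "u \<in> \<R>" and eq: "fixed_space s = fixed_space u"
  shows "s = u"
proof -
  obtain a where a: "\<And>x. s *v x = x + b s x *s a" "b s a = -2" using reflection_formula[OF s] by blast
  obtain a0 where a0: "\<And>x. u *v x = x + b u x *s a0" "b u a0 = -2" using reflection_formula[OF u] by blast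
  have "\<exists>c. \<forall>x. b u x = c * b s x"
    by (rule linear_form_proportional) (use s u eq b_zero_iff' b_linear in auto)
  then obtain c where c: "\<And>x. b u x = c * b s x" by blast
  \<comment> \<open>Rescaling \<open>a0\<close> writes both reflections through the one form
    \<open>b s\<close>.\<close>
  define a' where "a' = c *s a0"
  have a': "u *v x = x + b s x *s a'" for x by (simp add: a0 c a'_def mult.commute)
  have ba': "b s a' = -2" using a0(2) by (simp add: a'_def c b_simps s)
  define d where "d = a' - a"
  have bd: "b s d = 0" by (simp add: d_def b_simps s a ba')
  have su: "s *v (u *v x) = x + b s x *s d" for x
    by (simp add: a a' b_simps s ba' d_def algebra_simps
        vec_eq_iff)
  \<comment> \<open>\<open>g k\<close> is the power \<open>(su)^k\<close>, which adds
    \<open>k * b s x\<close> times \<open>d\<close> to \<open>x\<close>. Finiteness of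
    \<open>W\<close> makes two such powers coincide, whence \<open>d = 0\<close>.\<close>
  define g where "g k = ((**) (s ** u) ^^ k) (mat 1)" for k :: nat
  have gW: "g k \<in> W" for k
    by (induction k) (auto simp: g_def one_W mult_W R_W s u)
  have gx: "g k *v x = x + (of_nat k * b s x) *s d" for k x
    by (induction k)
       (simp_all add: g_def matrix_vector_mul_assoc[symmetric] su b_simps s bd,
         simp_all add: vec_eq_iff algebra_simps)
  obtain e where e: "b s e = 1" using b_nonzero[OF s] .
  have "\<not> inj g"
    using finite_W gW by (metis finite_subset image_subset_iff infinite_UNIV_nat finite_imageD)
  then obtain k l where kl: "k \<noteq> l" "g k = g l" by (auto simp: inj_def)
  then have "(of_nat k * b s e) *s d = (of_nat l * b s e) *s d" using gx by (metis add_left_cancel)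
  then have "d = 0" using kl e by simp
  then have "a = a'" by (simp add: d_def)
  then have "s *v x = u *v x" for x by (simp add: a a')
  then show ?thesis by (simp add: matrix_eq)
qed

text \<open>A reflection carrying one reflection \<open>u\<close> of a flat to another one
  \<open>y\<close> belongs to the flat itself, so the count \<alpha>(u, y) can be made inside the
  flat. By \<open>reflection_formula\<close>, \<open>b y\<close> vanishes at \<open>v\<close> iff
  \<open>b u\<close> vanishes at \<open>s v\<close>, which leaves \<open>b s v * b u a = 0\<close>;
  and \<open>b u a = 0\<close> would force \<open>y = u\<close>.\<close>

lemma third_reflection_flat:
  assumes s: "s \<in> \<R>" and u: "u \<in> \<R>" and y: "y = s ** u ** s" "u \<noteq> y"
    and v: "b u v = 0" "b y v = 0"
  shows "b s v = 0"
proof -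
  obtain a where a: "\<And>x. s *v x = x + b s x *s a" "b s a = -2" using reflection_formula[OF s] by blast
  have yR: "y \<in> \<R>" using s u y by simp
  have fy: "b y x = 0 \<longleftrightarrow> b u (s *v x) = 0" for x
  proof -
    have "y *v x = s *v (u *v (s *v x))" by (simp add: y matrix_vector_mul_assoc matrix_mul_assoc)
    moreover have "s *v (s *v x) = x" for x using s by (simp add: matrix_vector_mul_assoc)
    ultimately have "y *v x = x \<longleftrightarrow> u *v (s *v x) = s *v x" by metis
    then show ?thesis using b_zero_iff[OF yR] b_zero_iff[OF u] by simp
  qed
  have "b u a \<noteq> 0"
  proof
    assume "b u a = 0"
    then have "b y x = 0 \<longleftrightarrow> b u x = 0" for x unfolding fy by (simp add: a b_simps u)
    then have "fixed_space y = fixed_space u" using b_zero_iff' yR u by blast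
    then show False using fixed_space_inj[OF yR u] y by simp
  qed
  moreover have "b u (s *v v) = 0" using fy v by simp
  ultimately show ?thesis using v by (simp add: a b_simps u)
qed

end

section \<open>Integrability\<close>

context reflection_group begin

text \<open>The diagonal value \<open>1 - m\<close> makes the formula
  \<open>t\<^sub>s v\<^sub>u = v_(sus) - (gram m s u) v\<^sub>s\<close> hold for
  \<open>u = s\<close> as well, where \<open>sus = s\<close>.\<close>

definition gram :: "complex \<Rightarrow> complex^'n^'n \<Rightarrow> complex^'n^'n \<Rightarrow> complex" where
  "gram m s u = (if u = s then 1 - m else of_nat (\<alpha>_count W s u))"

lemma \<alpha>_count_sym: "\<alpha>_count W s u = \<alpha>_count W u s"
proof -
  have "{y \<in> \<R>. y ** s ** y = u} = {y \<in> \<R>. y ** u ** y = s}"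
    using sus_eq_iff by auto
  then show ?thesis by (simp add: \<alpha>_count_def)
qed

lemma gram_sym: "gram m s u = gram m u s"
  by (simp add: gram_def \<alpha>_count_sym)

lemma sus_sus [simp]: "s \<in> \<R> \<Longrightarrow> s ** (s ** u ** s) ** s = u"
  by (simp only: matrix_mul_assoc R_sq R_sq_right matrix_mul_lid)

lemma sus_inj: "s \<in> \<R> \<Longrightarrow> s ** u ** s = s ** v ** s \<longleftrightarrow> u = v"
  by (metis sus_sus)

lemma conj_mult_R: "s \<in> \<R> \<Longrightarrow> s ** (u ** v) ** s = (s ** u ** s) ** (s ** v ** s)"
proof -
  assume s: "s \<in> \<R>"
  have "(s ** u ** s) ** (s ** v ** s) = s ** u ** (s ** s) ** v ** s" by (simp only: matrix_mul_assoc)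
  then show ?thesis using s by (simp only: R_sq matrix_mul_rid matrix_mul_assoc)
qed

lemma \<alpha>_count_conj:
  assumes "s \<in> \<R>"
  shows "\<alpha>_count W (s ** u ** s) (s ** v ** s) = \<alpha>_count W u v"
proof -
  have "bij_betw (\<lambda>y. s ** y ** s) {y \<in> \<R>. y ** u ** y = v} {y \<in> \<R>. y ** (s ** u ** s) ** y = s ** v ** s}"
  proof (rule bij_betw_byWitness[where f' = "\<lambda>y. s ** y ** s"])
    show "(\<lambda>y. s ** y ** s) ` {y \<in> \<R>. y ** u ** y = v} \<subseteq> {y \<in> \<R>. y ** (s ** u ** s) ** y = s ** v ** s}"
      using assms by (auto simp: conj_mult_R[symmetric])
    show "(\<lambda>y. s ** y ** s) ` {y \<in> \<R>. y ** (s ** u ** s) ** y = s ** v ** s} \<subseteq> {y \<in> \<R>. y ** u ** y = v}"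
    proof clarsimp
      fix y assume y: "y \<in> \<R>" "y ** (s ** u ** s) ** y = s ** v ** s"
      have "s ** ((s ** y ** s) ** u ** (s ** y ** s)) ** s = s ** v ** s"
        using y assms by (simp add: conj_mult_R)
      then show "s ** y ** s \<in> \<R> \<and> s ** y ** s ** u ** (s ** y ** s) = v"
        using assms y by (simp only: sus_inj sus_R simp_thms)
    qed
  qed (use assms in auto)
  then show ?thesis unfolding \<alpha>_count_def by (simp add: bij_betw_same_card)
qed

lemma gram_conj: "s \<in> \<R> \<Longrightarrow> gram m (s ** u ** s) (s ** v ** s) = gram m u v"
  by (simp add: gram_def \<alpha>_count_conj sus_inj)

lemma t_op_entry:
  assumes "s \<in> \<R>" "j \<in> \<R>"
  shows "t_op W m s i j = of_bool (i = s ** j ** s) - of_bool (i = s) * gram m s j"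
  using assms by (auto simp: t_op_def mat_of_columns_def fscale_def unit_vec_def gram_def)

lemma t_op_outside: "s \<in> \<R> \<Longrightarrow> i \<notin> \<R> \<or> j \<notin> \<R> \<Longrightarrow> t_op W m s i j = 0"
  by (auto simp: t_op_def mat_of_columns_def fscale_def unit_vec_def)

text \<open>Self-adjointness of \<open>t\<^sub>s\<close>. The left side is
  \<open>gram i (sjs) - gram i s * gram s j\<close>, which is symmetric in \<open>i\<close> and
  \<open>j\<close> because the form is symmetric and invariant under conjugation by the involution
  \<open>s\<close>.\<close>

lemma gram_t_op:
  assumes "s \<in> \<R>" "i \<in> \<R>" "j \<in> \<R>"
  shows "(\<Sum>k\<in>\<R>. gram m i k * t_op W m s k j) = (\<Sum>k\<in>\<R>. gram m j k * t_op W m s k i)"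
proof -
  have *: "(\<Sum>k\<in>\<R>. gram m i k * t_op W m s k j) = gram m i (s ** j ** s) - gram m i s * gram m s j"
    if "i \<in> \<R>" "j \<in> \<R>" for i j
    using that assms finite_R
    by (simp add: t_op_entry right_diff_distrib sum_subtractf mult.assoc[symmetric])
       (simp add: of_bool_def if_distrib[of "\<lambda>x. _ * x"] if_distrib[of "\<lambda>x. x * _"] sum.delta cong: if_cong)
  have "gram m i (s ** j ** s) = gram m j (s ** i ** s)"
    using gram_conj[of s m "s ** i ** s" j] assms gram_sym by simp
  then show ?thesis
    using *[of i j] *[of j i] gram_sym[of m i s] gram_sym[of m s j] assms by simp
qed

lemma t_op_conj:
  assumes "s \<in> \<R>" "u \<in> \<R>" "i \<in> \<R>" "j \<in> \<R>"
  shows "t_op W m (u ** s ** u) (u ** i ** u) (u ** j ** u) = t_op W m s i j"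
  using assms by (simp add: t_op_entry gram_conj conj_mult_R[symmetric] sus_inj)

end

context reflection_arrangement begin

text \<open>\<open>Q\<close> collects the reflections of a flat of codimension two.\<close>

lemma flat_sum_commutes:
  fixes m :: complex
  assumes Q: "Q \<subseteq> \<R>" and stable: "\<And>s u. s \<in> Q \<Longrightarrow> u \<in> Q \<Longrightarrow> s ** u ** s \<in> Q"
    and full: "\<And>s u y. s \<in> \<R> \<Longrightarrow> u \<in> Q \<Longrightarrow> y \<in> Q \<Longrightarrow> y = s ** u ** s \<Longrightarrow> u \<noteq> y \<Longrightarrow> s \<in> Q"
    and u: "u \<in> Q" and ij: "i \<in> \<R>" "j \<in> \<R>"
  defines "T \<equiv> \<lambda>i j. \<Sum>s\<in>Q. t_op W m s i j"
  shows "fmat_mult \<R> (t_op W m u) T i j = fmat_mult \<R> T (t_op W m u) i j"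
proof -
  have uR: "u \<in> \<R>" using u Q by auto
  have finQ: "finite Q" using Q finite_R finite_subset by auto
  have sum_bool: "(\<Sum>k\<in>A. of_bool (k = a) * f k) = (if a \<in> A then f a else (0::complex))" if "finite A" for A a and f :: "_ \<Rightarrow> complex"
    using that by (simp add: of_bool_def if_distrib[of "\<lambda>x. x * _"] sum.delta cong: if_cong)
  \<comment> \<open>Conjugation by \<open>u\<close> permutes \<open>Q\<close>, so \<open>T\<close>
    commutes with the permutation part of \<open>t\<^sub>u\<close>.\<close>
  have Tconj: "T (u ** i ** u) (u ** j ** u) = T i j" if "i \<in> \<R>" "j \<in> \<R>" for i j
  proof -
    have "T (u ** i ** u) (u ** j ** u) = (\<Sum>s\<in>Q. t_op W m (u ** s ** u) (u ** i ** u) (u ** j ** u))"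
      unfolding T_def
      by (rule sum.reindex_bij_witness[where i = "\<lambda>s. u ** s ** u" and j = "\<lambda>s. u ** s ** u"])
         (use stable u uR in auto)
    then show ?thesis using that uR Q by (auto simp: T_def t_op_conj intro!: sum.cong)
  qed
  define l where "l = T u u"
  \<comment> \<open>The vector \<open>v\<^sub>u\<close> is an eigenvector of \<open>T\<close>. For
    \<open>k \<noteq> u\<close> the coefficient of \<open>v\<^sub>k\<close> is the number of
    \<open>s\<close> in \<open>Q\<close> with \<open>sus = k\<close>, minus \<alpha>(k, u) if
    \<open>k\<close> lies in \<open>Q\<close>; by \<open>full\<close> both numbers count the same
    reflections.\<close>
  have Tcol: "T k u = of_bool (k = u) * l" if k: "k \<in> \<R>" for k
  proof (cases "k = u")
    case False
    have "T k u = of_nat (card {s \<in> Q. k = s ** u ** s}) - (\<Sum>s\<in>Q. of_bool (s = k) * gram m s u)"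
      unfolding T_def using Q uR finQ
      by (simp add: t_op_entry subset_iff sum_subtractf sum.If_cases of_bool_def Int_def eq_commute[of k]
          cong: sum.cong)
    also have "\<dots> = of_nat (card {s \<in> Q. k = s ** u ** s}) - (if k \<in> Q then of_nat (\<alpha>_count W k u) else 0)"
      using False finQ by (simp add: sum_bool gram_def)
    also have "\<dots> = 0"
    proof (cases "k \<in> Q")
      case True
      have "{s \<in> Q. k = s ** u ** s} = {s \<in> \<R>. s ** k ** s = u}"
        using full[OF _ u True] False Q sus_eq_iff by (auto simp: eq_commute)
      then show ?thesis using True by (simp add: \<alpha>_count_def)
    next
      case False
      then have "{s \<in> Q. k = s ** u ** s} = {}" using stable u by auto
      then show ?thesis using False by (simp only: card.empty if_False of_nat_0 diff_self)
    qed
    finally show ?thesis using False by simp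
  qed (simp add: l_def)
  \<comment> \<open>By self-adjointness the pairing of \<open>v\<^sub>u\<close> with
    \<open>T v\<^sub>j\<close> is that of \<open>T v\<^sub>u = l v\<^sub>u\<close> with
    \<open>v\<^sub>j\<close>.\<close>
  have GT: "(\<Sum>k\<in>\<R>. gram m u k * T k j) = l * gram m u j"
  proof -
    have "(\<Sum>k\<in>\<R>. gram m u k * T k j) = (\<Sum>s\<in>Q. \<Sum>k\<in>\<R>. gram m u k * t_op W m s k j)"
      unfolding T_def by (simp add: sum_distrib_left sum.swap[of _ Q])
    also have "\<dots> = (\<Sum>s\<in>Q. \<Sum>k\<in>\<R>. gram m j k * t_op W m s k u)"
      using Q uR ij by (intro sum.cong refl gram_t_op) auto
    also have "\<dots> = (\<Sum>k\<in>\<R>. gram m j k * T k u)"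
      unfolding T_def by (simp add: sum_distrib_left sum.swap[of _ Q])
    also have "\<dots> = (\<Sum>k\<in>\<R>. of_bool (k = u) * (gram m j k * l))"
      by (intro sum.cong refl) (simp add: Tcol mult_ac)
    also have "\<dots> = gram m j u * l" using uR finite_R by (simp add: sum_bool)
    finally show ?thesis by (simp add: gram_sym mult.commute)
  qed
  \<comment> \<open>Split \<open>t\<^sub>u = u - p\<^sub>u\<close>: the permutation part commutes
    with \<open>T\<close> by \<open>Tconj\<close>, and both products of \<open>p\<^sub>u\<close>
    with \<open>T\<close> are \<open>l p\<^sub>u\<close>, by \<open>GT\<close> and
    \<open>Tcol\<close>.\<close>
  have "fmat_mult \<R> (t_op W m u) T i j = (\<Sum>k\<in>\<R>. of_bool (k = u ** i ** u) * T k j) - of_bool (i = u) * (\<Sum>k\<in>\<R>. gram m u k * T k j)"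
    unfolding fmat_mult_def using uR ij sus_eq_iff[OF uR]
    by (simp add: t_op_entry left_diff_distrib sum_subtractf sum_distrib_left mult.assoc eq_commute cong: sum.cong)
  also have "\<dots> = T (u ** i ** u) j - of_bool (i = u) * (l * gram m u j)"
    using GT uR ij finite_R by (simp add: sum_bool)
  also have "T (u ** i ** u) j = T i (u ** j ** u)"
    using Tconj[of i "u ** j ** u"] uR ij by simp
  also have "of_bool (i = u) * (l * gram m u j) = T i u * gram m u j"
    using ij Tcol by simp
  also have "T i (u ** j ** u) - T i u * gram m u j = (\<Sum>k\<in>\<R>. of_bool (k = u ** j ** u) * T i k) - (\<Sum>k\<in>\<R>. of_bool (k = u) * (T i k * gram m u j))"
    using uR ij finite_R by (simp add: sum_bool)
  also have "\<dots> = fmat_mult \<R> T (t_op W m u) i j"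
    unfolding fmat_mult_def using uR ij
    by (simp add: t_op_entry right_diff_distrib sum_subtractf mult_ac cong: sum.cong)
  finally show ?thesis .
qed

definition flat_refl :: "(complex^'n) set \<Rightarrow> (complex^'n^'n) set" where
  "flat_refl Z = {y \<in> \<R>. Z \<subseteq> fixed_space y}"

text \<open>Otherwise \<open>b s\<close> would be a multiple of \<open>b u\<close> and both
  reflections would share their hyperplane, contrary to \<open>fixed_space_inj\<close>.\<close>

lemma distinct_not_subset:
  assumes "s \<in> \<R>" "u \<in> \<R>" "s \<noteq> u"
  obtains e where "b s e = 1" "b u e = 0"
proof -
  have "\<exists>e. b s e \<noteq> 0 \<and> b u e = 0"
  proof (rule ccontr)
    assume "\<not> ?thesis"
    then have "\<exists>c. \<forall>x. b s x = c * b u x"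
      by (intro linear_form_proportional b_linear assms) auto
    then obtain c where c: "\<And>x. b s x = c * b u x" by blast
    then have "c \<noteq> 0" using b_nonzero[OF assms(1)] by (metis mult_zero_left zero_neq_one)
    then have "fixed_space s = fixed_space u"
      using c assms b_zero_iff' by (metis (no_types) mult_eq_0_iff subsetI subset_antisym)
    then show False using fixed_space_inj assms by blast
  qed
  then obtain e where e: "b s e \<noteq> 0" "b u e = 0" by blast
  then have "b s ((1 / b s e) *s e) = 1" "b u ((1 / b s e) *s e) = 0" using assms by (simp_all add: b_simps)
  then show ?thesis by (rule that)
qed

text \<open>The coefficients are the values of \<open>b y\<close> on two vectors dual to
  \<open>b a\<close> and \<open>b c\<close>; what remains of \<open>x\<close> lies in the
  flat.\<close>

lemma flat_combination:
  assumes a: "a \<in> \<R>" "c \<in> \<R>" "a \<noteq> c" and y: "y \<in> flat_refl (fixed_space a \<inter> fixed_space c)"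
  obtains p q where "\<And>x. b y x = p * b a x + q * b c x"
proof -
  obtain e1 where e1: "b a e1 = 1" "b c e1 = 0" using distinct_not_subset a by metis
  obtain e2 where e2: "b c e2 = 1" "b a e2 = 0" using distinct_not_subset a by metis
  have yR: "y \<in> \<R>" using y by (simp add: flat_refl_def)
  have "b y x = b y e1 * b a x + b y e2 * b c x" for x
  proof -
    let ?v = "x - b a x *s e1 - b c x *s e2"
    have "b a ?v = 0" "b c ?v = 0" using e1 e2 a by (simp_all add: b_simps)
    then have "?v \<in> fixed_space a \<inter> fixed_space c" using b_zero_iff' a by auto
    then have "?v \<in> fixed_space y" using y by (auto simp: flat_refl_def)
    then have "b y ?v = 0" using b_zero_iff' yR by blast
    then show ?thesis using yR by (simp add: b_simps algebra_simps)
  qed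
  then show ?thesis using that by blast
qed

text \<open>Two distinct reflections of the flat have independent forms in the plane spanned by
  \<open>b a\<close> and \<open>b c\<close>, hence cut out \<open>Z\<close> again. So the pairs of
  distinct reflections are partitioned by their flats, which is how the sum in
  \<open>kz_integrable\<close> is grouped.\<close>

lemma flat_pairs:
  assumes a: "a \<in> \<R>" "c \<in> \<R>" "a \<noteq> c"
  defines "Z \<equiv> fixed_space a \<inter> fixed_space c"
  shows "{(s, u). s \<in> \<R> \<and> u \<in> \<R> \<and> s \<noteq> u \<and> fixed_space s \<inter> fixed_space u = Z} =
    {(s, u). s \<in> flat_refl Z \<and> u \<in> flat_refl Z \<and> s \<noteq> u}"
proof -
  have "s \<in> \<R> \<and> u \<in> \<R> \<and> s \<noteq> u \<and> fixed_space s \<inter> fixed_space u = Z"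
    if su: "s \<in> flat_refl Z" "u \<in> flat_refl Z" "s \<noteq> u" for s u
  proof -
  have R: "s \<in> \<R>" "u \<in> \<R>" using su by (auto simp: flat_refl_def)
  obtain p q where s: "\<And>x. b s x = p * b a x + q * b c x" using flat_combination[OF a su(1)[unfolded Z_def]] by blast
  obtain p' q' where u: "\<And>x. b u x = p' * b a x + q' * b c x" using flat_combination[OF a su(2)[unfolded Z_def]] by blast
  have det: "p * q' - q * p' \<noteq> 0"
  proof
    assume d: "p * q' - q * p' = 0"
    obtain e where e: "b s e = 1" "b u e = 0" using distinct_not_subset R su(3) by metis
    have "q' * b s x = q * b u x" "p' * b s x = p * b u x" for x
      using d unfolding s u by (simp_all add: algebra_simps)
    from this[of e] have "q' = 0" "p' = 0" using e by simp_all
    then have "b u x = 0" for x by (simp add: u)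
    then show False using b_nonzero[OF R(2)] by (metis zero_neq_one)
  qed
  have "fixed_space s \<inter> fixed_space u = Z"
  proof (intro subset_antisym subsetI)
    fix x assume "x \<in> fixed_space s \<inter> fixed_space u"
    then have "b s x = 0" "b u x = 0" using b_zero_iff' R by auto
    moreover have "(p * q' - q * p') * b a x = q' * b s x - q * b u x" "(p * q' - q * p') * b c x = p * b u x - p' * b s x"
      unfolding s u by (simp_all add: algebra_simps)
    ultimately have "b a x = 0" "b c x = 0" using det by simp_all
    then show "x \<in> Z" using b_zero_iff' a by (auto simp: Z_def)
  qed (use su in \<open>auto simp: flat_refl_def\<close>)
  then show ?thesis using R su by simp
  qed
  moreover have "s \<in> flat_refl Z \<and> u \<in> flat_refl Z"
    if "s \<in> \<R>" "u \<in> \<R>" "fixed_space s \<inter> fixed_space u = Z" for s u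
    using that by (auto simp: flat_refl_def)
  ultimately show ?thesis by blast
qed

text \<open>The relation \<open>b y = p * b a + q * b c\<close> also holds at the base point
  \<open>x\<close>; dividing by \<open>b y x\<close> makes the two weights sum to 1.\<close>

lemma log_form_flat:
  assumes a: "a \<in> \<R>" "c \<in> \<R>" "a \<noteq> c" and x: "x \<in> hyperplane_complement W"
    and y: "y \<in> flat_refl (fixed_space a \<inter> fixed_space c)"
  shows "\<exists>l. \<forall>v. log_form (b y) x v = l * log_form (b a) x v + (1 - l) * log_form (b c) x v"
proof -
  obtain p q where pq: "\<And>x. b y x = p * b a x + q * b c x" using flat_combination[OF a y] by blast
  have yR: "y \<in> \<R>" using y by (simp add: flat_refl_def)
  have nz: "b a x \<noteq> 0" "b c x \<noteq> 0" "b y x \<noteq> 0" using x a yR by (auto simp: X_iff)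
  have 1: "1 - p * b a x / b y x = q * b c x / b y x"
    using nz(3) by (simp add: field_simps pq)
  have "log_form (b y) x v = p * b a x / b y x * log_form (b a) x v + (1 - p * b a x / b y x) * log_form (b c) x v" for v
    unfolding 1 log_form_def pq[of v] using nz by (simp add: add_divide_distrib ring_distribs mult_ac)
  then show ?thesis by blast
qed

text \<open>On a flat all log forms are affine combinations of two, so the wedge of those of
  \<open>s\<close> and \<open>u\<close> is \<open>(l s - l u) * \<theta>\<close>. The contribution
  of the flat becomes the sum of \<open>l s * \<theta>\<close> times the commutator of
  \<open>t\<^sub>s\<close> with the sum of the \<open>t\<^sub>u\<close> over the flat, and
  \<open>flat_sum_commutes\<close> applies.\<close>

theorem kz_integrable: "integrable_form \<R> (hyperplane_complement W) (kz_form W b m)"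
  unfolding integrable_form_def
proof (intro ballI allI ext)
  fix x v w :: "complex^'n" and i j :: "complex^'n^'n"
  assume x: "x \<in> hyperplane_complement W"
  define L where "L s v = log_form (b s) x v" for s v
  define wd where "wd s u = L s v * L u w - L s w * L u v" for s u
  define S where "S s u = fmat_mult \<R> (t_op W m s) (t_op W m u) i j" for s u
  have mult: "fmat_mult \<R> (kz_form W b m x v) (kz_form W b m x w) i j = (\<Sum>s\<in>\<R>. \<Sum>u\<in>\<R>. S s u * (L s v * L u w))" for v w
  proof -
    have "fmat_mult \<R> (kz_form W b m x v) (kz_form W b m x w) i j
      = (\<Sum>k\<in>\<R>. \<Sum>s\<in>\<R>. \<Sum>u\<in>\<R>. t_op W m s i k * t_op W m u k j * (L s v * L u w))"
      by (simp add: fmat_mult_def kz_form_def L_def sum_product mult_ac)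
    also have "\<dots> = (\<Sum>s\<in>\<R>. \<Sum>k\<in>\<R>. \<Sum>u\<in>\<R>. t_op W m s i k * t_op W m u k j * (L s v * L u w))"
      by (rule sum.swap)
    also have "\<dots> = (\<Sum>s\<in>\<R>. \<Sum>u\<in>\<R>. \<Sum>k\<in>\<R>. t_op W m s i k * t_op W m u k j * (L s v * L u w))"
      by (rule sum.cong[OF refl], rule sum.swap)
    finally show ?thesis by (simp add: S_def fmat_mult_def sum_distrib_right)
  qed
  define P where "P = {(s, u). s \<in> \<R> \<and> u \<in> \<R> \<and> s \<noteq> u}"
  define h where "h = (\<lambda>(s, u). S s u * wd s u)"
  define g where "g = (\<lambda>(s, u). fixed_space s \<inter> fixed_space u :: (complex^'n) set)"
  have finP: "finite P" by (rule finite_subset[of _ "\<R> \<times> \<R>"]) (auto simp: P_def finite_R)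
  have drop_diag: "(\<Sum>s\<in>Q. \<Sum>u\<in>Q. S s u * wd s u) = (\<Sum>p\<in>{(s, u). s \<in> Q \<and> u \<in> Q \<and> s \<noteq> u}. h p)"
    if "finite Q" for Q
    unfolding sum.cartesian_product h_def
    by (rule sum.mono_neutral_right) (use that in \<open>auto simp: wd_def\<close>)
  have "(\<Sum>p\<in>{p \<in> P. g p = Z}. h p) = 0" if Z: "Z \<in> g ` P" for Z
  proof -
    obtain a c where ac: "a \<in> \<R>" "c \<in> \<R>" "a \<noteq> c" "Z = fixed_space a \<inter> fixed_space c"
      using Z by (auto simp: P_def g_def)
    define Q where "Q = flat_refl Z"
    have QR: "Q \<subseteq> \<R>" and finQ: "finite Q" using finite_R by (auto simp: Q_def flat_refl_def)
    have pairs: "{p \<in> P. g p = Z} = {(s, u). s \<in> Q \<and> u \<in> Q \<and> s \<noteq> u}"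
      using flat_pairs[OF ac(1-3)] unfolding ac(4)[symmetric] Q_def[symmetric] P_def g_def by auto
    obtain l where l: "\<And>y v. y \<in> Q \<Longrightarrow> L y v = l y * L a v + (1 - l y) * L c v"
      using log_form_flat[OF ac(1-3) x] unfolding ac(4)[symmetric] Q_def[symmetric] L_def by metis
    define \<theta> where "\<theta> = L a v * L c w - L a w * L c v"
    have wd: "wd s u = (l s - l u) * \<theta>" if "s \<in> Q" "u \<in> Q" for s u
      unfolding wd_def l[OF that(1)] l[OF that(2)] \<theta>_def by algebra
    have mem: "y \<in> Q \<longleftrightarrow> y \<in> \<R> \<and> (\<forall>x. b a x = 0 \<longrightarrow> b c x = 0 \<longrightarrow> b y x = 0)" for y
      using ac b_zero_iff' by (auto simp: Q_def flat_refl_def subset_iff)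
    have stable: "s ** u ** s \<in> Q" if "s \<in> Q" "u \<in> Q" for s u
    proof -
      have R: "s \<in> \<R>" "u \<in> \<R>" using that QR by auto
      have "b (s ** u ** s) x = 0" if "b a x = 0" "b c x = 0" for x
      proof -
        have "s *v x = x" "u *v x = x" using that \<open>s \<in> Q\<close> \<open>u \<in> Q\<close> mem b_zero_iff by blast+
        then have "(s ** u ** s) *v x = x" by (simp add: matrix_vector_mul_assoc[symmetric])
        then show ?thesis using R b_zero_iff[of "s ** u ** s"] by simp
      qed
      then show ?thesis using R by (simp add: mem)
    qed
    have full: "s \<in> Q" if "s \<in> \<R>" "u \<in> Q" "y \<in> Q" "y = s ** u ** s" "u \<noteq> y" for s u y
      using that third_reflection_flat[of s u y] QR by (subst mem) (metis mem)
    have "(\<Sum>p\<in>{p \<in> P. g p = Z}. h p) = (\<Sum>s\<in>Q. \<Sum>u\<in>Q. S s u * wd s u)"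
      unfolding pairs by (rule drop_diag[OF finQ, symmetric])
    also have "\<dots> = (\<Sum>s\<in>Q. \<Sum>u\<in>Q. S s u * l s * \<theta>) - (\<Sum>s\<in>Q. \<Sum>u\<in>Q. S s u * l u * \<theta>)"
      by (simp add: wd sum_subtractf[symmetric] algebra_simps cong: sum.cong)
    also have "(\<Sum>s\<in>Q. \<Sum>u\<in>Q. S s u * l u * \<theta>) = (\<Sum>s\<in>Q. \<Sum>u\<in>Q. S u s * l s * \<theta>)"
      by (rule sum.swap)
    also have "(\<Sum>s\<in>Q. \<Sum>u\<in>Q. S s u * l s * \<theta>) = (\<Sum>s\<in>Q. \<Sum>u\<in>Q. S u s * l s * \<theta>)"
    proof (rule sum.cong[OF refl])
      fix s assume s: "s \<in> Q"
      have "(\<Sum>u\<in>Q. S s u) = (\<Sum>u\<in>Q. S u s)"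
      proof (cases "i \<in> \<R> \<and> j \<in> \<R>")
        case True
        have "(\<Sum>u\<in>Q. S s u) = fmat_mult \<R> (t_op W m s) (\<lambda>i j. \<Sum>u\<in>Q. t_op W m u i j) i j"
          by (simp add: S_def fmat_mult_def sum_distrib_left sum.swap[of _ Q])
        also have "\<dots> = fmat_mult \<R> (\<lambda>i j. \<Sum>u\<in>Q. t_op W m u i j) (t_op W m s) i j"
          by (rule flat_sum_commutes[OF QR stable full s]) (use True in auto)
        also have "\<dots> = (\<Sum>u\<in>Q. S u s)"
          by (simp add: S_def fmat_mult_def sum_distrib_right sum.swap[of _ Q])
        finally show ?thesis .
      next
        case False
        then have "S u u' = 0" if "u \<in> Q" "u' \<in> Q" for u u'
          using that QR by (auto simp: S_def fmat_mult_def t_op_outside subset_iff intro!: sum.neutral)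
        then show ?thesis using s by simp
      qed
      then show "(\<Sum>u\<in>Q. S s u * l s * \<theta>) = (\<Sum>u\<in>Q. S u s * l s * \<theta>)"
        by (simp add: sum_distrib_right[symmetric])
    qed
    finally show ?thesis by simp
  qed
  then have "(\<Sum>Z\<in>g ` P. \<Sum>p\<in>{p \<in> P. g p = Z}. h p) = 0" by simp
  then have "sum h P = 0" using sum.group[OF finP finite_imageI[OF finP] subset_refl, of h g] by simp
  then have "(\<Sum>s\<in>\<R>. \<Sum>u\<in>\<R>. S s u * wd s u) = 0"
    using drop_diag[OF finite_R] by (simp add: P_def)
  then have "(\<Sum>s\<in>\<R>. \<Sum>u\<in>\<R>. S s u * (L s v * L u w)) - (\<Sum>s\<in>\<R>. \<Sum>u\<in>\<R>. S s u * (L s w * L u v)) = 0"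
    by (simp add: wd_def sum_subtractf[symmetric] right_diff_distrib)
  then show "wedge \<R> (kz_form W b m) (kz_form W b m) x v w i j = 0 i j"
    by (simp add: wedge_def mult)
qed

end

section \<open>The Lie algebra generated by the operators for generic m\<close>

definition fmat_bracket :: "'i set \<Rightarrow> ('i, 'a::comm_ring_1) fmat \<Rightarrow> ('i, 'a) fmat \<Rightarrow> ('i, 'a) fmat" where
  "fmat_bracket I X Y = (\<lambda>i j. fmat_mult I X Y i j - fmat_mult I Y X i j)"

definition fmat_unit :: "'i \<Rightarrow> 'i \<Rightarrow> ('i, 'a::zero_neq_one) fmat" where
  "fmat_unit a b = (\<lambda>i j. if i = a \<and> j = b then 1 else 0)"

text \<open>Commutative rings are allowed because both complex matrices and matrices over
  polynomials in \<open>m\<close> occur.\<close>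

definition lie_subalgebra :: "'i set \<Rightarrow> ('i, 'a::comm_ring_1) fmat set \<Rightarrow> bool" where
  "lie_subalgebra I L \<longleftrightarrow> (\<lambda>_ _. 0) \<in> L \<and>
     (\<forall>a. \<forall>X\<in>L. (\<lambda>i j. a * X i j) \<in> L) \<and>
     (\<forall>X\<in>L. \<forall>Y\<in>L. (\<lambda>i j. X i j + Y i j) \<in> L) \<and>
     (\<forall>X\<in>L. \<forall>Y\<in>L. fmat_bracket I X Y \<in> L)"

lemma lie_subalgebraD:
  assumes "lie_subalgebra I L"
  shows "(\<lambda>_ _. 0) \<in> L" "X \<in> L \<Longrightarrow> (\<lambda>i j. a * X i j) \<in> L"
    "X \<in> L \<Longrightarrow> Y \<in> L \<Longrightarrow> (\<lambda>i j. X i j + Y i j) \<in> L"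
    "X \<in> L \<Longrightarrow> Y \<in> L \<Longrightarrow> fmat_bracket I X Y \<in> L"
  using assms unfolding lie_subalgebra_def by blast+

inductive_set lie_closure :: "'i set \<Rightarrow> ('i, 'a::comm_ring_1) fmat set \<Rightarrow> ('i, 'a) fmat set"
  for I S where
  gen: "X \<in> S \<Longrightarrow> X \<in> lie_closure I S"
| zero: "(\<lambda>_ _. 0) \<in> lie_closure I S"
| scale: "X \<in> lie_closure I S \<Longrightarrow> (\<lambda>i j. a * X i j) \<in> lie_closure I S"
| add: "X \<in> lie_closure I S \<Longrightarrow> Y \<in> lie_closure I S \<Longrightarrow> (\<lambda>i j. X i j + Y i j) \<in> lie_closure I S"
| bracket: "X \<in> lie_closure I S \<Longrightarrow> Y \<in> lie_closure I S \<Longrightarrow> fmat_bracket I X Y \<in> lie_closure I S"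

lemma lie_subalgebra_sum:
  assumes L: "lie_subalgebra I L" and "finite A" "\<And>a. a \<in> A \<Longrightarrow> f a \<in> L"
  shows "(\<lambda>i j. \<Sum>a\<in>A. f a i j) \<in> L"
  using assms(2,3)
proof (induction A rule: finite_induct)
  case empty show ?case using lie_subalgebraD(1)[OF L] by simp
next
  case (insert x F)
  then have "(\<lambda>i j. f x i j + (\<Sum>a\<in>F. f a i j)) \<in> L"
    by (intro lie_subalgebraD(3)[OF L]) auto
  then show ?case using insert by simp
qed

lemma fmats_subset_lie:
  assumes "finite I" "lie_subalgebra I L" "\<And>a b. a \<in> I \<Longrightarrow> b \<in> I \<Longrightarrow> fmat_unit a b \<in> L"
  shows "fmats I \<subseteq> L"
proof
  fix X :: "('a, 'b) fmat" assume X: "X \<in> fmats I"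
  have "(\<lambda>i j. \<Sum>p\<in>I\<times>I. (\<lambda>i j. X (fst p) (snd p) * fmat_unit (fst p) (snd p) i j) i j) \<in> L"
    using assms(1,3) by (intro lie_subalgebra_sum[OF assms(2)] lie_subalgebraD(2)[OF assms(2)]) auto
  also have "(\<lambda>i j. \<Sum>p\<in>I\<times>I. (\<lambda>i j. X (fst p) (snd p) * fmat_unit (fst p) (snd p) i j) i j) = X"
  proof (intro ext)
    fix i j
    have "(\<Sum>p\<in>I\<times>I. X (fst p) (snd p) * fmat_unit (fst p) (snd p) i j) = (\<Sum>p\<in>I\<times>I. if p = (i, j) then X i j else 0)"
      by (intro sum.cong refl) (auto simp: fmat_unit_def)
    also have "\<dots> = X i j" using X assms(1) by (auto simp: fmats_def)
    finally show "(\<Sum>p\<in>I\<times>I. (\<lambda>i j. X (fst p) (snd p) * fmat_unit (fst p) (snd p) i j) i j) = X i j" by simp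
  qed
  finally show "X \<in> L" .
qed

section \<open>Leading coefficients in the parameter\<close>

lemma coeff_mult_top:
  fixes p q :: "'a::comm_ring_1 poly"
  assumes "degree p \<le> k" "degree q \<le> l"
  shows "coeff (p * q) (k + l) = coeff p k * coeff q l"
proof -
  have "coeff (p * q) (k + l) = (\<Sum>i\<le>k + l. if i = k then coeff p k * coeff q l else 0)"
    unfolding coeff_mult
  proof (intro sum.cong refl)
    fix i assume "i \<in> {..k + l}"
    consider "i < k" | "i = k" | "i > k" by linarith
    then show "coeff p i * coeff q (k + l - i) = (if i = k then coeff p k * coeff q l else 0)"
    proof cases
      case 1 then have "degree q < k + l - i" using assms by linarith
      then show ?thesis using 1 by (simp add: coeff_eq_0)
    next
      case 3 then have "degree p < i" using assms by linarith
      then show ?thesis using 3 by (simp add: coeff_eq_0)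
    qed simp
  qed
  then show ?thesis by simp
qed

text \<open>The number \<open>k\<close> only bounds the degrees and \<open>x\<close> may be zero;
  this is what makes the coefficient vectors of polynomial elements closed under sums and
  brackets.\<close>

definition top_coeff :: "('j \<Rightarrow> 'a::comm_ring_1 poly) \<Rightarrow> nat \<Rightarrow> ('j \<Rightarrow> 'a) \<Rightarrow> bool" where
  "top_coeff Y k x \<longleftrightarrow> (\<forall>j. degree (Y j) \<le> k \<and> coeff (Y j) k = x j)"

text \<open>Fraction-free Gaussian elimination; the leading terms certify that the pivots do not vanish.\<close>

lemma top_coeff_elimination:
  fixes M :: "('j \<Rightarrow> 'a::idom poly) set"
  assumes fin: "finite J"
    and comb: "\<And>p q Y Z. Y \<in> M \<Longrightarrow> Z \<in> M \<Longrightarrow> (\<lambda>j. p * Y j - q * Z j) \<in> M"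
    and top: "\<And>j. j \<in> J \<Longrightarrow> \<exists>k. \<exists>Y\<in>M. top_coeff Y k (\<lambda>l. of_bool (l = j))"
  shows "\<forall>j\<in>J. \<exists>Y\<in>M. Y j \<noteq> 0 \<and> (\<forall>l\<in>J. l \<noteq> j \<longrightarrow> Y l = 0)"
proof -
  \<comment> \<open>Induction on the set \<open>J'\<close> of positions already cleared, while the
    leading vector remains a basis vector throughout.\<close>
  have "\<forall>j\<in>J. \<exists>k. \<exists>Y\<in>M. top_coeff Y k (\<lambda>l. of_bool (l = j)) \<and> (\<forall>l\<in>J'. l \<noteq> j \<longrightarrow> Y l = 0)" if "finite J'" "J' \<subseteq> J" for J'
    using that
  proof (induction J' rule: finite_induct)
    case empty then show ?case using top by simp
  next
    case (insert l J')
    show ?case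
    proof
      fix j assume j: "j \<in> J"
      obtain k Y where Y: "Y \<in> M" "top_coeff Y k (\<lambda>l. of_bool (l = j))" "\<And>i. i \<in> J' \<Longrightarrow> i \<noteq> j \<Longrightarrow> Y i = 0"
        using insert j by blast
      obtain k' Z where Z: "Z \<in> M" "top_coeff Z k' (\<lambda>i. of_bool (i = l))" "\<And>i. i \<in> J' \<Longrightarrow> i \<noteq> l \<Longrightarrow> Z i = 0"
        using insert by blast
      show "\<exists>k. \<exists>Y\<in>M. top_coeff Y k (\<lambda>l. of_bool (l = j)) \<and> (\<forall>i\<in>insert l J'. i \<noteq> j \<longrightarrow> Y i = 0)"
      proof (cases "j = l")
        case True
        then show ?thesis using Y by blast
      next
        case False
        \<comment> \<open>\<open>U\<close> clears position \<open>l\<close>. In degree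
          \<open>k' + k\<close> the factor \<open>Z l\<close> has coefficient 1 and
          \<open>Y l\<close> has coefficient 0, as \<open>l \<noteq> j\<close>, so the leading
          vector of \<open>U\<close> is again that of \<open>Y\<close>.\<close>
        define U where "U = (\<lambda>i. Z l * Y i - Y l * Z i)"
        have "U \<in> M" unfolding U_def by (rule comb[OF Y(1) Z(1)])
        moreover have "top_coeff U (k' + k) (\<lambda>l. of_bool (l = j))"
          unfolding top_coeff_def
        proof (intro allI conjI)
          fix i
          have d: "degree (Z i) \<le> k'" "degree (Y i) \<le> k" for i using Y(2) Z(2) by (auto simp: top_coeff_def)
          have "degree (Z l * Y i) \<le> k' + k" "degree (Y l * Z i) \<le> k' + k"
            using d[of i] d[of l] degree_mult_le[of "Z l" "Y i"] degree_mult_le[of "Y l" "Z i"] by linarith+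
          then show "degree (U i) \<le> k' + k" by (simp add: U_def degree_diff_le)
          have "coeff (U i) (k' + k) = coeff (Z l) k' * coeff (Y i) k - coeff (Y l) k * coeff (Z i) k'"
            using coeff_mult_top[OF d(1)[of l] d(2)[of i]] coeff_mult_top[OF d(2)[of l] d(1)[of i]]
            by (simp add: U_def add.commute)
          also have "\<dots> = of_bool (i = j)" using Y(2) Z(2) False by (simp add: top_coeff_def)
          finally show "coeff (U i) (k' + k) = of_bool (i = j)" .
        qed
        moreover have "U i = 0" if "i \<in> insert l J'" "i \<noteq> j" for i
          using that Y(3)[of i] Z(3)[of i] by (cases "i = l") (auto simp: U_def mult.commute)
        ultimately show ?thesis by blast
      qed
    qed
  qed
  from this[OF fin subset_refl] have *: "\<forall>j\<in>J. \<exists>k. \<exists>Y\<in>M. top_coeff Y k (\<lambda>l. of_bool (l = j)) \<and> (\<forall>l\<in>J. l \<noteq> j \<longrightarrow> Y l = 0)" .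
  show ?thesis
  proof
    fix j assume "j \<in> J"
    then obtain k Y where Y: "Y \<in> M" "top_coeff Y k (\<lambda>l. of_bool (l = j))" "\<forall>l\<in>J. l \<noteq> j \<longrightarrow> Y l = 0" using * by blast
    then have "coeff (Y j) k = 1" by (simp add: top_coeff_def)
    then have "Y j \<noteq> 0" by auto
    then show "\<exists>Y\<in>M. Y j \<noteq> 0 \<and> (\<forall>l\<in>J. l \<noteq> j \<longrightarrow> Y l = 0)" using Y by blast
  qed
qed

text \<open>Leading coefficients multiply, which handles brackets. For sums the two nominal degrees
  are first made equal by multiplying with monomials, which are scalars for
  \<open>P\<close>.\<close>

lemma top_coeff_lie_subalgebra:
  fixes P :: "('i, 'a::comm_ring_1 poly) fmat set"
  assumes P: "lie_subalgebra I P" and fin: "finite I"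
  shows "lie_subalgebra I {X. \<exists>k. \<exists>Y\<in>P. \<forall>i. top_coeff (Y i) k (X i)}" (is "lie_subalgebra I ?G")
  unfolding lie_subalgebra_def
proof (intro conjI ballI allI)
  have "(\<lambda>_ _. 0) \<in> P" by (rule lie_subalgebraD[OF P])
  then show "(\<lambda>_ _. 0) \<in> ?G" by (auto simp: top_coeff_def intro!: exI[of _ 0] bexI[of _ "\<lambda>_ _. 0"])
next
  fix a X assume "X \<in> ?G"
  then obtain k Y where Y: "Y \<in> P" "\<forall>i. top_coeff (Y i) k (X i)" by blast
  have "(\<lambda>i j. [:a:] * Y i j) \<in> P" by (rule lie_subalgebraD(2)[OF P Y(1)])
  moreover have "\<forall>i. top_coeff (\<lambda>j. [:a:] * Y i j) k (\<lambda>j. a * X i j)"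
    using Y by (auto simp: top_coeff_def intro: order.trans[OF degree_smult_le])
  ultimately show "(\<lambda>i j. a * X i j) \<in> ?G"
    by (intro CollectI exI[of _ k] bexI[of _ "\<lambda>i j. [:a:] * Y i j"])
next
  fix X1 X2 assume "X1 \<in> ?G" "X2 \<in> ?G"
  then obtain k1 Y1 k2 Y2 where Y: "Y1 \<in> P" "\<forall>i. top_coeff (Y1 i) k1 (X1 i)" "Y2 \<in> P" "\<forall>i. top_coeff (Y2 i) k2 (X2 i)" by blast
  have d: "degree (Y1 i j) \<le> k1" "degree (Y2 i j) \<le> k2" "coeff (Y1 i j) k1 = X1 i j" "coeff (Y2 i j) k2 = X2 i j" for i j
    using Y by (auto simp: top_coeff_def)
  have "(\<lambda>i j. monom 1 k2 * Y1 i j + monom 1 k1 * Y2 i j) \<in> P" by (intro lie_subalgebraD(2,3)[OF P] Y(1) Y(3))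
  moreover have "\<forall>i. top_coeff (\<lambda>j. monom 1 k2 * Y1 i j + monom 1 k1 * Y2 i j) (k2 + k1) (\<lambda>j. X1 i j + X2 i j)"
    unfolding top_coeff_def
  proof (intro allI conjI)
    fix i j
    have "degree (monom 1 k2 * Y1 i j) \<le> k2 + k1" "degree (monom 1 k1 * Y2 i j) \<le> k2 + k1"
      using d[of i j] degree_mult_le[of "monom 1 k2" "Y1 i j"] degree_mult_le[of "monom 1 k1" "Y2 i j"]
        degree_monom_le[of "1::'a" k1] degree_monom_le[of "1::'a" k2] by linarith+
    then show "degree (monom 1 k2 * Y1 i j + monom 1 k1 * Y2 i j) \<le> k2 + k1" by (rule degree_add_le)
    show "coeff (monom 1 k2 * Y1 i j + monom 1 k1 * Y2 i j) (k2 + k1) = X1 i j + X2 i j"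
      by (simp add: coeff_monom_mult d)
  qed
  ultimately show "(\<lambda>i j. X1 i j + X2 i j) \<in> ?G"
    by (intro CollectI exI[of _ "k2 + k1"] bexI[of _ "\<lambda>i j. monom 1 k2 * Y1 i j + monom 1 k1 * Y2 i j"])
  have mult: "degree (fmat_mult I Y Z i j) \<le> k + l \<and> coeff (fmat_mult I Y Z i j) (k + l) = fmat_mult I X X' i j"
    if Y: "\<And>i j. degree (Y i j) \<le> k" "\<And>i j. coeff (Y i j) k = X i j"
      and Z: "\<And>i j. degree (Z i j) \<le> l" "\<And>i j. coeff (Z i j) l = X' i j"
    for Y Z :: "('i, 'a poly) fmat" and X X' k l i j
  proof
    have "degree (Y i p * Z p j) \<le> k + l" for p
      using degree_mult_le[of "Y i p" "Z p j"] Y(1)[of i p] Z(1)[of p j] by linarith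
    then show "degree (fmat_mult I Y Z i j) \<le> k + l"
      unfolding fmat_mult_def by (intro degree_sum_le fin)
    show "coeff (fmat_mult I Y Z i j) (k + l) = fmat_mult I X X' i j"
      unfolding fmat_mult_def coeff_sum by (intro sum.cong refl) (simp add: coeff_mult_top Y Z)
  qed
  have "fmat_bracket I Y1 Y2 \<in> P" by (rule lie_subalgebraD(4)[OF P Y(1,3)])
  moreover have "\<forall>i. top_coeff (fmat_bracket I Y1 Y2 i) (k1 + k2) (fmat_bracket I X1 X2 i)"
    using mult[OF d(1,3) d(2,4)] mult[OF d(2,4) d(1,3)]
    by (simp add: top_coeff_def fmat_bracket_def degree_diff_le add.commute[of k2])
  ultimately show "fmat_bracket I X1 X2 \<in> ?G" by blast
qed

lemma fmat_mult_unit_left: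
  assumes "finite I" "b \<in> I"
  shows "fmat_mult I (fmat_unit a b) X i j = (if i = a then X b j else (0::'a::comm_ring_1))"
proof -
  have "fmat_mult I (fmat_unit a b) X i j = (\<Sum>k\<in>I. if k = b then (if i = a then X b j else 0) else 0)"
    unfolding fmat_mult_def by (intro sum.cong refl) (simp add: fmat_unit_def)
  then show ?thesis using assms by simp
qed

lemma fmat_mult_unit_right:
  assumes "finite I" "a \<in> I"
  shows "fmat_mult I X (fmat_unit a b) i j = (if j = b then X i a else (0::'a::comm_ring_1))"
proof -
  have "fmat_mult I X (fmat_unit a b) i j = (\<Sum>k\<in>I. if k = a then (if j = b then X i a else 0) else 0)"
    unfolding fmat_mult_def by (intro sum.cong refl) (simp add: fmat_unit_def)
  then show ?thesis using assms by simp
qed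

text \<open>The matrix units with equal indices span a torus; its weights separate the off-diagonal entries.\<close>

lemma lie_subalgebra_extract_unit:
  fixes L :: "('i, 'a::field_char_0) fmat set"
  assumes L: "lie_subalgebra I L" and fin: "finite I" and ab: "a \<in> I" "b \<in> I" "a \<noteq> b"
    and diag: "fmat_unit a a \<in> L" "fmat_unit b b \<in> L" and X: "X \<in> L" "X a b = 1"
  shows "fmat_unit a b \<in> L"
proof -
  have ad: "fmat_bracket I (fmat_unit p p) Y = (\<lambda>i j. (of_bool (i = p) - of_bool (j = p)) * Y i j)"
    if "p \<in> I" for p and Y :: "('i, 'a) fmat"
    using that fin by (auto simp: fmat_bracket_def fmat_mult_unit_left fmat_mult_unit_right fun_eq_iff)
  \<comment> \<open>Bracketing with the units at \<open>(a, a)\<close> and \<open>(b, b)\<close>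
    leaves only the entries at \<open>(a, b)\<close> and \<open>(b, a)\<close>, both with factor -1.
    A further bracket with the unit at \<open>(a, a)\<close> keeps the sign of the first and flips
    that of the second, so \<open>Y + Z\<close> is -2 times the unit at
    \<open>(a, b)\<close>.\<close>
  define Y where "Y = fmat_bracket I (fmat_unit b b) (fmat_bracket I (fmat_unit a a) X)"
  define Z where "Z = fmat_bracket I (fmat_unit a a) Y"
  have YZ: "Y \<in> L" "Z \<in> L" unfolding Y_def Z_def by (intro lie_subalgebraD(4)[OF L] diag X)+
  have "(\<lambda>i j. (- 1 / 2) * (Y i j + Z i j)) \<in> L" by (intro lie_subalgebraD(2,3)[OF L] YZ)
  also have "(\<lambda>i j. (- 1 / 2) * (Y i j + Z i j)) = fmat_unit a b"
    unfolding Y_def Z_def ad[OF ab(1)] ad[OF ab(2)]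
    using ab X(2) by (auto simp: fmat_unit_def fun_eq_iff)
  finally show ?thesis .
qed

section \<open>Conjugacy classes of reflections and generation of the full matrix algebra\<close>

context reflection_group begin

lemma class_orbit:
  assumes "c \<in> reflection_classes W" "a \<in> c"
  shows "c = (\<lambda>w. conj_by w a) ` W"
proof -
  obtain s where s: "s \<in> \<R>" "c = (\<lambda>w. conj_by w s) ` W" using assms(1) by (auto simp: reflection_classes_def)
  obtain v where v: "v \<in> W" "a = conj_by v s" using assms(2) s by auto
  show ?thesis
  proof (intro subset_antisym subsetI)
    fix x assume "x \<in> c"
    then obtain w where w: "w \<in> W" "x = conj_by w s" using s by auto
    have "x = conj_by (w ** matrix_inv v) a" using w v by (simp add: conj_by_mult inv_W conj_by_inv)
    then show "x \<in> (\<lambda>w. conj_by w a) ` W" using w v mult_W inv_W by blast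
  next
    fix x assume "x \<in> (\<lambda>w. conj_by w a) ` W"
    then obtain w where w: "w \<in> W" "x = conj_by w a" by auto
    then have "x = conj_by (w ** v) s" using v by (simp add: conj_by_mult)
    then show "x \<in> c" using s w v mult_W by blast
  qed
qed

lemma class_subset: "c \<in> reflection_classes W \<Longrightarrow> c \<subseteq> \<R>"
  by (auto simp: reflection_classes_def conj_R)

lemma class_finite: "c \<in> reflection_classes W \<Longrightarrow> finite c"
  using class_subset finite_R finite_subset by blast

lemma class_conj: "c \<in> reflection_classes W \<Longrightarrow> a \<in> c \<Longrightarrow> w \<in> W \<Longrightarrow> conj_by w a \<in> c"
  using class_orbit by blast

lemma class_sus: "c \<in> reflection_classes W \<Longrightarrow> a \<in> c \<Longrightarrow> s \<in> \<R> \<Longrightarrow> s ** a ** s \<in> c"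
  using class_conj[of c a s] R_W by (simp add: conj_by_R)

lemma class_nonempty: "c \<in> reflection_classes W \<Longrightarrow> \<exists>a. a \<in> c"
  using one_W by (auto simp: reflection_classes_def)

lemma sus_neq: "s \<in> \<R> \<Longrightarrow> a \<noteq> s \<Longrightarrow> s ** a ** s \<noteq> s"
  using sus_inj[of s a s] by simp

lemma usu_neq: "u \<in> \<R> \<Longrightarrow> a \<in> \<R> \<Longrightarrow> u \<noteq> a \<Longrightarrow> u ** a ** u \<noteq> u"
  using sus_neq by metis

text \<open>Here \<open>P\<close> is the Lie algebra over polynomials in \<open>m\<close> generated
  by the blocks of the \<open>t\<^sub>s\<close>, and \<open>G\<close> the complex Lie algebra of its
  leading matrices. Once \<open>G\<close> contains all matrix units, elimination finds for every
  position an element of \<open>P\<close> supported there; the exceptional \<open>m\<close> are the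
  roots of these entries.\<close>

theorem generic_lie_generation:
  assumes c: "c \<in> reflection_classes W"
  shows "\<exists>M. finite M \<and> (\<forall>m. m \<notin> M \<longrightarrow> (\<forall>L. lie_subalgebra c L \<and>
    (\<forall>s\<in>\<R>. restrict_fmat c (t_op W m s) \<in> L) \<longrightarrow> fmats c \<subseteq> L))"
proof -
  have fin: "finite c" by (rule class_finite[OF c])
  have cR: "x \<in> \<R>" if "x \<in> c" for x using class_subset[OF c] that by auto
  \<comment> \<open>The entry at \<open>(s, s)\<close> is \<open>m\<close> itself; the others do not
    depend on \<open>m\<close> and are taken at \<open>m = 0\<close>.\<close>
  define tp :: "complex^'n^'n \<Rightarrow> (complex^'n^'n, complex poly) fmat" where
    "tp s = (\<lambda>i j. if i \<in> c \<and> j \<in> c then if i = s \<and> j = s then [:0, 1:] else [:t_op W 0 s i j:] else 0)" for s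
  have tp_eval: "poly (tp s i j) m = restrict_fmat c (t_op W m s) i j" if "s \<in> \<R>" for s i j m
    using that by (auto simp: tp_def restrict_fmat_def t_op_entry cR gram_def)
  define P where "P = lie_closure c (tp ` \<R>)"
  have P: "lie_subalgebra c P"
    unfolding lie_subalgebra_def P_def by (auto intro: lie_closure.intros)
  have Pc: "Y \<in> fmats c" if "Y \<in> P" for Y
    using that unfolding P_def
    by (induction rule: lie_closure.induct) (auto simp: fmats_def tp_def fmat_bracket_def fmat_mult_def)
  have tpP: "tp s \<in> P" if "s \<in> \<R>" for s using that by (auto simp: P_def intro: lie_closure.gen)
  define G where "G = {X :: (complex^'n^'n, complex) fmat. \<exists>k. \<exists>Y\<in>P. \<forall>i. top_coeff (Y i) k (X i)}"
  have G: "lie_subalgebra c G" unfolding G_def by (rule top_coeff_lie_subalgebra[OF P fin])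
  have diag: "fmat_unit a a \<in> G" if a: "a \<in> c" for a
  proof -
    have "\<forall>i. top_coeff (tp a i) 1 (fmat_unit a a i)"
      using a by (auto simp: top_coeff_def tp_def fmat_unit_def)
    then show ?thesis using tpP[OF cR[OF a]] by (auto simp: G_def)
  qed
  \<comment> \<open>In the \<open>(a, d)\<close> entry of the bracket of \<open>t\<^sub>a\<close>
    and \<open>t\<^sub>u\<close>, with \<open>d = uau\<close>, the parameter enters only through the
    \<open>(a, a)\<close> entry of \<open>t\<^sub>a\<close>. Its partner is the
    \<open>(a, d)\<close> entry of \<open>t\<^sub>u\<close>, which is 1, so \<open>m\<close> has
    coefficient 1 there and the torus isolates this position.\<close>
  have step: "fmat_unit a (u ** a ** u) \<in> G" if a: "a \<in> c" and u: "u \<in> \<R>" "u \<noteq> a" "u ** a ** u \<noteq> a" for a u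
  proof -
    define d where "d = u ** a ** u"
    have d: "d \<in> c" "d \<noteq> u" "d \<noteq> a" using class_sus[OF c a u(1)] usu_neq[OF u(1) cR[OF a] u(2)] u by (auto simp: d_def)
    define Y where "Y = fmat_bracket c (tp a) (tp u)"
    have const: "degree (tp s i j) = 0" "coeff (tp s i j) 1 = 0" if "\<not> (i = s \<and> j = s)" for s i j
      using that by (auto simp: tp_def)
    have deg1: "degree (tp s i j) \<le> 1" for s i j by (auto simp: tp_def)
    \<comment> \<open>The entries containing \<open>m\<close> sit at \<open>(s, s)\<close> and
      \<open>(s', s')\<close>; a product of an \<open>(i, k)\<close> entry with a
      \<open>(k, j)\<close> entry meets at most one of them.\<close>
    have prod: "degree (tp s i k * tp s' k j) \<le> 1" if "s \<noteq> s'" for s s' i j k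
    proof -
      have "degree (tp s i k) + degree (tp s' k j) \<le> 1"
        using that const(1)[of i s k] const(1)[of k s' j] deg1[of s i k] deg1[of s' k j]
        by (cases "i = s \<and> k = s") auto
      then show ?thesis using degree_mult_le[of "tp s i k" "tp s' k j"] by linarith
    qed
    have "degree (Y i j) \<le> 1" for i j
      unfolding Y_def fmat_bracket_def fmat_mult_def
      by (intro degree_diff_le degree_sum_le fin prod) (use u in auto)
    then have top: "\<forall>i. top_coeff (Y i) 1 (\<lambda>j. coeff (Y i j) 1)" by (simp add: top_coeff_def)
    have "coeff (fmat_mult c (tp a) (tp u) a d) 1 = (\<Sum>k\<in>c. if k = a then 1 else 0)"
      unfolding fmat_mult_def coeff_sum
    proof (intro sum.cong refl)
      fix k assume k: "k \<in> c"
      show "coeff (tp a a k * tp u k d) 1 = (if k = a then 1 else 0)"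
      proof (cases "k = a")
        case True
        have "t_op W 0 u a d = 1" using u a d cR by (simp add: t_op_entry d_def)
        then have "tp u a d = 1" using a d u by (simp add: tp_def pCons_one)
        then show ?thesis using True a by (simp add: tp_def)
      next
        case False
        then have "degree (tp a a k * tp u k d) = 0"
          using const(1)[of a a k] const(1)[of k u d] d degree_mult_le[of "tp a a k" "tp u k d"] by auto
        then show ?thesis using False by (simp add: coeff_eq_0)
      qed
    qed
    moreover have "coeff (fmat_mult c (tp u) (tp a) a d) 1 = 0"
      unfolding fmat_mult_def coeff_sum
    proof (intro sum.neutral ballI)
      fix k
      have "degree (tp u a k * tp a k d) = 0"
        using const(1)[of a u k] const(1)[of k a d] d u degree_mult_le[of "tp u a k" "tp a k d"] by auto
      then show "coeff (tp u a k * tp a k d) 1 = 0" by (simp add: coeff_eq_0)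
    qed
    ultimately have 1: "coeff (Y a d) 1 = 1" using a fin by (simp add: Y_def fmat_bracket_def)
    have "Y \<in> P" unfolding Y_def by (intro lie_subalgebraD(4)[OF P] tpP cR a u)
    then have "(\<lambda>i j. coeff (Y i j) 1) \<in> G" using top unfolding G_def by blast
    then show ?thesis
      using lie_subalgebra_extract_unit[OF G fin a d(1) _ diag[OF a] diag[OF d(1)], of "\<lambda>i j. coeff (Y i j) 1"] d 1
      by (auto simp: d_def)
  qed
  \<comment> \<open>The \<open>d\<close> whose unit at \<open>(a, d)\<close> lies in
    \<open>G\<close> are stable under conjugation by reflections: if \<open>a\<close>,
    \<open>x\<close> and \<open>d = uxu\<close> are distinct, the bracket of the units at
    \<open>(a, x)\<close> and \<open>(x, d)\<close> is the unit at \<open>(a, d)\<close>.\<close>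
  have units: "fmat_unit a d \<in> G" if a: "a \<in> c" and "d \<in> c" for a d
  proof -
    have "conj_by w a \<in> {d \<in> c. fmat_unit a d \<in> G}" if "w \<in> W" for w
      using _ that
    proof (rule conj_closed)
      fix u x assume u: "u \<in> \<R>" and x: "x \<in> {d \<in> c. fmat_unit a d \<in> G}"
      let ?d = "u ** x ** u"
      have d: "?d \<in> c" using x class_sus[OF c _ u] by simp
      consider "u = x" | "?d = x" | "?d = a" | "a = x" "u \<noteq> x" "?d \<noteq> x" | "u \<noteq> x" "?d \<noteq> x" "?d \<noteq> a" "a \<noteq> x" by blast
      then have "fmat_unit a ?d \<in> G"
      proof cases
        case 5
        have "fmat_bracket c (fmat_unit a x) (fmat_unit x ?d) \<in> G"
          using x u 5 by (intro lie_subalgebraD(4)[OF G] step) auto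
        moreover have "fmat_bracket c (fmat_unit a x) (fmat_unit x ?d) = (fmat_unit a ?d :: (complex^'n^'n, complex) fmat)"
          using x a d 5 fin by (auto simp: fmat_bracket_def fmat_mult_unit_left fun_eq_iff) (auto simp: fmat_unit_def)
        ultimately show ?thesis by simp
      qed (use x u diag[OF a] step[OF a] in auto)
      then show "?d \<in> {d \<in> c. fmat_unit a d \<in> G}" using d by simp
    qed (use a diag in auto)
    then show ?thesis using class_orbit[OF c a] that by blast
  qed
  \<comment> \<open>Matrices are flattened to vectors indexed by \<open>c \<times> c\<close>, the
    shape in which the elimination is stated.\<close>
  define M where "M = {(\<lambda>p. Y (fst p) (snd p)) | Y. Y \<in> P}"
  have "\<forall>p\<in>c\<times>c. \<exists>Y\<in>M. Y p \<noteq> 0 \<and> (\<forall>l\<in>c\<times>c. l \<noteq> p \<longrightarrow> Y l = 0)"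
  proof (rule top_coeff_elimination)
    fix p q Y Z assume "Y \<in> M" "Z \<in> M"
    then obtain Y' Z' where YZ: "Y = (\<lambda>p. Y' (fst p) (snd p))" "Z = (\<lambda>p. Z' (fst p) (snd p))" "Y' \<in> P" "Z' \<in> P"
      by (auto simp: M_def)
    have "(\<lambda>i j. p * Y' i j + (- q) * Z' i j) \<in> P" by (intro lie_subalgebraD(2,3)[OF P] YZ)
    then show "(\<lambda>j. p * Y j - q * Z j) \<in> M" unfolding M_def YZ by auto
  next
    fix p assume "p \<in> c \<times> c"
    then have "fmat_unit (fst p) (snd p) \<in> G" using units by auto
    then obtain k Y where Y: "Y \<in> P" "\<And>i. top_coeff (Y i) k (fmat_unit (fst p) (snd p) i)" by (auto simp: G_def)
    then have "top_coeff (\<lambda>p. Y (fst p) (snd p)) k (\<lambda>l. of_bool (l = p))"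
      by (auto simp: top_coeff_def fmat_unit_def prod_eq_iff)
    then show "\<exists>k. \<exists>Y\<in>M. top_coeff Y k (\<lambda>l. of_bool (l = p))" using Y(1) by (auto simp: M_def)
  qed (use fin in auto)
  then have el: "\<exists>Y\<in>M. Y p \<noteq> 0 \<and> (\<forall>l\<in>c\<times>c. l \<noteq> p \<longrightarrow> Y l = 0)" if "p \<in> c \<times> c" for p
    using that by (rule bspec)
  have "\<exists>Y. Y \<in> P \<and> Y (fst p) (snd p) \<noteq> 0 \<and> (\<forall>l\<in>c\<times>c. l \<noteq> p \<longrightarrow> Y (fst l) (snd l) = 0)"
    if pc: "p \<in> c \<times> c" for p
  proof -
    obtain Z where Z: "Z \<in> M" "Z p \<noteq> 0" "\<forall>l\<in>c\<times>c. l \<noteq> p \<longrightarrow> Z l = 0" using el[OF pc] by blast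
    obtain Y where Y: "Y \<in> P" "Z = (\<lambda>p. Y (fst p) (snd p))" using Z(1) unfolding M_def by blast
    show ?thesis using Y(1) Z(2,3) unfolding Y(2) by blast
  qed
  then obtain F where F: "\<And>p. p \<in> c \<times> c \<Longrightarrow> F p \<in> P \<and> F p (fst p) (snd p) \<noteq> 0 \<and> (\<forall>l\<in>c\<times>c. l \<noteq> p \<longrightarrow> F p (fst l) (snd l) = 0)"
    by metis
  define B where "B = (\<Union>p\<in>c\<times>c. {m. poly (F p (fst p) (snd p)) m = 0})"
  have "finite B" unfolding B_def using F fin by (auto intro!: poly_roots_finite)
  moreover have "fmats c \<subseteq> L" if m: "m \<notin> B" and L: "lie_subalgebra c L" "\<forall>s\<in>\<R>. restrict_fmat c (t_op W m s) \<in> L" for m L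
  proof -
    \<comment> \<open>Evaluation at \<open>m\<close> is a ring homomorphism, so it respects brackets
      and carries \<open>P\<close> into \<open>L\<close>.\<close>
    have eval: "(\<lambda>i j. poly (Y i j) m) \<in> L" if "Y \<in> P" for Y
      using that unfolding P_def
    proof (induction rule: lie_closure.induct)
      case (gen X)
      then obtain s where s: "s \<in> \<R>" "X = tp s" by auto
      then have "(\<lambda>i j. poly (X i j) m) = restrict_fmat c (t_op W m s)" by (simp add: tp_eval fun_eq_iff)
      then show ?case using L s by simp
    next
      case (bracket X Y)
      have "(\<lambda>i j. poly (fmat_bracket c X Y i j) m) = fmat_bracket c (\<lambda>i j. poly (X i j) m) (\<lambda>i j. poly (Y i j) m)"
        by (simp add: fmat_bracket_def fmat_mult_def fun_eq_iff poly_sum)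
      then show ?case using lie_subalgebraD(4)[OF L(1)] bracket by simp
    next
      case (scale X a)
      then show ?case using lie_subalgebraD(2)[OF L(1), of _ "poly a m"] by simp
    next
      case (add X Y)
      then show ?case using lie_subalgebraD(3)[OF L(1)] by simp
    qed (use lie_subalgebraD(1)[OF L(1)] in simp)
    show ?thesis
    proof (rule fmats_subset_lie[OF fin L(1)])
      fix a d assume ad: "a \<in> c" "d \<in> c"
      let ?F = "F (a, d)"
      have F': "?F \<in> P" "\<And>i j. i \<in> c \<Longrightarrow> j \<in> c \<Longrightarrow> (i, j) \<noteq> (a, d) \<Longrightarrow> ?F i j = 0" using F[of "(a, d)"] ad by force+
      have nz: "poly (?F a d) m \<noteq> 0" using m ad by (auto simp: B_def)
      have "(\<lambda>i j. (1 / poly (?F a d) m) * poly (?F i j) m) \<in> L" by (intro lie_subalgebraD(2)[OF L(1)] eval F')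
      also have "(\<lambda>i j. (1 / poly (?F a d) m) * poly (?F i j) m) = fmat_unit a d"
      proof (intro ext)
        fix i j
        show "1 / poly (?F a d) m * poly (?F i j) m = fmat_unit a d i j"
          using nz F'(2)[of i j] Pc[OF F'(1)] ad by (cases "i \<in> c \<and> j \<in> c") (auto simp: fmat_unit_def fmats_def)
      qed
      finally show "fmat_unit a d \<in> L" .
    qed
  qed
  ultimately show ?thesis by blast
qed

end

section \<open>Zariski density over Laurent series\<close>

definition fmat_line :: "('i, 'a::comm_ring_1) fmat \<Rightarrow> ('i, 'a) fmat \<Rightarrow> 'a \<Rightarrow> ('i, 'a) fmat" where
  "fmat_line M N x = (\<lambda>i j. M i j + x * N i j)"

lemma fmat_line_0 [simp]: "fmat_line M N 0 = M"
  by (simp add: fmat_line_def)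

lemma poly_functions_line:
  assumes "f \<in> poly_functions I"
  shows "\<exists>p. \<forall>x. f (fmat_line M N x) = poly p x"
  using assms
proof (induction rule: poly_functions.induct)
  case (const a)
  show ?case by (rule exI[of _ "[:a:]"]) simp
next
  case (entry i j)
  show ?case by (rule exI[of _ "[:M i j, N i j:]"]) (simp add: fmat_line_def mult.commute)
next
  case (add p q)
  then show ?case by (metis poly_add)
next
  case (mult p q)
  then show ?case by (metis poly_mult)
qed

lemma poly_functions_cong:
  assumes "f \<in> poly_functions I" "\<And>i j. i \<in> I \<Longrightarrow> j \<in> I \<Longrightarrow> M i j = N i j"
  shows "f M = f N"
  using assms by (induction rule: poly_functions.induct) auto

lemma poly_functions_sum:
  assumes "finite A" "\<And>a. a \<in> A \<Longrightarrow> f a \<in> poly_functions I"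
  shows "(\<lambda>M. \<Sum>a\<in>A. f a M) \<in> poly_functions I"
  using assms
proof (induction A rule: finite_induct)
  case empty
  show ?case using poly_functions.const[of 0 I] by simp
next
  case (insert x F)
  then show ?case using poly_functions.add[of "f x" I "\<lambda>M. \<Sum>a\<in>F. f a M"] by simp
qed

definition dir_deriv :: "(('i, complex) fmat \<Rightarrow> complex) \<Rightarrow> ('i, complex) fmat \<Rightarrow> ('i, complex) fmat \<Rightarrow> complex" where
  "dir_deriv f M N = deriv (\<lambda>x. f (fmat_line M N x)) 0"

lemma dir_deriv_has:
  assumes "f \<in> poly_functions I"
  shows "((\<lambda>x. f (fmat_line M N x)) has_field_derivative dir_deriv f M N) (at 0)"
proof -
  obtain p where p: "\<And>x. f (fmat_line M N x) = poly p x" using poly_functions_line[OF assms] by blast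
  have "((\<lambda>x. f (fmat_line M N x)) has_field_derivative poly (pderiv p) 0) (at 0)"
    unfolding p by (rule poly_DERIV)
  then show ?thesis unfolding dir_deriv_def by (metis DERIV_imp_deriv)
qed

lemma dir_deriv_const: "dir_deriv (\<lambda>_. a) M N = 0"
  by (simp add: dir_deriv_def)

lemma dir_deriv_entry: "dir_deriv (\<lambda>M. M i j) M N = N i j"
  unfolding dir_deriv_def fmat_line_def
  by (rule DERIV_imp_deriv) (auto intro!: derivative_eq_intros)

lemma dir_deriv_add:
  assumes "f \<in> poly_functions I" "g \<in> poly_functions I"
  shows "dir_deriv (\<lambda>M. f M + g M) M N = dir_deriv f M N + dir_deriv g M N"
  unfolding dir_deriv_def[of "\<lambda>M. f M + g M"]
  by (rule DERIV_imp_deriv, rule DERIV_add) (rule dir_deriv_has assms)+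

lemma dir_deriv_mult:
  assumes "f \<in> poly_functions I" "g \<in> poly_functions I"
  shows "dir_deriv (\<lambda>M. f M * g M) M N = dir_deriv f M N * g M + f M * dir_deriv g M N"
  unfolding dir_deriv_def[of "\<lambda>M. f M * g M"]
  by (rule DERIV_imp_deriv)
     (use DERIV_mult[OF dir_deriv_has[OF assms(1), of M N] dir_deriv_has[OF assms(2), of M N]] in
        \<open>simp add: algebra_simps\<close>)

lemma dir_deriv_linear:
  assumes "f \<in> poly_functions I"
  shows "dir_deriv f M (\<lambda>i j. a * N i j + N' i j) = a * dir_deriv f M N + dir_deriv f M N'"
  using assms
  by (induction rule: poly_functions.induct)
     (simp_all add: dir_deriv_const dir_deriv_entry dir_deriv_add dir_deriv_mult algebra_simps)

lemma dir_deriv_cong: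
  assumes "f \<in> poly_functions I" "\<And>i j. i \<in> I \<Longrightarrow> j \<in> I \<Longrightarrow> N i j = N' i j"
  shows "dir_deriv f M N = dir_deriv f M N'"
  unfolding dir_deriv_def
  by (rule arg_cong[where f = "\<lambda>h. deriv h 0"], rule ext, rule poly_functions_cong[OF assms(1)])
     (simp add: fmat_line_def assms(2))

lemma dir_deriv_sum:
  assumes "finite A" "\<And>a. a \<in> A \<Longrightarrow> f a \<in> poly_functions I"
  shows "dir_deriv (\<lambda>M. \<Sum>a\<in>A. f a M) M N = (\<Sum>a\<in>A. dir_deriv (f a) M N)"
  using assms
proof (induction A rule: finite_induct)
  case empty
  show ?case by (simp add: dir_deriv_const)
next
  case (insert x F)
  then show ?case using dir_deriv_add[of "f x" I "\<lambda>M. \<Sum>a\<in>F. f a M" M N] poly_functions_sum[of F f I] by simp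
qed

lemma dir_deriv_line:
  assumes "f \<in> poly_functions I"
  shows "\<exists>p. \<forall>x. dir_deriv f (fmat_line M N x) N' = poly p x"
  using assms
proof (induction rule: poly_functions.induct)
  case (const a)
  show ?case by (rule exI[of _ 0]) (simp add: dir_deriv_const)
next
  case (entry i j)
  show ?case by (rule exI[of _ "[:N' i j:]"]) (simp add: dir_deriv_entry)
next
  case (add p q)
  then show ?case by (simp add: dir_deriv_add) (metis poly_add)
next
  case (mult f g)
  then obtain p q where pq: "\<And>x. dir_deriv f (fmat_line M N x) N' = poly p x" "\<And>x. dir_deriv g (fmat_line M N x) N' = poly q x"
    by blast
  obtain p' q' where pq': "\<And>x. f (fmat_line M N x) = poly p' x" "\<And>x. g (fmat_line M N x) = poly q' x"
    using poly_functions_line mult by metis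
  show ?case
    by (rule exI[of _ "p * q' + p' * q"]) (simp add: dir_deriv_mult[OF mult.hyps(1,2)] pq pq')
qed

text \<open>The left-invariant vector field with value \<open>Y\<close> at the identity, acting as a
  derivation: the infinitesimal form of right translation by \<open>1 + x Y\<close>.\<close>

definition right_deriv :: "'i set \<Rightarrow> ('i, complex) fmat \<Rightarrow> (('i, complex) fmat \<Rightarrow> complex) \<Rightarrow> ('i, complex) fmat \<Rightarrow> complex" where
  "right_deriv I Y f M = dir_deriv f M (fmat_mult I M Y)"

lemma right_deriv_simps:
  "right_deriv I Y (\<lambda>_. a) = (\<lambda>_. 0)"
  "right_deriv I Y (\<lambda>M. M i j) = (\<lambda>M. fmat_mult I M Y i j)"
  "f \<in> poly_functions I \<Longrightarrow> g \<in> poly_functions I \<Longrightarrow>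
    right_deriv I Y (\<lambda>M. f M + g M) = (\<lambda>M. right_deriv I Y f M + right_deriv I Y g M)"
  "f \<in> poly_functions I \<Longrightarrow> g \<in> poly_functions I \<Longrightarrow>
    right_deriv I Y (\<lambda>M. f M * g M) = (\<lambda>M. right_deriv I Y f M * g M + f M * right_deriv I Y g M)"
  by (simp_all add: right_deriv_def fun_eq_iff dir_deriv_const dir_deriv_entry dir_deriv_add dir_deriv_mult)

lemma right_deriv_poly_functions:
  assumes "f \<in> poly_functions I" "finite I"
  shows "right_deriv I Y f \<in> poly_functions I"
  using assms
proof (induction rule: poly_functions.induct)
  case (entry i j)
  then show ?case unfolding right_deriv_simps fmat_mult_def
    by (intro poly_functions_sum) (auto intro: poly_functions.intros)
qed (auto simp: right_deriv_simps intro!: poly_functions.intros)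

lemma fmat_mult_assoc:
  "finite I \<Longrightarrow> fmat_mult I (fmat_mult I X Y) Z = fmat_mult I X (fmat_mult I Y (Z :: ('i, 'a::comm_ring_1) fmat))"
proof (intro ext)
  fix i j
  have "fmat_mult I (fmat_mult I X Y) Z i j = (\<Sum>k\<in>I. \<Sum>l\<in>I. X i l * Y l k * Z k j)"
    by (simp add: fmat_mult_def sum_distrib_right)
  also have "\<dots> = (\<Sum>l\<in>I. \<Sum>k\<in>I. X i l * Y l k * Z k j)" by (rule sum.swap)
  finally show "fmat_mult I (fmat_mult I X Y) Z i j = fmat_mult I X (fmat_mult I Y Z) i j"
    by (simp add: fmat_mult_def sum_distrib_left mult.assoc)
qed

lemma right_deriv_linear:
  assumes "f \<in> poly_functions I"
  shows "right_deriv I (\<lambda>i j. a * Y i j + Y' i j) f M = a * right_deriv I Y f M + right_deriv I Y' f M"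
proof -
  have "fmat_mult I M (\<lambda>i j. a * Y i j + Y' i j) = (\<lambda>i j. a * fmat_mult I M Y i j + fmat_mult I M Y' i j)"
    by (simp add: fmat_mult_def fun_eq_iff sum.distrib sum_distrib_left algebra_simps)
  then show ?thesis by (simp add: right_deriv_def dir_deriv_linear[OF assms])
qed

text \<open>Both sides are derivations in \<open>f\<close>, so the matrix entries decide: there,
  applying the derivation along \<open>Z\<close> and then the one along \<open>Y\<close> gives the
  entries of \<open>M Y Z\<close>.\<close>

lemma right_deriv_bracket:
  assumes "f \<in> poly_functions I" "finite I"
  shows "right_deriv I (fmat_bracket I Y Z) f M = right_deriv I Y (right_deriv I Z f) M - right_deriv I Z (right_deriv I Y f) M"
  using assms
proof (induction arbitrary: M rule: poly_functions.induct)
  case (const a)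
  then show ?case by (simp add: right_deriv_simps)
next
  case (entry i j)
  have *: "right_deriv I Y (right_deriv I Z (\<lambda>M. M i j)) M = fmat_mult I M (fmat_mult I Y Z) i j" for Y Z
  proof -
    have "right_deriv I Y (\<lambda>M. \<Sum>k\<in>I. M i k * Z k j) M = (\<Sum>k\<in>I. fmat_mult I M Y i k * Z k j)"
    proof -
      have "dir_deriv (\<lambda>M. M i k * Z k j) M N = N i k * Z k j" if "k \<in> I" for k N
        using dir_deriv_mult[OF poly_functions.entry[OF entry(1) that] poly_functions.const]
        by (simp add: dir_deriv_const dir_deriv_entry)
      then show ?thesis unfolding right_deriv_def using entry
        by (subst dir_deriv_sum[where I = I]) (auto intro!: poly_functions.mult poly_functions.intros sum.cong)
    qed
    then have "right_deriv I Y (right_deriv I Z (\<lambda>M. M i j)) M = fmat_mult I (fmat_mult I M Y) Z i j"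
      unfolding right_deriv_simps(2) by (simp add: fmat_mult_def[of I _ Z])
    then show ?thesis using entry by (simp add: fmat_mult_assoc)
  qed
  show ?case unfolding * by (simp add: right_deriv_simps fmat_mult_def fmat_bracket_def sum_subtractf right_diff_distrib)
next
  case (add f g)
  then show ?case by (simp add: right_deriv_simps right_deriv_poly_functions)
next
  case (mult f g)
  then have P: "right_deriv I Y f \<in> poly_functions I" "right_deriv I Y g \<in> poly_functions I" for Y
    by (auto intro: right_deriv_poly_functions)
  have m: "(\<lambda>M. right_deriv I Y f M * g M) \<in> poly_functions I" "(\<lambda>M. f M * right_deriv I Y g M) \<in> poly_functions I" for Y
    using P mult.hyps by (auto intro!: poly_functions.mult)
  note IH = mult.IH(1)[OF mult.prems] mult.IH(2)[OF mult.prems]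
  show ?case by (simp add: right_deriv_simps(3,4) mult.hyps P m IH) (simp add: algebra_simps)
qed

text \<open>\<open>q\<close> has coefficients in \<open>A\<close> and \<open>f\<close> arises by
  setting \<open>h = 0\<close> in them. A function carries no coefficients that could be reduced,
  hence a relation that builds both together.\<close>

inductive reduces_to :: "'i set \<Rightarrow> (('i, complex fls) fmat \<Rightarrow> complex fls) \<Rightarrow> (('i, complex) fmat \<Rightarrow> complex) \<Rightarrow> bool"
  for I where
  const: "reduces_to I (\<lambda>_. fps_to_fls a) (\<lambda>_. fps_nth a 0)"
| entry: "i \<in> I \<Longrightarrow> j \<in> I \<Longrightarrow> reduces_to I (\<lambda>M. M i j) (\<lambda>M. M i j)"
| add: "reduces_to I p f \<Longrightarrow> reduces_to I q g \<Longrightarrow> reduces_to I (\<lambda>M. p M + q M) (\<lambda>M. f M + g M)"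
| mult: "reduces_to I p f \<Longrightarrow> reduces_to I q g \<Longrightarrow> reduces_to I (\<lambda>M. p M * q M) (\<lambda>M. f M * g M)"

text \<open>\<open>q\<close> is \<open>f\<close> after extension of scalars. Such lifts serve as the
  part free of \<open>h\<close> that is split off in \<open>reduces_to_decompose\<close>.\<close>

inductive lifts :: "'i set \<Rightarrow> (('i, complex fls) fmat \<Rightarrow> complex fls) \<Rightarrow> (('i, complex) fmat \<Rightarrow> complex) \<Rightarrow> bool"
  for I where
  const: "lifts I (\<lambda>_. fls_const a) (\<lambda>_. a)"
| entry: "i \<in> I \<Longrightarrow> j \<in> I \<Longrightarrow> lifts I (\<lambda>M. M i j) (\<lambda>M. M i j)"
| add: "lifts I p f \<Longrightarrow> lifts I q g \<Longrightarrow> lifts I (\<lambda>M. p M + q M) (\<lambda>M. f M + g M)"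
| mult: "lifts I p f \<Longrightarrow> lifts I q g \<Longrightarrow> lifts I (\<lambda>M. p M * q M) (\<lambda>M. f M * g M)"

lemma reduces_to_poly_functions:
  assumes "reduces_to I q f" shows "q \<in> poly_functions I" "f \<in> poly_functions I"
  using assms by (induction rule: reduces_to.induct) (auto intro: poly_functions.intros)

lemma lifts_reduces_to: "lifts I q f \<Longrightarrow> reduces_to I q f"
proof (induction rule: lifts.induct)
  case (const a)
  then show ?case using reduces_to.const[of I "fps_const a"] by (simp add: fls_const_def)
qed (auto intro: reduces_to.intros)

lemma reduces_to_value:
  assumes "reduces_to I q f"
  shows "\<exists>a. q (scalars_to_fls M) = fps_to_fls a \<and> fps_nth a 0 = f (\<lambda>i j. fps_nth (M i j) 0)"
  using assms
proof (induction rule: reduces_to.induct)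
  case (add p f q g)
  then obtain a b where "p (scalars_to_fls M) = fps_to_fls a \<and> fps_nth a 0 = f (\<lambda>i j. fps_nth (M i j) 0)"
    "q (scalars_to_fls M) = fps_to_fls b \<and> fps_nth b 0 = g (\<lambda>i j. fps_nth (M i j) 0)" by blast
  then show ?case by (intro exI[of _ "a + b"]) simp
next
  case (mult p f q g)
  then obtain a b where "p (scalars_to_fls M) = fps_to_fls a \<and> fps_nth a 0 = f (\<lambda>i j. fps_nth (M i j) 0)"
    "q (scalars_to_fls M) = fps_to_fls b \<and> fps_nth b 0 = g (\<lambda>i j. fps_nth (M i j) 0)" by blast
  then show ?case by (intro exI[of _ "a * b"]) (simp add: fls_times_fps_to_fls)
qed (auto simp: scalars_to_fls_def)

lemma reduces_to_X_mult:
  "reduces_to I q f \<Longrightarrow> reduces_to I (\<lambda>M. fls_X * q M) (\<lambda>_. 0)"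
  using reduces_to.mult[OF reduces_to.const[of I fps_X]] by simp

lemma reduces_to_sum:
  assumes "finite A" "\<And>a. a \<in> A \<Longrightarrow> reduces_to I (q a) (f a)"
  shows "reduces_to I (\<lambda>M. \<Sum>a\<in>A. q a M) (\<lambda>M. \<Sum>a\<in>A. f a M)"
  using assms
proof (induction A rule: finite_induct)
  case empty
  show ?case using reduces_to.const[of I 0] by simp
next
  case (insert x F)
  then show ?case using reduces_to.add[of I "q x" "f x" "\<lambda>M. \<Sum>a\<in>F. q a M" "\<lambda>M. \<Sum>a\<in>F. f a M"] by simp
qed

text \<open>To first order in \<open>h\<close>, right translation by \<open>1 + h N\<close> is the derivation \<open>right_deriv I N\<^sub>0\<close>.\<close>

lemma reduces_to_translate:
  assumes "reduces_to I q f" "finite I"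
  shows "\<exists>q'. reduces_to I q' (right_deriv I (\<lambda>i j. fps_nth (N i j) 0) f) \<and>
    (\<forall>M. q (fmat_mult I M (\<lambda>i j. fmat_one I i j + fls_X * fps_to_fls (N i j))) = q M + fls_X * q' M)"
  (is "\<exists>q'. reduces_to I q' (right_deriv I ?N f) \<and> (\<forall>M. q (?T M) = q M + _)")
  using assms(1)
proof (induction rule: reduces_to.induct)
  case (const a)
  show ?case using reduces_to.const[of I 0] by (intro exI[of _ "\<lambda>_. 0"]) (simp add: right_deriv_simps)
next
  case (entry i j)
  have "reduces_to I (\<lambda>M. \<Sum>k\<in>I. M i k * fps_to_fls (N k j)) (\<lambda>M. \<Sum>k\<in>I. M i k * fps_nth (N k j) 0)"
    using assms(2) entry
    by (intro reduces_to_sum reduces_to.mult reduces_to.entry reduces_to.const[of I "N _ j"]) auto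
  moreover have "?T M i j = M i j + fls_X * (\<Sum>k\<in>I. M i k * fps_to_fls (N k j))" for M
  proof -
    have "(\<Sum>k\<in>I. M i k * fmat_one I k j) = (\<Sum>k\<in>I. if k = j then M i j else 0)"
      by (intro sum.cong refl) (auto simp: fmat_one_def)
    then show ?thesis using assms(2) entry
      by (simp add: fmat_mult_def ring_distribs sum.distrib sum_distrib_left mult_ac)
  qed
  ultimately show ?case unfolding right_deriv_simps fmat_mult_def[of I _ ?N] by blast
next
  case (add p f q g)
  then obtain p' q' where p': "reduces_to I p' (right_deriv I ?N f)" "\<And>M. p (?T M) = p M + fls_X * p' M"
    and q': "reduces_to I q' (right_deriv I ?N g)" "\<And>M. q (?T M) = q M + fls_X * q' M" by blast
  have fg: "f \<in> poly_functions I" "g \<in> poly_functions I" using add reduces_to_poly_functions by auto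
  show ?case unfolding right_deriv_simps(3)[OF fg]
    by (intro exI[of _ "\<lambda>M. p' M + q' M"] conjI reduces_to.add p' q') (simp add: p' q' algebra_simps)
next
  case (mult p f q g)
  then obtain p' q' where p': "reduces_to I p' (right_deriv I ?N f)" "\<And>M. p (?T M) = p M + fls_X * p' M"
    and q': "reduces_to I q' (right_deriv I ?N g)" "\<And>M. q (?T M) = q M + fls_X * q' M" by blast
  have fg: "f \<in> poly_functions I" "g \<in> poly_functions I" using mult reduces_to_poly_functions by auto
  \<comment> \<open>The term quadratic in the increments carries an extra factor \<open>h\<close>
    and so reduces to 0, leaving the Leibniz rule.\<close>
  have "reduces_to I (\<lambda>M. p' M * q M + p M * q' M + fls_X * (p' M * q' M))
    (\<lambda>M. right_deriv I ?N f M * g M + f M * right_deriv I ?N g M + 0)"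
    by (intro reduces_to.add reduces_to.mult reduces_to_X_mult[OF reduces_to.mult[OF p'(1) q'(1)]] p' q' mult.hyps)
  then show ?case unfolding right_deriv_simps(4)[OF fg]
    by (intro exI[of _ "\<lambda>M. p' M * q M + p M * q' M + fls_X * (p' M * q' M)"])
       (simp add: p' q' algebra_simps)
qed

text \<open>Every coefficient is its constant term plus a multiple of \<open>h\<close>, and in
  products all mixed terms remain divisible by \<open>h\<close>. This permits division by
  \<open>h\<close> when the reduction vanishes.\<close>

lemma reduces_to_decompose:
  assumes "reduces_to I q f"
  shows "\<exists>l q' f'. lifts I l f \<and> reduces_to I q' f' \<and> (\<forall>M. q M = l M + fls_X * q' M)"
  using assms
proof (induction rule: reduces_to.induct)
  case (const a)
  have "a = fps_const (fps_nth a 0) + fps_X * fps_shift 1 a"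
    by (rule fps_ext) simp
  then have "fps_to_fls a = fps_to_fls (fps_const (fps_nth a 0) + fps_X * fps_shift 1 a)"
    by (rule arg_cong)
  then have "fps_to_fls a = fls_const (fps_nth a 0) + fls_X * fps_to_fls (fps_shift 1 a)"
    by (simp only: fps_to_fls_plus fls_times_fps_to_fls fps_const_to_fls fps_X_to_fls)
  then show ?case using lifts.const reduces_to.const by (intro exI conjI allI) assumption+
next
  case (entry i j)
  show ?case using entry lifts.entry reduces_to.const[of I 0]
    by (intro exI[of _ "\<lambda>M. M i j"] exI[of _ "\<lambda>_. 0"]) auto
next
  case (add p f q g)
  then obtain l p' f' k q' g' where
    h: "lifts I l f" "reduces_to I p' f'" "\<And>M. p M = l M + fls_X * p' M"
       "lifts I k g" "reduces_to I q' g'" "\<And>M. q M = k M + fls_X * q' M" by blast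
  show ?case
    by (intro exI[of _ "\<lambda>M. l M + k M"] exI[of _ "\<lambda>M. p' M + q' M"] exI[of _ "\<lambda>M. f' M + g' M"]
        conjI lifts.add reduces_to.add h) (simp add: h algebra_simps)
next
  case (mult p f q g)
  then obtain l p' f' k q' g' where
    h: "lifts I l f" "reduces_to I p' f'" "\<And>M. p M = l M + fls_X * p' M"
       "lifts I k g" "reduces_to I q' g'" "\<And>M. q M = k M + fls_X * q' M" by blast
  have "reduces_to I (\<lambda>M. p' M * q M + l M * q' M) (\<lambda>M. f' M * g M + f M * g' M)"
    by (intro reduces_to.add reduces_to.mult h mult.hyps lifts_reduces_to)
  moreover have "p M * q M = l M * k M + fls_X * (p' M * q M + l M * q' M)" for M
    by (simp add: h algebra_simps)
  moreover have "lifts I (\<lambda>M. l M * k M) (\<lambda>M. f M * g M)" by (intro lifts.mult h)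
  ultimately show ?case
    by (intro exI[of _ "\<lambda>M. l M * k M"] exI[of _ "\<lambda>M. p' M * q M + l M * q' M"]
        exI[of _ "\<lambda>M. f' M * g M + f M * g' M"]) auto
qed

lemma lifts_constant_matrix:
  assumes "lifts I l f" shows "l (\<lambda>i j. fls_const (M i j)) = fls_const (f M)"
  using assms by (induction rule: lifts.induct) (auto simp: fls_plus_const fls_const_mult_const)

text \<open>Induction on the set \<open>J\<close> of positions with arbitrary entries: in one
  further entry the function is a polynomial vanishing at the infinitely many constants.\<close>

lemma poly_functions_vanish:
  fixes p :: "('i, complex fls) fmat \<Rightarrow> complex fls"
  assumes p: "p \<in> poly_functions I" and fin: "finite I"
    and zero: "\<And>M. p (\<lambda>i j. fls_const (M i j)) = 0"
  shows "p M = 0"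
proof -
  have "\<forall>M. (\<forall>i\<in>I. \<forall>j\<in>I. (i, j) \<notin> J \<longrightarrow> M i j \<in> range fls_const) \<longrightarrow> p M = 0" if "finite J" for J
    using that
  proof (induction J rule: finite_induct)
    case empty
    show ?case
    proof (intro allI impI)
      fix M :: "('i, complex fls) fmat" assume "\<forall>i\<in>I. \<forall>j\<in>I. (i, j) \<notin> {} \<longrightarrow> M i j \<in> range fls_const"
      then have "\<And>i j. i \<in> I \<Longrightarrow> j \<in> I \<Longrightarrow> M i j = fls_const (inv_into UNIV fls_const (M i j))"
        by (simp add: f_inv_into_f)
      then have "p M = p (\<lambda>i j. fls_const (inv_into UNIV fls_const (M i j)))" by (rule poly_functions_cong[OF p])
      then show "p M = 0" using zero by simp
    qed
  next
    case (insert x J)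
    obtain a b where x: "x = (a, b)" by (cases x)
    show ?case
    proof (intro allI impI)
      fix M :: "('i, complex fls) fmat" assume M: "\<forall>i\<in>I. \<forall>j\<in>I. (i, j) \<notin> insert x J \<longrightarrow> M i j \<in> range fls_const"
      obtain P where P: "\<And>y. p (fmat_line (\<lambda>i j. if i = a \<and> j = b then 0 else M i j) (fmat_unit a b) y) = poly P y"
        using poly_functions_line[OF p] by blast
      have "poly P (fls_const y) = 0" for y
        unfolding P[symmetric] using M by (intro insert.IH[rule_format]) (auto simp: fmat_line_def fmat_unit_def x)
      then have "range fls_const \<subseteq> {y. poly P y = 0}" by auto
      moreover have "infinite (range (fls_const :: complex \<Rightarrow> complex fls))"
      proof
        assume "finite (range (fls_const :: complex \<Rightarrow> complex fls))"
        moreover have "inj (fls_const :: complex \<Rightarrow> complex fls)" by (metis injI fls_const_nth)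
        ultimately show False using infinite_UNIV_char_0[where ?'a = complex] finite_imageD by blast
      qed
      ultimately have "P = 0" using poly_roots_finite finite_subset by blast
      then have "p (fmat_line (\<lambda>i j. if i = a \<and> j = b then 0 else M i j) (fmat_unit a b) (M a b)) = 0" using P by simp
      also have "fmat_line (\<lambda>i j. if i = a \<and> j = b then 0 else M i j) (fmat_unit a b) (M a b) = M"
        by (auto simp: fmat_line_def fmat_unit_def fun_eq_iff)
      finally show "p M = 0" .
    qed
  qed
  from this[of "I \<times> I"] show ?thesis using fin by auto
qed

text \<open>A polynomial has finitely many coefficients, so one power of \<open>h\<close> clears the
  poles of all of them.\<close>

lemma poly_functions_clear_denominators:
  assumes "p \<in> poly_functions I"
  shows "\<exists>n q f. reduces_to I q f \<and> (\<forall>M. q M = fls_X ^ n * p M)"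
  using assms
proof (induction rule: poly_functions.induct)
  case (const a)
  obtain n b where "fls_X ^ n * a = fps_to_fls b"
  proof -
    define n where "n = nat (- fls_subdegree a)"
    have "int n \<ge> - fls_subdegree a" by (simp add: n_def)
    from fls_as_fps'[OF this] obtain b where "a = fls_shift (int n) (fps_to_fls b)" ..
    then have "fls_X ^ n * a = fps_to_fls b"
      by (simp add: fls_X_power_times_conv_shift)
    then show ?thesis by (rule that)
  qed
  then show ?case using reduces_to.const[of I b] by metis
next
  case (entry i j)
  then show ?case using reduces_to.entry by (metis mult_1 power_0)
next
  case (add p q)
  then obtain n1 p' f n2 q' g where h: "reduces_to I p' f" "\<And>M. p' M = fls_X ^ n1 * p M"
    "reduces_to I q' g" "\<And>M. q' M = fls_X ^ n2 * q M" by blast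
  have X: "reduces_to I (\<lambda>_. fls_X ^ n) (\<lambda>_. fps_nth (fps_X ^ n) 0)" for n
    using reduces_to.const[of I "fps_X ^ n"] by (simp add: fps_to_fls_power)
  have "reduces_to I (\<lambda>M. fls_X ^ n2 * p' M + fls_X ^ n1 * q' M)
     (\<lambda>M. fps_nth (fps_X ^ n2) 0 * f M + fps_nth (fps_X ^ n1) 0 * g M)"
    by (intro reduces_to.add reduces_to.mult X h)
  then show ?case
    by (intro exI[of _ "n1 + n2"] exI[of _ "\<lambda>M. fls_X ^ n2 * p' M + fls_X ^ n1 * q' M"] exI conjI)
       (assumption, simp add: h power_add algebra_simps)
next
  case (mult p q)
  then obtain n1 p' f n2 q' g where h: "reduces_to I p' f" "\<And>M. p' M = fls_X ^ n1 * p M"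
    "reduces_to I q' g" "\<And>M. q' M = fls_X ^ n2 * q M" by blast
  have "reduces_to I (\<lambda>M. p' M * q' M) (\<lambda>M. f M * g M)" by (intro reduces_to.mult h)
  then show ?case
    by (intro exI[of _ "n1 + n2"] exI[of _ "\<lambda>M. p' M * q' M"] exI conjI)
       (assumption, simp add: h power_add algebra_simps)
qed

text \<open>After denominators are cleared, \<open>h\<close> is divided out as long as the reduction
  vanishes. This terminates because the value at one fixed complex matrix \<open>M1\<close> is a
  nonzero power series whose order drops each time.\<close>

lemma nonzero_reduction:
  assumes p: "p \<in> poly_functions I" and fin: "finite I" and M: "p M \<noteq> 0"
  shows "\<exists>q f c. reduces_to I q f \<and> (\<exists>M. f M \<noteq> 0) \<and> (\<forall>M. c * q M = p M) \<and> c \<noteq> (0 :: complex fls)"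
proof -
  obtain M1 where M1: "p (\<lambda>i j. fls_const (M1 i j)) \<noteq> 0" using poly_functions_vanish[OF p fin] M by blast
  have divide: "\<exists>q' f' c. reduces_to I q' f' \<and> (\<exists>M. f' M \<noteq> 0) \<and> (\<forall>M. c * q' M = q M) \<and> c \<noteq> (0 :: complex fls)"
    if "reduces_to I q f" "q (\<lambda>i j. fls_const (M1 i j)) = fps_to_fls a" "a \<noteq> 0" for q f a
    using that
  proof (induction "subdegree a" arbitrary: q f a rule: less_induct)
    case less
    show ?case
    proof (cases "\<exists>M. f M \<noteq> 0")
      case True
      then show ?thesis using less.prems(1) by (intro exI[of _ q] exI[of _ f] exI[of _ 1]) simp
    next
      case False
      obtain l q' f' where h: "lifts I l f" "reduces_to I q' f'" "\<forall>M. q M = l M + fls_X * q' M"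
        using reduces_to_decompose[OF less.prems(1)] by (elim exE conjE) (rule that; assumption)
      \<comment> \<open>With zero reduction the lift \<open>l\<close> vanishes on complex matrices,
        hence everywhere, and \<open>q\<close> equals \<open>h\<close> times
        \<open>q'\<close>.\<close>
      have "l M = 0" for M
      proof (rule poly_functions_vanish[OF reduces_to_poly_functions(1)[OF lifts_reduces_to[OF h(1)]] fin])
        show "l (\<lambda>i j. fls_const (M i j)) = 0" for M
          using False lifts_constant_matrix[OF h(1), of M] by simp
      qed
      then have q: "q M = fls_X * q' M" for M using h(3) by simp
      obtain b where b: "q' (\<lambda>i j. fls_const (M1 i j)) = fps_to_fls b"
        using reduces_to_value[OF h(2), of "\<lambda>i j. fps_const (M1 i j)"] by (auto simp: scalars_to_fls_def)
      have "fps_to_fls a = fps_to_fls (fps_X * b)"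
        using q[of "\<lambda>i j. fls_const (M1 i j)"] less.prems(2) b by (simp add: fls_times_fps_to_fls)
      then have "a = fps_X * b" by simp
      then have "b \<noteq> 0" "subdegree b < subdegree a" using less.prems(3) by auto
      then obtain q2 f2 c where "reduces_to I q2 f2" "\<exists>M. f2 M \<noteq> 0" "\<And>M. c * q2 M = q' M" "c \<noteq> 0"
        using less.hyps[OF _ h(2) b] by blast
      then show ?thesis
        by (intro exI[of _ q2] exI[of _ f2] exI[of _ "fls_X * c"]) (simp add: q mult.assoc)
    qed
  qed
  obtain n q f where q: "reduces_to I q f" "\<And>M. q M = fls_X ^ n * p M"
    using poly_functions_clear_denominators[OF p] by blast
  obtain a where a: "q (\<lambda>i j. fls_const (M1 i j)) = fps_to_fls a"
    using reduces_to_value[OF q(1), of "\<lambda>i j. fps_const (M1 i j)"] by (auto simp: scalars_to_fls_def)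
  have "a \<noteq> 0" using a q(2) M1 by auto
  then obtain q' f' c where "reduces_to I q' f'" "\<exists>M. f' M \<noteq> 0" "\<And>M. c * q' M = q M" "c \<noteq> 0"
    using divide[OF q(1) a] by blast
  moreover have "c / fls_X ^ n * q' M = p M" for M
  proof -
    have "c / fls_X ^ n * q' M = q M / fls_X ^ n"
      unfolding \<open>\<And>M. c * q' M = q M\<close>[symmetric] by (rule times_divide_eq_left)
    also have "\<dots> = p M" unfolding q(2) by (rule nonzero_mult_div_cancel_left) simp
    finally show ?thesis .
  qed
  moreover have "c / fls_X ^ n \<noteq> 0" using \<open>c \<noteq> 0\<close> unfolding divide_eq_0_iff by simp
  ultimately show ?thesis by blast
qed

text \<open>The order of vanishing at \<open>t = 0\<close> of \<open>f (1 + t N)\<close> cannot be positive and minimal, since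
  \<open>d/dt f (1 + t N)\<close> is an alternating sum of the \<open>t\<^sup>r (D f) (1 + t N)\<close> with \<open>D\<close> the derivation
  along \<open>N\<^sup>r\<^sup>+\<^sup>1\<close>.\<close>

lemma derivation_stable_vanish:
  fixes V :: "(('i, complex) fmat \<Rightarrow> complex) set"
  assumes fin: "finite I" and V: "V \<subseteq> poly_functions I"
    and stable: "\<And>f Y. f \<in> V \<Longrightarrow> Y \<in> fmats I \<Longrightarrow> right_deriv I Y f \<in> V"
    and one: "\<And>f. f \<in> V \<Longrightarrow> f (fmat_one I) = 0"
    and f: "f \<in> V"
  shows "f M = 0"
proof -
  have van: "f (fmat_line (fmat_one I) N x) = 0" if N: "N \<in> fmats I" and f: "f \<in> V" for N f x
  proof -
    define P where "P f = (SOME p. \<forall>x. f (fmat_line (fmat_one I) N x) = poly p x)" for f :: "('i, complex) fmat \<Rightarrow> complex"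
    have P: "f (fmat_line (fmat_one I) N x) = poly (P f) x" if "f \<in> V" for f x
      unfolding P_def using someI_ex[OF poly_functions_line[of f I "fmat_one I" N]] that V by blast
    have "P f = 0"
    proof (rule ccontr)
      assume "P f \<noteq> 0"
      define k where "k = (LEAST k. \<exists>g\<in>V. P g \<noteq> 0 \<and> Polynomial.order 0 (P g) = k)"
      have "\<exists>k. \<exists>g\<in>V. P g \<noteq> 0 \<and> Polynomial.order 0 (P g) = k" using f \<open>P f \<noteq> 0\<close> by blast
      from LeastI_ex[OF this] obtain g where g: "g \<in> V" "P g \<noteq> 0" "Polynomial.order 0 (P g) = k"
        unfolding k_def[symmetric] by blast
      have min: "[:0, 1:] ^ k dvd P g" if "g \<in> V" for g
      proof (cases "P g = 0")
        case False
        then have "k \<le> Polynomial.order 0 (P g)" unfolding k_def using that by (intro Least_le) blast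
        then show ?thesis using order_1[of 0 "P g"] by (metis le_imp_power_dvd dvd_trans minus_zero)
      qed simp
      define pow where "pow r = ((fmat_mult I N) ^^ r) N" for r
      have pow: "pow r \<in> fmats I" for r
        by (induction r) (use N in \<open>auto simp: pow_def fmats_def fmat_mult_def\<close>)
      define E where "E r = (SOME p. \<forall>x. dir_deriv g (fmat_line (fmat_one I) N x) (pow r) = poly p x)" for r
      have gI: "g \<in> poly_functions I" using g V by auto
      have E: "dir_deriv g (fmat_line (fmat_one I) N x) (pow r) = poly (E r) x" for r x
        unfolding E_def using someI_ex[OF dir_deriv_line[OF gI, of "fmat_one I" N "pow r"]] by blast
      have E0: "pderiv (P g) = E 0"
      proof (rule poly_eq_poly_eq_iff[THEN iffD1], rule ext)
        fix x
        have "(poly (P g) has_field_derivative dir_deriv g (fmat_line (fmat_one I) N x) N) (at x)"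
        proof -
          have "((\<lambda>y. g (fmat_line (fmat_line (fmat_one I) N x) N y)) has_field_derivative
              dir_deriv g (fmat_line (fmat_one I) N x) N) (at 0)" by (rule dir_deriv_has[OF gI])
          also have "(\<lambda>y. g (fmat_line (fmat_line (fmat_one I) N x) N y)) = (\<lambda>y. poly (P g) (x + y))"
            unfolding P[OF g(1), symmetric] by (simp add: fmat_line_def algebra_simps)
          finally show ?thesis
            using DERIV_shift[of "poly (P g)" "dir_deriv g (fmat_line (fmat_one I) N x) N" 0 x]
            by (simp add: add.commute)
        qed
        then show "poly (pderiv (P g)) x = poly (E 0) x"
          using DERIV_unique[OF poly_DERIV[of "P g" x]] E[of x 0] by (simp add: pow_def)
      qed
      \<comment> \<open>\<open>pow r\<close> is \<open>N^(r+1)\<close>, so at \<open>1 + x N\<close>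
        the invariant vector field along it has the value
        \<open>N^(r+1) + x N^(r+2)\<close>.\<close>
      have step: "P (right_deriv I (pow r) g) = E r + [:0, 1:] * E (Suc r)" for r
      proof (rule poly_eq_poly_eq_iff[THEN iffD1], rule ext)
        fix x
        have "poly (P (right_deriv I (pow r) g)) x = right_deriv I (pow r) g (fmat_line (fmat_one I) N x)"
          using P[OF stable[OF g(1) pow]] by simp
        also have "\<dots> = dir_deriv g (fmat_line (fmat_one I) N x) (\<lambda>i j. x * pow (Suc r) i j + pow r i j)"
          unfolding right_deriv_def
        proof (rule dir_deriv_cong[OF gI])
          fix i j assume "i \<in> I" "j \<in> I"
          have "(\<Sum>k\<in>I. fmat_one I i k * pow r k j) = (\<Sum>k\<in>I. if k = i then pow r i j else 0)"
            using \<open>i \<in> I\<close> by (intro sum.cong refl) (auto simp: fmat_one_def)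
          also have "\<dots> = pow r i j" using fin \<open>i \<in> I\<close> by simp
          finally show "fmat_mult I (fmat_line (fmat_one I) N x) (pow r) i j = x * pow (Suc r) i j + pow r i j"
            by (simp add: fmat_mult_def fmat_line_def pow_def ring_distribs sum.distrib sum_distrib_left mult.assoc)
        qed
        also have "\<dots> = poly (E r + [:0, 1:] * E (Suc r)) x"
          by (simp add: dir_deriv_linear[OF gI] E)
        finally show "poly (P (right_deriv I (pow r) g)) x = poly (E r + [:0, 1:] * E (Suc r)) x" .
      qed
      \<comment> \<open>Modulo \<open>x^k\<close> each \<open>E r\<close> equals
        \<open>- x E (r+1)\<close>, so \<open>E 0\<close> is a multiple of \<open>x^r E r\<close>.
        With \<open>r = k\<close> this shows that \<open>x^k\<close> divides \<open>E 0\<close>, the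
        derivative of \<open>P g\<close>, although a root of order \<open>k > 0\<close> leaves only
        order \<open>k - 1\<close>.\<close>
      have "\<exists>c. [:0, 1:] ^ k dvd E 0 - c * [:0, 1:] ^ r * E r" for r
      proof (induction r)
        case 0
        show ?case by (rule exI[of _ 1]) simp
      next
        case (Suc r)
        then obtain c where c: "[:0, 1:] ^ k dvd E 0 - c * [:0, 1:] ^ r * E r" by blast
        have "[:0, 1:] ^ k dvd E r + [:0, 1:] * E (Suc r)"
          using min[OF stable[OF g(1) pow]] unfolding step .
        then have "[:0, 1:] ^ k dvd (E 0 - c * [:0, 1:] ^ r * E r) + c * [:0, 1:] ^ r * (E r + [:0, 1:] * E (Suc r))"
          by (rule dvd_add[OF c dvd_mult])
        also have "(E 0 - c * [:0, 1:] ^ r * E r) + c * [:0, 1:] ^ r * (E r + [:0, 1:] * E (Suc r)) =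
            E 0 - (- c) * [:0, 1:] ^ Suc r * E (Suc r)"
        proof -
          have "(a - c * x * b) + c * x * (b + y * d) = a - (- c) * (y * x) * d" for a b d x y :: "complex poly"
            by (simp add: algebra_simps)
          then show ?thesis by (simp only: power_Suc)
        qed
        finally show ?case by blast
      qed
      then obtain c where c: "[:0, 1:] ^ k dvd E 0 - c * [:0, 1:] ^ k * E k" by blast
      have "[:0, 1:] ^ k dvd (E 0 - c * [:0, 1:] ^ k * E k) + [:0, 1:] ^ k * (c * E k)"
        by (rule dvd_add[OF c dvd_triv_left])
      also have "(E 0 - c * [:0, 1:] ^ k * E k) + [:0, 1:] ^ k * (c * E k) = E 0"
      proof -
        have "(a - c * x * b) + x * (c * b) = a" for a b x :: "complex poly"
          by (simp add: algebra_simps)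
        then show ?thesis .
      qed
      finally have dvd: "[:0, 1:] ^ k dvd pderiv (P g)" by (simp only: E0)
      have root: "poly (P g) 0 = 0" using P[OF g(1), of 0] one[OF g(1)] by simp
      have nz: "pderiv (P g) \<noteq> 0"
      proof
        assume "pderiv (P g) = 0"
        then obtain c where "P g = [:c:]" using pderiv_iszero by blast
        then show False using root g(2) by simp
      qed
      have "Polynomial.order 0 (P g) = Suc (Polynomial.order 0 (pderiv (P g)))"
        by (rule Polynomial.order_pderiv[OF g(2) root])
      moreover have "k \<le> Polynomial.order 0 (pderiv (P g))"
        using dvd nz order_divides[of 0 k "pderiv (P g)"] by simp
      ultimately show False using g(3) by simp
    qed
    then show ?thesis using P[OF f] by simp
  qed
  define N where "N = (\<lambda>i j. if i \<in> I \<and> j \<in> I then M i j - fmat_one I i j else 0)"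
  have "f M = f (fmat_line (fmat_one I) N 1)"
    by (rule poly_functions_cong[of f I]) (use f V in \<open>auto simp: fmat_line_def N_def\<close>)
  also have "\<dots> = 0" by (rule van) (auto simp: N_def fmats_def f)
  finally show ?thesis .
qed

text \<open>\<open>G\<close> consists of first order terms of elements \<open>1 + h N\<close> that
  preserve \<open>S\<close> by right multiplication. A nonzero \<open>p\<close> would put a nonzero
  function into the space \<open>V\<close> of reductions of polynomials vanishing on
  \<open>S\<close>.\<close>

theorem zariski_vanish:
  fixes S :: "('i, complex fls) fmat set" and G :: "('i, complex) fmat set"
  assumes fin: "finite I" and one: "fmat_one I \<in> S"
    and translate: "\<And>g. g \<in> G \<Longrightarrow> \<exists>N. (\<forall>i j. fps_nth (N i j) 0 = g i j) \<and>
      (\<forall>M\<in>S. fmat_mult I M (\<lambda>i j. fmat_one I i j + fls_X * fps_to_fls (N i j)) \<in> S)"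
    and lie: "\<And>L. lie_subalgebra I L \<Longrightarrow> G \<subseteq> L \<Longrightarrow> fmats I \<subseteq> L"
    and p: "p \<in> poly_functions I" "\<And>M. M \<in> S \<Longrightarrow> p M = 0"
  shows "p M = 0"
proof (rule ccontr)
  assume "p M \<noteq> 0"
  then obtain q f c where q: "reduces_to I q f" "\<exists>M. f M \<noteq> 0" "\<And>M. c * q M = p M" "c \<noteq> 0"
    using nonzero_reduction[OF p(1) fin] by blast
  define V where "V = {f. \<exists>q. reduces_to I q f \<and> (\<forall>M\<in>S. q M = 0)}"
  have VI: "V \<subseteq> poly_functions I" using reduces_to_poly_functions by (auto simp: V_def)
  have Vlin: "(\<lambda>M. a * f M + g M) \<in> V" if "f \<in> V" "g \<in> V" for f g a
  proof -
    obtain p q where pq: "reduces_to I p f" "reduces_to I q g" "\<forall>M\<in>S. p M = 0" "\<forall>M\<in>S. q M = 0"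
      using \<open>f \<in> V\<close> \<open>g \<in> V\<close> by (auto simp: V_def)
    have "reduces_to I (\<lambda>M. fps_to_fls (fps_const a) * p M + q M) (\<lambda>M. fps_nth (fps_const a) 0 * f M + g M)"
      by (intro reduces_to.intros pq)
    then show ?thesis using pq(3,4) unfolding V_def by fastforce
  qed
  have V0: "(\<lambda>_. 0) \<in> V" unfolding V_def using reduces_to.const[of I 0] by force
  \<comment> \<open>The stabiliser of \<open>V\<close> is a Lie algebra since
    \<open>right_deriv\<close> turns brackets into commutators.\<close>
  define L where "L = {Y. \<forall>f\<in>V. right_deriv I Y f \<in> V}"
  have L: "lie_subalgebra I L"
    unfolding lie_subalgebra_def
  proof (intro conjI ballI allI)
    have "right_deriv I (\<lambda>_ _. 0) f = (\<lambda>_. 0)" if "f \<in> V" for f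
    proof
      fix M show "right_deriv I (\<lambda>_ _. 0) f M = 0"
        using right_deriv_linear[of f I 0 "\<lambda>_ _. 0" "\<lambda>_ _. 0" M]
          right_deriv_linear[of f I "-1" "\<lambda>_ _. 0" "\<lambda>_ _. 0" M] that VI by auto
    qed
    then show L0: "(\<lambda>_ _. 0) \<in> L" using V0 by (simp add: L_def)
    fix a X Y assume X: "X \<in> L"
    have lin: "right_deriv I (\<lambda>i j. a * X i j + Y i j) f = (\<lambda>M. a * right_deriv I X f M + right_deriv I Y f M)"
      if "f \<in> V" for f a Y using right_deriv_linear[of f I a X Y] that VI by auto
    show "(\<lambda>i j. a * X i j) \<in> L"
      using lin[of _ a "\<lambda>_ _. 0"] Vlin X L0 by (simp add: L_def)
    assume Y: "Y \<in> L"
    show "(\<lambda>i j. X i j + Y i j) \<in> L"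
      using lin[of _ 1 Y] Vlin[of _ _ 1] X Y by (simp add: L_def)
    have "right_deriv I (fmat_bracket I X Y) f \<in> V" if f: "f \<in> V" for f
    proof -
      have "right_deriv I (fmat_bracket I X Y) f =
        (\<lambda>M. - 1 * right_deriv I Y (right_deriv I X f) M + right_deriv I X (right_deriv I Y f) M)"
        using right_deriv_bracket[of f I X Y] f VI fin by (auto simp: fun_eq_iff)
      also have "\<dots> \<in> V" using X Y f by (intro Vlin) (auto simp: L_def)
      finally show ?thesis .
    qed
    then show "fmat_bracket I X Y \<in> L" by (simp add: L_def)
  qed
  have "G \<subseteq> L"
  proof
    fix g assume "g \<in> G"
    then obtain N where N: "\<And>i j. fps_nth (N i j) 0 = g i j"
      "\<And>M. M \<in> S \<Longrightarrow> fmat_mult I M (\<lambda>i j. fmat_one I i j + fls_X * fps_to_fls (N i j)) \<in> S"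
      using translate by blast
    have "right_deriv I g f \<in> V" if f: "f \<in> V" for f
    proof -
      obtain p where p: "reduces_to I p f" "\<And>M. M \<in> S \<Longrightarrow> p M = 0" using f by (auto simp: V_def)
      obtain p' where p': "reduces_to I p' (right_deriv I (\<lambda>i j. fps_nth (N i j) 0) f)"
        "\<And>M. p (fmat_mult I M (\<lambda>i j. fmat_one I i j + fls_X * fps_to_fls (N i j))) = p M + fls_X * p' M"
        using reduces_to_translate[OF p(1) fin, of N] by blast
      \<comment> \<open>Both \<open>M\<close> and its translate lie in \<open>S\<close>, so
        \<open>h\<close> times \<open>p' M\<close> is a difference of two zeros.\<close>
      have "p' M = 0" if "M \<in> S" for M
        using p'(2)[of M] p(2)[OF that] p(2)[OF N(2)[OF that]] by simp
      then show ?thesis using p'(1) unfolding N(1) V_def by blast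
    qed
    then show "g \<in> L" by (simp add: L_def)
  qed
  then have all: "fmats I \<subseteq> L" by (rule lie[OF L])
  have "f M = 0" for M
  proof (rule derivation_stable_vanish[OF fin VI, where f = f and M = M])
    show "right_deriv I Y g \<in> V" if "g \<in> V" "Y \<in> fmats I" for g Y using that all by (auto simp: L_def)
    have "q M = 0" if "M \<in> S" for M using q(3)[of M] q(4) p(2)[OF that] by simp
    then show "f \<in> V" using q(1) unfolding V_def by blast
    fix g assume "g \<in> V"
    then obtain q where q: "reduces_to I q g" "q (fmat_one I) = 0" using one by (auto simp: V_def)
    have "scalars_to_fls (fmat_one I) = (fmat_one I :: ('i, complex fls) fmat)" "(\<lambda>i j. fps_nth (fmat_one I i j) 0) = (fmat_one I :: ('i, complex) fmat)"
      by (auto simp: scalars_to_fls_def fmat_one_def fun_eq_iff)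
    then show "g (fmat_one I) = 0" using reduces_to_value[OF q(1), of "fmat_one I"] q(2) by auto
  qed
  then show False using q(2) by blast
qed

section \<open>Solutions along paths\<close>

text \<open>Radial integration of the form with coefficients \<open>g s\<close> and constant
  covectors \<open>\<beta> s\<close>, which is the shape of \<open>kz\<close> times a matrix once it
  is expanded in the \<open>b s\<close>. Continuity of the \<open>g' s\<close> allows
  differentiation under the integral.\<close>

lemma poincare_ball:
  fixes g :: "'s \<Rightarrow> 'e::euclidean_space \<Rightarrow> complex" and \<beta> :: "'s \<Rightarrow> 'e \<Rightarrow> complex"
  assumes d: "\<And>s x. s \<in> S \<Longrightarrow> x \<in> ball c r \<Longrightarrow> (g s has_derivative g' s x) (at x)"
    and cont: "\<And>s u. s \<in> S \<Longrightarrow> continuous_on (ball c r) (\<lambda>x. g' s x u)"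
    and \<beta>: "\<And>s. s \<in> S \<Longrightarrow> bounded_linear (\<beta> s)"
    and closed: "\<And>x u v. x \<in> ball c r \<Longrightarrow> (\<Sum>s\<in>S. g' s x u * \<beta> s v) = (\<Sum>s\<in>S. g' s x v * \<beta> s u)"
  shows "\<exists>f. f c = a \<and> (\<forall>x\<in>ball c r. (f has_derivative (\<lambda>v. \<Sum>s\<in>S. g s x * \<beta> s v)) (at x))"
proof (cases "r > 0")
  case False
  then have "ball c r = {}" by simp
  then have "\<forall>x\<in>ball c r. P x" for P by blast
  then show ?thesis by (intro exI[of _ "\<lambda>_. a"] conjI refl)
next
  case True
  define p where "p x t = c + t *\<^sub>R (x - c)" for x and t :: real
  have p_in: "p x t \<in> ball c r" if "x \<in> ball c r" "t \<in> {0..1}" for x t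
  proof -
    have "norm (t *\<^sub>R (x - c)) \<le> norm (x - c)" using that by (simp add: mult_left_le_one_le)
    then show ?thesis using that by (auto simp: p_def dist_norm norm_minus_commute)
  qed
  define F where "F x t = (\<Sum>s\<in>S. g s (p x t) * \<beta> s (x - c))" for x t
  define D where "D x t u = (\<Sum>s\<in>S. g' s (p x t) (t *\<^sub>R u) * \<beta> s (x - c) + g s (p x t) * \<beta> s u)" for x t u
  have hd: "((\<lambda>x. F x t) has_derivative D x t) (at x)" if x: "x \<in> ball c r" and t: "t \<in> {0..1}" for x t
  proof -
    have "((\<lambda>x. g s (p x t)) has_derivative (\<lambda>u. g' s (p x t) (t *\<^sub>R u))) (at x)" if s: "s \<in> S" for s
    proof -
      have "((\<lambda>x. p x t) has_derivative (\<lambda>u. t *\<^sub>R u)) (at x)"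
        unfolding p_def by (auto intro!: derivative_eq_intros)
      then show ?thesis
        using has_derivative_compose[of "\<lambda>x. p x t" _ x UNIV "g s"] d[OF s p_in[OF x t]] by blast
    qed
    moreover have "((\<lambda>x. \<beta> s (x - c)) has_derivative (\<lambda>u. \<beta> s u)) (at x)" if s: "s \<in> S" for s
      by (rule bounded_linear.has_derivative[OF \<beta>[OF s]]) (auto intro!: derivative_eq_intros)
    ultimately show ?thesis
      unfolding F_def D_def by (auto intro!: derivative_eq_intros simp: add.commute)
  qed
  have gc: "continuous_on (ball c r) (g s)" if "s \<in> S" for s
    by (rule has_derivative_continuous_on[of _ _ "g' s"]) (rule has_derivative_at_withinI[OF d[OF that]])
  have bl: "bounded_linear (D x t)" if "x \<in> ball c r" "t \<in> {0..1}" for x t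
    using hd[OF that] by (rule has_derivative_bounded_linear)
  have lin: "g' s x (t *\<^sub>R u) = t *\<^sub>R g' s x u" if "s \<in> S" "x \<in> ball c r" for s x t u
    by (rule linear_cmul[OF has_derivative_linear[OF d[OF that]]])
  have D_alt: "D x t u = (\<Sum>s\<in>S. (t *\<^sub>R g' s (p x t) u) * \<beta> s (x - c) + g s (p x t) * \<beta> s u)"
    if "x \<in> ball c r" "t \<in> {0..1}" for x t u
    unfolding D_def by (intro sum.cong refl) (simp only: lin[OF _ p_in[OF that]])
  have pc: "continuous_on A (\<lambda>q. p (fst q) (snd q))" for A
    unfolding p_def by (intro continuous_intros)
  have Dc: "continuous_on (ball c r \<times> {0..1}) (\<lambda>q. D (fst q) (snd q) u)" for u
  proof -
    have "continuous_on (ball c r \<times> {0..1})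
      (\<lambda>q. \<Sum>s\<in>S. (snd q *\<^sub>R g' s (p (fst q) (snd q)) u) * \<beta> s (fst q - c) + g s (p (fst q) (snd q)) * \<beta> s u)"
    proof (intro continuous_intros)
      fix s assume s: "s \<in> S"
      show "continuous_on (ball c r \<times> {0..1}) (\<lambda>q. g' s (p (fst q) (snd q)) u)"
        by (rule continuous_on_compose2[OF cont[OF s] pc]) (auto intro: p_in)
      show "continuous_on (ball c r \<times> {0..1}) (\<lambda>q. g s (p (fst q) (snd q)))"
        by (rule continuous_on_compose2[OF gc[OF s] pc]) (auto intro: p_in)
      show "continuous_on (ball c r \<times> {0..1}) (\<lambda>q. \<beta> s (fst q - c))"
        by (rule bounded_linear.continuous_on[OF \<beta>[OF s]]) (intro continuous_intros)
    qed
    then show ?thesis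
      by (rule continuous_on_eq) (auto simp: D_alt)
  qed
  have hl: "((\<lambda>x. integral (cbox 0 1) (F x)) has_derivative
      blinfun_apply (integral (cbox 0 1) (\<lambda>t. Blinfun (D x t)))) (at x within ball c r)" if x: "x \<in> ball c r" for x
  proof (rule leibniz_rule[where fx = "\<lambda>x t. Blinfun (D x t)"])
    fix x and t :: real assume "x \<in> ball c r" "t \<in> cbox 0 1"
    then show "((\<lambda>x. F x t) has_derivative blinfun_apply (Blinfun (D x t))) (at x within ball c r)"
      using hd[of x t] bl[of x t] by (simp add: bounded_linear_Blinfun_apply has_derivative_at_withinI)
  next
    fix x assume x: "x \<in> ball c r"
    have "continuous_on {0..1} (F x)"
      unfolding F_def
    proof (intro continuous_intros)
      fix s assume s: "s \<in> S"
      show "continuous_on {0..1} (\<lambda>t. g s (p x t))"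
        by (rule continuous_on_compose2[OF gc[OF s]]) (auto simp: p_def intro!: continuous_intros p_in[unfolded p_def] x)
    qed
    then show "F x integrable_on cbox 0 1" by (simp add: integrable_continuous_interval)
  next
    show "continuous_on (ball c r \<times> cbox 0 1) (\<lambda>(x, t). Blinfun (D x t))"
    proof (rule continuous_on_blinfun_componentwise)
      fix u :: 'e
      show "continuous_on (ball c r \<times> cbox 0 1) (\<lambda>q. blinfun_apply (case q of (x, t) \<Rightarrow> Blinfun (D x t)) u)"
        by (rule continuous_on_eq[OF Dc[of u, folded cbox_interval]])
           (auto simp: bounded_linear_Blinfun_apply bl)
    qed
  qed (use x in auto)
  have val: "blinfun_apply (integral (cbox 0 1) (\<lambda>t. Blinfun (D x t))) u = (\<Sum>s\<in>S. g s x * \<beta> s u)"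
    if x: "x \<in> ball c r" for x u
  proof -
    have "continuous_on {0..1} (\<lambda>t. Blinfun (D x t))"
    proof (rule continuous_on_blinfun_componentwise)
      fix u :: 'e
      have "continuous_on {0..1} (\<lambda>t. D (fst (x, t)) (snd (x, t)) u)"
        by (rule continuous_on_compose2[OF Dc[of u], of "{0..1}" "\<lambda>t. (x, t)"])
           (use x in \<open>auto intro!: continuous_on_Pair continuous_on_const continuous_on_id\<close>)
      then have "continuous_on {0..1} (\<lambda>t. D x t u)" by simp
      then show "continuous_on {0..1} (\<lambda>t. blinfun_apply (Blinfun (D x t)) u)"
        by (rule continuous_on_eq) (use x in \<open>simp add: bounded_linear_Blinfun_apply bl\<close>)
    qed
    then have "(\<lambda>t. Blinfun (D x t)) integrable_on cbox 0 1" by (simp add: integrable_continuous_interval)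
    then have "blinfun_apply (integral (cbox 0 1) (\<lambda>t. Blinfun (D x t))) u = integral {0..1} (\<lambda>t. blinfun_apply (Blinfun (D x t)) u)"
      by (simp add: blinfun_apply_integral)
    also have "\<dots> = integral {0..1} (\<lambda>t. D x t u)"
      by (rule integral_cong) (use x in \<open>simp add: bounded_linear_Blinfun_apply bl\<close>)
    also have "\<dots> = (\<Sum>s\<in>S. g s x * \<beta> s u)"
    proof (rule integral_unique)
      \<comment> \<open>By closedness \<open>D x t u\<close> is the derivative in \<open>t\<close>
        of \<open>t\<close> times the form at \<open>p x t\<close> applied to \<open>u\<close>;
        hence the integral is the form at \<open>x\<close>.\<close>
      define H where "H t = of_real t * (\<Sum>s\<in>S. g s (p x t) * \<beta> s u)" for t
      have "(H has_vector_derivative D x t u) (at t within {0..1})" if t: "t \<in> {0..1}" for t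
      proof -
        have "((\<lambda>t. g s (p x t)) has_vector_derivative g' s (p x t) (x - c)) (at t within {0..1})" if s: "s \<in> S" for s
        proof -
          have "((\<lambda>t. p x t) has_derivative (\<lambda>h. h *\<^sub>R (x - c))) (at t within {0..1})"
            unfolding p_def by (auto intro!: derivative_eq_intros)
          from has_derivative_compose[OF this d[OF s p_in[OF x t]]]
          show ?thesis unfolding has_vector_derivative_def by (simp only: lin[OF s p_in[OF x t]])
        qed
        then have "(H has_vector_derivative (of_real t * (\<Sum>s\<in>S. g' s (p x t) (x - c) * \<beta> s u)
            + 1 * (\<Sum>s\<in>S. g s (p x t) * \<beta> s u))) (at t within {0..1})"
          unfolding H_def
          by (intro has_vector_derivative_mult has_vector_derivative_sum has_vector_derivative_mult_left)
             (auto simp: has_vector_derivative_def scaleR_conv_of_real intro!: derivative_eq_intros)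
        moreover have "of_real t * (\<Sum>s\<in>S. g' s (p x t) (x - c) * \<beta> s u) + 1 * (\<Sum>s\<in>S. g s (p x t) * \<beta> s u) = D x t u"
          unfolding D_alt[OF x t] closed[OF p_in[OF x t], of "x - c" u] sum.distrib
          by (simp add: sum_distrib_left scaleR_conv_of_real mult.assoc)
        ultimately show ?thesis by simp
      qed
      then have "((\<lambda>t. D x t u) has_integral H 1 - H 0) {0..1}" by (intro fundamental_theorem_of_calculus) auto
      then show "((\<lambda>t. D x t u) has_integral (\<Sum>s\<in>S. g s x * \<beta> s u)) {0..1}" by (simp add: H_def p_def)
    qed
    finally show ?thesis .
  qed
  define f where "f x = integral (cbox 0 1) (F x) - integral (cbox 0 1) (F c) + a" for x
  have "(f has_derivative (\<lambda>v. \<Sum>s\<in>S. g s x * \<beta> s v)) (at x)" if x: "x \<in> ball c r" for x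
  proof -
    have "blinfun_apply (integral (cbox 0 1) (\<lambda>t. Blinfun (D x t))) = (\<lambda>v. \<Sum>s\<in>S. g s x * \<beta> s v)"
      using val[OF x] by blast
    then have "((\<lambda>x. integral (cbox 0 1) (F x)) has_derivative (\<lambda>v. \<Sum>s\<in>S. g s x * \<beta> s v)) (at x)"
      using hl[OF x] at_within_open[OF x open_ball] by simp
    then show ?thesis unfolding f_def by (auto intro!: derivative_eq_intros)
  qed
  then show ?thesis by (intro exI[of _ f]) (simp add: f_def)
qed

locale kz_system = reflection_arrangement W b
  for W :: "(complex^'n^'n) set" and b :: "complex^'n^'n \<Rightarrow> complex^'n \<Rightarrow> complex" +
  fixes m :: complex
begin

abbreviation "X \<equiv> hyperplane_complement W"
abbreviation "kz \<equiv> kz_form W b m"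
abbreviation "\<omega> \<equiv> h_kz_form W b m"

lemma b_bounded_linear: "s \<in> \<R> \<Longrightarrow> bounded_linear (b s)"
proof -
  assume s: "s \<in> \<R>"
  have "linear (b s)"
  proof
    fix x y :: "complex^'n" and r :: real
    show "b s (x + y) = b s x + b s y" using s by (simp add: b_simps)
    have "r *\<^sub>R x = of_real r *s x" by (simp add: vec_eq_iff scaleR_conv_of_real[where 'a = complex])
    then show "b s (r *\<^sub>R x) = r *\<^sub>R b s x" using s by (simp add: b_simps scaleR_conv_of_real)
  qed
  then show ?thesis by (simp add: linear_conv_bounded_linear)
qed

lemma b_continuous: "s \<in> \<R> \<Longrightarrow> continuous_on A (b s)"
  using b_bounded_linear linear_continuous_on by blast

lemma open_X: "open X"
proof -
  have "X = (\<Inter>s\<in>\<R>. {x. b s x \<noteq> 0})" by (auto simp: X_iff)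
  moreover have "open {x. b s x \<noteq> 0}" if "s \<in> \<R>" for s
    using open_Collect_neq[OF b_continuous[OF that] continuous_on_const] by simp
  ultimately show ?thesis using finite_R by (simp add: open_INT)
qed

lemma ball_in_X: "x \<in> X \<Longrightarrow> \<exists>r>0. ball x r \<subseteq> X"
  using open_X open_contains_ball by blast

lemma kz_mult_expand:
  "fmat_mult \<R> (kz x v) F i j = (\<Sum>s\<in>\<R>. (\<Sum>l\<in>\<R>. t_op W m s i l * F l j) * log_form (b s) x v)"
proof -
  have "fmat_mult \<R> (kz x v) F i j = (\<Sum>l\<in>\<R>. \<Sum>s\<in>\<R>. t_op W m s i l * F l j * log_form (b s) x v)"
    by (simp add: fmat_mult_def kz_form_def sum_distrib_right sum_distrib_left mult_ac)
  also have "\<dots> = (\<Sum>s\<in>\<R>. \<Sum>l\<in>\<R>. t_op W m s i l * F l j * log_form (b s) x v)" by (rule sum.swap)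
  finally show ?thesis by (simp add: sum_distrib_right)
qed

text \<open>Integrability in the shape in which it yields closedness below.\<close>

lemma kz_commute:
  assumes "x \<in> X"
  shows "fmat_mult \<R> (kz x v) (fmat_mult \<R> (kz x w) F) = fmat_mult \<R> (kz x w) (fmat_mult \<R> (kz x v) F)"
proof -
  have "fmat_mult \<R> (kz x v) (kz x w) - fmat_mult \<R> (kz x w) (kz x v) = 0"
    using kz_integrable[of m] assms unfolding integrable_form_def wedge_def by blast
  then have "fmat_mult \<R> (kz x v) (kz x w) = fmat_mult \<R> (kz x w) (kz x v)" by simp
  then show ?thesis by (simp add: fmat_mult_assoc[OF finite_R, symmetric])
qed

text \<open>The recursion between consecutive powers of \<open>h\<close> in a solution: \<Psi> is
  the coefficient of one power and \<Phi> that of the next.\<close>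

definition kz_primitive :: "(complex^'n) set \<Rightarrow> (complex^'n \<Rightarrow> (complex^'n^'n, complex) fmat) \<Rightarrow>
    (complex^'n \<Rightarrow> (complex^'n^'n, complex) fmat) \<Rightarrow> bool" where
  "kz_primitive U \<Phi> \<Psi> \<longleftrightarrow> (\<forall>x\<in>U. \<forall>i\<in>\<R>. \<forall>j\<in>\<R>.
     ((\<lambda>y. \<Phi> y i j) has_derivative (\<lambda>v. fmat_mult \<R> (kz x v) (\<Psi> x) i j)) (at x))"

lemma kz_primitive_continuous:
  assumes "kz_primitive U \<Phi> \<Psi>" "i \<in> \<R>" "j \<in> \<R>"
  shows "continuous_on U (\<lambda>x. \<Phi> x i j)"
  by (rule has_derivative_continuous_on[where f' = "\<lambda>x v. fmat_mult \<R> (kz x v) (\<Psi> x) i j"],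
      rule has_derivative_at_withinI) (use assms in \<open>auto simp: kz_primitive_def\<close>)

text \<open>\<open>kz\<close> times \<Phi> is closed: \<open>kz\<close> is closed, and replacing
  \<open>d\<Phi>\<close> by \<open>kz\<close> times \<Psi> turns the remaining term into the wedge
  square of \<open>kz\<close> times \<Psi>, which is 0. This is why \<Phi> has to come with its own
  predecessor \<Psi>.\<close>

lemma kz_primitive_step:
  assumes U: "ball c r \<subseteq> X" and \<Phi>: "kz_primitive (ball c r) \<Phi> \<Psi>"
    and \<Psi>: "\<And>i j. i \<in> \<R> \<Longrightarrow> j \<in> \<R> \<Longrightarrow> continuous_on (ball c r) (\<lambda>x. \<Psi> x i j)"
  shows "\<exists>\<Phi>'. \<Phi>' c = G \<and> kz_primitive (ball c r) \<Phi>' \<Phi>"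
proof -
  define \<kappa> where "\<kappa> = 1 / (\<i> * complex_of_real pi)"
  have "\<exists>f. f c = G i j \<and> (\<forall>x\<in>ball c r. (f has_derivative (\<lambda>v. fmat_mult \<R> (kz x v) (\<Phi> x) i j)) (at x))"
    if ij: "i \<in> \<R>" "j \<in> \<R>" for i j
  proof -
    define g where "g s x = (\<Sum>l\<in>\<R>. t_op W m s i l * \<Phi> x l j) * (\<kappa> / b s x)" for s x
    define D where "D x l u = fmat_mult \<R> (kz x u) (\<Psi> x) l j" for x l u
    define g' where "g' s x u = (\<Sum>l\<in>\<R>. t_op W m s i l * D x l u) * (\<kappa> / b s x)
       - (\<Sum>l\<in>\<R>. t_op W m s i l * \<Phi> x l j) * \<kappa> / (b s x)\<^sup>2 * b s u" for s x u
    have nz: "b s x \<noteq> 0" if "s \<in> \<R>" "x \<in> ball c r" for s x using that U X_iff by blast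
    have "\<exists>f. f c = G i j \<and> (\<forall>x\<in>ball c r. (f has_derivative (\<lambda>v. \<Sum>s\<in>\<R>. g s x * b s v)) (at x))"
    proof (rule poincare_ball[where g' = g'])
      fix s x assume s: "s \<in> \<R>" and x: "x \<in> ball c r"
      have "((\<lambda>y. \<Sum>l\<in>\<R>. t_op W m s i l * \<Phi> y l j) has_derivative (\<lambda>u. \<Sum>l\<in>\<R>. t_op W m s i l * D x l u)) (at x)"
        using \<Phi> x ij by (intro has_derivative_sum has_derivative_mult_right) (auto simp: kz_primitive_def D_def)
      moreover have "((\<lambda>y. \<kappa> / b s y) has_derivative (\<lambda>u. - \<kappa> / (b s x)\<^sup>2 * b s u)) (at x)"
        using nz[OF s x] bounded_linear_imp_has_derivative[OF b_bounded_linear[OF s], of "at x"]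
        by (auto intro!: derivative_eq_intros simp: power2_eq_square)
      ultimately show "(g s has_derivative g' s x) (at x)"
        unfolding g_def g'_def by (rule has_derivative_eq_rhs[OF has_derivative_mult]) (simp add: fun_eq_iff algebra_simps)
    next
      fix s u assume s: "s \<in> \<R>"
      have bc: "continuous_on (ball c r) (b s')" if "s' \<in> \<R>" for s' using b_continuous that .
      have "continuous_on (ball c r) (\<lambda>x. D x l u)" if "l \<in> \<R>" for l
        unfolding D_def kz_mult_expand log_form_def using nz that ij
        by (intro continuous_intros \<Psi> bc) auto
      then show "continuous_on (ball c r) (\<lambda>x. g' s x u)"
        unfolding g'_def using nz s ij kz_primitive_continuous[OF \<Phi>]
        by (intro continuous_intros bc) auto
    next
      fix x u v assume x: "x \<in> ball c r"
      \<comment> \<open>The first term is symmetric in \<open>u\<close> and \<open>v\<close> by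
        \<open>kz_commute\<close>, the second because each summand contains the product
        \<open>b s u * b s v\<close>.\<close>
      have *: "(\<Sum>s\<in>\<R>. g' s x u * b s v) = fmat_mult \<R> (kz x v) (fmat_mult \<R> (kz x u) (\<Psi> x)) i j
         - (\<Sum>s\<in>\<R>. (\<Sum>l\<in>\<R>. t_op W m s i l * \<Phi> x l j) * \<kappa> / (b s x)\<^sup>2 * (b s u * b s v))" for u v
        unfolding kz_mult_expand[of _ v] g'_def D_def log_form_def \<kappa>_def
        by (subst sum_subtractf[symmetric], rule sum.cong[OF refl]) (simp only: left_diff_distrib, simp)
      show "(\<Sum>s\<in>\<R>. g' s x u * b s v) = (\<Sum>s\<in>\<R>. g' s x v * b s u)"
        unfolding * using kz_commute[of x u v "\<Psi> x"] x U by (auto simp: mult.commute[of "b _ u"])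
    qed (rule b_bounded_linear)
    moreover have "(\<Sum>s\<in>\<R>. g s x * b s v) = fmat_mult \<R> (kz x v) (\<Phi> x) i j" for x v
      unfolding kz_mult_expand g_def by (simp add: log_form_def \<kappa>_def)
    ultimately show ?thesis by simp
  qed
  then obtain f where f: "\<And>i j. i \<in> \<R> \<Longrightarrow> j \<in> \<R> \<Longrightarrow> f i j c = G i j \<and>
      (\<forall>x\<in>ball c r. (f i j has_derivative (\<lambda>v. fmat_mult \<R> (kz x v) (\<Phi> x) i j)) (at x))"
    by metis
  define \<Phi>' where "\<Phi>' x = (\<lambda>i j. if i \<in> \<R> \<and> j \<in> \<R> then f i j x else G i j)" for x
  have "\<Phi>' c = G" using f by (auto simp: \<Phi>'_def fun_eq_iff)
  moreover have "kz_primitive (ball c r) \<Phi>' \<Phi>" using f by (simp add: kz_primitive_def \<Phi>'_def)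
  ultimately show ?thesis by blast
qed

lemma omega_coeff:
  "fps_nth (fmat_mult \<R> (\<omega> x v) F i j) k =
    (if k = 0 then 0 else fmat_mult \<R> (kz x v) (\<lambda>i j. fps_nth (F i j) (k - 1)) i j)"
  by (simp add: fmat_mult_def h_kz_form_def fps_sum_nth mult.assoc)

lemma local_solution:
  assumes U: "ball c r \<subseteq> X" and G: "G \<in> fmats \<R>"
  shows "\<exists>\<Phi>. solves_on \<R> \<omega> (ball c r) \<Phi> \<and> \<Phi> c = G"
proof -
  \<comment> \<open>Besides the value at \<open>c\<close> the invariant keeps a continuous
    predecessor, from which closedness of the next form is derived. The coefficient of
    \<open>h^0\<close> is constant, with predecessor 0.\<close>
  define P where "P n \<Phi> \<longleftrightarrow> \<Phi> c = (\<lambda>i j. fps_nth (G i j) n) \<and> (\<exists>\<Psi>. kz_primitive (ball c r) \<Phi> \<Psi> \<and>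
     (\<forall>i\<in>\<R>. \<forall>j\<in>\<R>. continuous_on (ball c r) (\<lambda>x. \<Psi> x i j)))" for n :: nat and \<Phi>
  have "\<exists>f. (\<forall>n. P n (f n)) \<and> (\<forall>n. kz_primitive (ball c r) (f (Suc n)) (f n)) \<and>
     (f 0 = (\<lambda>_. (\<lambda>i j. fps_nth (G i j) 0)))"
  proof -
    have "\<exists>f. \<forall>n. (P n (f n) \<and> (n = 0 \<longrightarrow> f n = (\<lambda>_. (\<lambda>i j. fps_nth (G i j) 0)))) \<and>
        kz_primitive (ball c r) (f (Suc n)) (f n)"
    proof (rule dependent_nat_choice)
      have "kz_primitive (ball c r) (\<lambda>_. (\<lambda>i j. fps_nth (G i j) 0)) (\<lambda>_ _ _. 0)"
        by (simp add: kz_primitive_def fmat_mult_def)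
      then have "P 0 (\<lambda>_. (\<lambda>i j. fps_nth (G i j) 0))"
        unfolding P_def by (intro conjI refl exI[of _ "\<lambda>_ _ _. 0"]) auto
      then show "\<exists>\<Phi>. P 0 \<Phi> \<and> (0 = (0::nat) \<longrightarrow> \<Phi> = (\<lambda>_. (\<lambda>i j. fps_nth (G i j) 0)))" by blast
    next
      fix \<Phi> n assume "P n \<Phi> \<and> (n = 0 \<longrightarrow> \<Phi> = (\<lambda>_. (\<lambda>i j. fps_nth (G i j) 0)))"
      then obtain \<Psi> where \<Psi>: "kz_primitive (ball c r) \<Phi> \<Psi>"
        "\<And>i j. i \<in> \<R> \<Longrightarrow> j \<in> \<R> \<Longrightarrow> continuous_on (ball c r) (\<lambda>x. \<Psi> x i j)" by (auto simp: P_def)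
      obtain \<Phi>' where \<Phi>': "\<Phi>' c = (\<lambda>i j. fps_nth (G i j) (Suc n))" "kz_primitive (ball c r) \<Phi>' \<Phi>"
        using kz_primitive_step[OF U \<Psi>] by blast
      then have "P (Suc n) \<Phi>'"
        unfolding P_def using kz_primitive_continuous[OF \<Psi>(1)] by blast
      then show "\<exists>\<Phi>'. (P (Suc n) \<Phi>' \<and> (Suc n = 0 \<longrightarrow> \<Phi>' = (\<lambda>_. (\<lambda>i j. fps_nth (G i j) 0)))) \<and> kz_primitive (ball c r) \<Phi>' \<Phi>"
        using \<Phi>' by blast
    qed
    then show ?thesis by blast
  qed
  then obtain f where f: "\<And>n. P n (f n)" "\<And>n. kz_primitive (ball c r) (f (Suc n)) (f n)"
    "f 0 = (\<lambda>_. (\<lambda>i j. fps_nth (G i j) 0))" by blast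
  define \<Phi> where "\<Phi> x = (\<lambda>i j. if i \<in> \<R> \<and> j \<in> \<R> then Abs_fps (\<lambda>n. f n x i j) else 0)" for x
  have "solves_on \<R> \<omega> (ball c r) \<Phi>"
    unfolding solves_on_def
  proof (intro conjI ballI allI)
    fix x i j k assume x: "x \<in> ball c r" and ij: "i \<in> \<R>" "j \<in> \<R>"
    show "((\<lambda>y. fps_nth (\<Phi> y i j) k) has_derivative (\<lambda>v. fps_nth (fmat_mult \<R> (\<omega> x v) (\<Phi> x) i j) k)) (at x)"
    proof (cases k)
      case 0
      then show ?thesis using ij f(3) by (simp add: omega_coeff \<Phi>_def)
    next
      case (Suc n)
      have "fmat_mult \<R> (kz x v) (\<lambda>i j. fps_nth (\<Phi> x i j) n) i j = fmat_mult \<R> (kz x v) (f n x) i j" for v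
        using ij by (auto simp: fmat_mult_def \<Phi>_def intro!: sum.cong)
      then show ?thesis using f(2)[of n] x ij by (simp add: omega_coeff Suc kz_primitive_def \<Phi>_def)
    qed
  qed (simp add: \<Phi>_def fmats_def)
  moreover have "\<Phi> c = G"
    using f(1) G by (auto simp: \<Phi>_def P_def fmats_def fun_eq_iff fps_eq_iff)
  ultimately show ?thesis by blast
qed

lemma solves_on_subset: "solves_on \<R> \<omega> U \<Phi> \<Longrightarrow> V \<subseteq> U \<Longrightarrow> solves_on \<R> \<omega> V \<Phi>"
  by (auto simp: solves_on_def)

text \<open>Induction on the power of \<open>h\<close>: equal coefficients one power below give
  equal derivatives, and the ball is convex.\<close>

lemma solves_on_unique:
  assumes 1: "solves_on \<R> \<omega> (ball c r) \<Phi>" and 2: "solves_on \<R> \<omega> (ball c r) \<Psi>"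
    and a: "a \<in> ball c r" "\<Phi> a = \<Psi> a" and x: "x \<in> ball c r"
  shows "\<Phi> x = \<Psi> x"
proof -
  have step: "fps_nth (\<Phi> x i j) k = fps_nth (\<Psi> x i j) k"
    if eq: "\<And>x v. x \<in> ball c r \<Longrightarrow> fps_nth (fmat_mult \<R> (\<omega> x v) (\<Phi> x) i j) k = fps_nth (fmat_mult \<R> (\<omega> x v) (\<Psi> x) i j) k"
      and h: "x \<in> ball c r" "i \<in> \<R>" "j \<in> \<R>" for x i j k
  proof -
    have "fps_nth (\<Phi> x i j) k - fps_nth (\<Psi> x i j) k = fps_nth (\<Phi> a i j) k - fps_nth (\<Psi> a i j) k"
    proof (rule has_derivative_zero_unique[OF convex_ball _ h(1) a(1)], rule has_derivative_at_withinI)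
      fix y assume y: "y \<in> ball c r"
      have "((\<lambda>x. fps_nth (\<Phi> x i j) k - fps_nth (\<Psi> x i j) k) has_derivative
         (\<lambda>v. fps_nth (fmat_mult \<R> (\<omega> y v) (\<Phi> y) i j) k - fps_nth (fmat_mult \<R> (\<omega> y v) (\<Psi> y) i j) k)) (at y)"
        using 1 2 h y unfolding solves_on_def by (intro has_derivative_diff) blast+
      then show "((\<lambda>x. fps_nth (\<Phi> x i j) k - fps_nth (\<Psi> x i j) k) has_derivative (\<lambda>h. 0)) (at y)"
        using eq[OF y] by simp
    qed
    then show ?thesis using a by simp
  qed
  have "\<forall>x\<in>ball c r. \<forall>i\<in>\<R>. \<forall>j\<in>\<R>. fps_nth (\<Phi> x i j) k = fps_nth (\<Psi> x i j) k" for k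
  proof (induction k)
    case 0
    show ?case by (intro ballI step) (simp_all add: omega_coeff)
  next
    case (Suc k)
    show ?case using Suc by (intro ballI step) (simp_all add: omega_coeff, auto simp: fmat_mult_def intro!: sum.cong)
  qed
  moreover have "\<Phi> x \<in> fmats \<R>" "\<Psi> x \<in> fmats \<R>" using 1 2 x by (auto simp: solves_on_def)
  ultimately show ?thesis using x by (fastforce simp: fmats_def fun_eq_iff fps_eq_iff)
qed

lemma solves_on_right_mult:
  assumes "solves_on \<R> \<omega> U \<Phi>" and C: "C \<in> fmats \<R>"
  shows "solves_on \<R> \<omega> U (\<lambda>x. fmat_mult \<R> (\<Phi> x) C)"
  unfolding solves_on_def
proof (intro conjI ballI allI)
  fix x assume x: "x \<in> U"
  have \<Phi>: "\<Phi> x \<in> fmats \<R>" using assms x by (simp add: solves_on_def)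
  show "fmat_mult \<R> (\<Phi> x) C \<in> fmats \<R>" using \<Phi> C by (auto simp: fmats_def fmat_mult_def)
  fix i j k assume ij: "i \<in> \<R>" "j \<in> \<R>"
  have "((\<lambda>y. \<Sum>l\<in>\<R>. \<Sum>p=0..k. fps_nth (\<Phi> y i l) p * fps_nth (C l j) (k - p)) has_derivative
      (\<lambda>v. \<Sum>l\<in>\<R>. \<Sum>p=0..k. fps_nth (fmat_mult \<R> (\<omega> x v) (\<Phi> x) i l) p * fps_nth (C l j) (k - p))) (at x)"
    using assms x ij by (intro has_derivative_sum has_derivative_mult_left) (auto simp: solves_on_def)
  then show "((\<lambda>y. fps_nth (fmat_mult \<R> (\<Phi> y) C i j) k) has_derivative
      (\<lambda>v. fps_nth (fmat_mult \<R> (\<omega> x v) (fmat_mult \<R> (\<Phi> x) C) i j) k)) (at x)"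
    unfolding fmat_mult_assoc[OF finite_R, symmetric]
    unfolding fmat_mult_def[of _ _ C] by (simp add: fps_sum_nth fps_mult_nth)
qed

end

text \<open>Bisection. It is applied to coefficients and also to truth values such as
  \<open>F t = G t\<close>.\<close>

lemma locally_constant_interval:
  fixes \<phi> :: "real \<Rightarrow> 'a"
  assumes "a \<le> b" and loc: "\<And>t. t \<in> {a..b} \<Longrightarrow> \<exists>e>0. \<forall>\<tau>\<in>{a..b} \<inter> ball t e. \<phi> \<tau> = \<phi> t"
  shows "\<phi> b = \<phi> a"
proof -
  have "a \<le> a \<longrightarrow> b \<le> b \<longrightarrow> \<phi> b = \<phi> a"
  proof (rule Bolzano[of a b "\<lambda>u v. a \<le> u \<longrightarrow> v \<le> b \<longrightarrow> \<phi> v = \<phi> u"])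
    fix x assume x: "a \<le> x" "x \<le> b"
    then have "x \<in> {a..b}" by simp
    from loc[OF this] obtain e where e: "e > 0" "\<forall>\<tau>\<in>{a..b} \<inter> ball x e. \<phi> \<tau> = \<phi> x" by blast
    have "\<phi> v = \<phi> u" if "u \<le> x" "x \<le> v" "v - u < e" "a \<le> u" "v \<le> b" for u v
    proof -
      have "u \<in> {a..b} \<inter> ball x e" "v \<in> {a..b} \<inter> ball x e" using that by (auto simp: dist_real_def)
      then show ?thesis using e(2) by metis
    qed
    then show "\<exists>d>0. \<forall>u v. u \<le> x \<and> x \<le> v \<and> v - u < d \<longrightarrow> a \<le> u \<longrightarrow> v \<le> b \<longrightarrow> \<phi> v = \<phi> u"
      using e(1) by blast
  qed (use assms in auto)
  then show ?thesis by simp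
qed

section \<open>Continuation of solutions along continuous paths\<close>

context kz_system begin

text \<open>\<open>solution_along\<close> on an arbitrary interval, so that paths can be cut and
  glued.\<close>

definition solution_on :: "(real \<Rightarrow> complex^'n) \<Rightarrow> real \<Rightarrow> real \<Rightarrow> (real \<Rightarrow> (complex^'n^'n, complex fps) fmat) \<Rightarrow> bool" where
  "solution_on \<gamma> a q F \<longleftrightarrow> (\<forall>t\<in>{a..q}. \<exists>U \<Phi>. open U \<and> \<gamma> t \<in> U \<and> U \<subseteq> X \<and> solves_on \<R> \<omega> U \<Phi> \<and>
     (\<exists>e>0. \<forall>\<tau>\<in>{a..q} \<inter> ball t e. \<gamma> \<tau> \<in> U \<and> F \<tau> = \<Phi> (\<gamma> \<tau>)))"

lemma solution_along_iff: "solution_along \<R> \<omega> X \<gamma> F \<longleftrightarrow> solution_on \<gamma> 0 1 F"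
  by (simp add: solution_along_def solution_on_def)

lemma solution_onE:
  assumes "solution_on \<gamma> a q F" "t \<in> {a..q}"
  obtains U \<Phi> e where "open U" "\<gamma> t \<in> U" "U \<subseteq> X" "solves_on \<R> \<omega> U \<Phi>" "e > 0"
    "\<And>\<tau>. \<tau> \<in> {a..q} \<Longrightarrow> dist t \<tau> < e \<Longrightarrow> \<gamma> \<tau> \<in> U \<and> F \<tau> = \<Phi> (\<gamma> \<tau>)"
proof -
  from bspec[OF assms(1)[unfolded solution_on_def] assms(2)]
  show ?thesis by (elim exE conjE) (rule that, assumption+, auto)
qed

text \<open>Shrinks a local solution to a ball, where \<open>solves_on_unique\<close> applies; the
  bound \<open>R\<close> lets two such balls be nested.\<close>

lemma solution_on_ball:
  assumes sol: "solution_on \<gamma> a q F" and cont: "continuous_on {a..q} \<gamma>" and t: "t \<in> {a..q}" and "R > 0"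
  obtains r \<Phi> e where "0 < r" "r \<le> R" "ball (\<gamma> t) r \<subseteq> X" "solves_on \<R> \<omega> (ball (\<gamma> t) r) \<Phi>" "e > 0"
    "\<And>\<tau>. \<tau> \<in> {a..q} \<Longrightarrow> dist t \<tau> < e \<Longrightarrow> \<gamma> \<tau> \<in> ball (\<gamma> t) r \<and> F \<tau> = \<Phi> (\<gamma> \<tau>)"
proof -
  obtain U \<Phi> e where U: "open U" "\<gamma> t \<in> U" "U \<subseteq> X" "solves_on \<R> \<omega> U \<Phi>" "e > 0"
    "\<And>\<tau>. \<tau> \<in> {a..q} \<Longrightarrow> dist t \<tau> < e \<Longrightarrow> \<gamma> \<tau> \<in> U \<and> F \<tau> = \<Phi> (\<gamma> \<tau>)"
    by (rule solution_onE[OF sol t]) (rule that; assumption)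
  obtain r0 where r0: "r0 > 0" "ball (\<gamma> t) r0 \<subseteq> U" using U open_contains_ball by blast
  define r where "r = min r0 R"
  have r: "r > 0" "r \<le> R" "ball (\<gamma> t) r \<subseteq> U" using r0 \<open>R > 0\<close> by (auto simp: r_def)
  obtain d where d: "d > 0" "\<And>\<tau>. \<tau> \<in> {a..q} \<Longrightarrow> dist \<tau> t < d \<Longrightarrow> dist (\<gamma> \<tau>) (\<gamma> t) < r"
    using cont[unfolded continuous_on_iff, rule_format, OF t r(1)] by blast
  show ?thesis
  proof (rule that[of r \<Phi> "min d e"])
    show "ball (\<gamma> t) r \<subseteq> X" using r U by blast
    show "solves_on \<R> \<omega> (ball (\<gamma> t) r) \<Phi>" by (rule solves_on_subset[OF U(4) r(3)])
    show "min d e > 0" using d U by simp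
    show "\<gamma> \<tau> \<in> ball (\<gamma> t) r \<and> F \<tau> = \<Phi> (\<gamma> \<tau>)" if "\<tau> \<in> {a..q}" "dist t \<tau> < min d e" for \<tau>
      using d(2)[of \<tau>] U(6)[of \<tau>] that by (auto simp: dist_commute)
  qed (use r in auto)
qed

lemma solution_on_fmats:
  assumes "solution_on \<gamma> a q F" "t \<in> {a..q}"
  shows "F t \<in> fmats \<R>"
  by (rule solution_onE[OF assms]) (use assms(2) in \<open>auto simp: solves_on_def\<close>)

text \<open>The truth value of \<open>F t = G t\<close> is locally constant, by uniqueness on
  balls.\<close>

lemma solution_on_unique:
  assumes F: "solution_on \<gamma> a q F" and G: "solution_on \<gamma> a q G" and cont: "continuous_on {a..q} \<gamma>"
    and "F a = G a" and t: "t \<in> {a..q}"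
  shows "F t = G t"
proof -
  have "(F t = G t) = (F a = G a)"
  proof (rule locally_constant_interval[where \<phi> = "\<lambda>t. F t = G t"])
    fix \<tau>0 assume \<tau>0: "\<tau>0 \<in> {a..t}"
    then have \<tau>0': "\<tau>0 \<in> {a..q}" using t by auto
    obtain r \<Phi> e where 1: "0 < r" "solves_on \<R> \<omega> (ball (\<gamma> \<tau>0) r) \<Phi>" "e > 0"
      "\<And>\<tau>. \<tau> \<in> {a..q} \<Longrightarrow> dist \<tau>0 \<tau> < e \<Longrightarrow> \<gamma> \<tau> \<in> ball (\<gamma> \<tau>0) r \<and> F \<tau> = \<Phi> (\<gamma> \<tau>)"
      by (rule solution_on_ball[OF F cont \<tau>0' zero_less_one]) (rule that; assumption)
    obtain r' \<Psi> e' where 2: "0 < r'" "r' \<le> r" "solves_on \<R> \<omega> (ball (\<gamma> \<tau>0) r') \<Psi>" "e' > 0"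
      "\<And>\<tau>. \<tau> \<in> {a..q} \<Longrightarrow> dist \<tau>0 \<tau> < e' \<Longrightarrow> \<gamma> \<tau> \<in> ball (\<gamma> \<tau>0) r' \<and> G \<tau> = \<Psi> (\<gamma> \<tau>)"
      by (rule solution_on_ball[OF G cont \<tau>0' 1(1)]) (rule that; assumption)
    have \<Phi>: "solves_on \<R> \<omega> (ball (\<gamma> \<tau>0) r') \<Phi>" using solves_on_subset[OF 1(2)] 2(2) by (simp add: subset_ball)
    have "(F \<tau> = G \<tau>) = (F \<tau>0 = G \<tau>0)" if \<tau>: "\<tau> \<in> {a..t} \<inter> ball \<tau>0 (min e e')" for \<tau>
    proof -
      have h: "\<gamma> \<tau> \<in> ball (\<gamma> \<tau>0) r'" "\<gamma> \<tau>0 \<in> ball (\<gamma> \<tau>0) r'" "F \<tau> = \<Phi> (\<gamma> \<tau>)" "G \<tau> = \<Psi> (\<gamma> \<tau>)"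
        "F \<tau>0 = \<Phi> (\<gamma> \<tau>0)" "G \<tau>0 = \<Psi> (\<gamma> \<tau>0)"
        using 1(3,4) 2(1,4,5) \<tau> \<tau>0' t by auto
      show ?thesis unfolding h(3-6)
        using solves_on_unique[OF \<Phi> 2(3) h(1) _ h(2)] solves_on_unique[OF \<Phi> 2(3) h(2) _ h(1)] by blast
    qed
    then show "\<exists>e>0. \<forall>\<tau>\<in>{a..t} \<inter> ball \<tau>0 e. (F \<tau> = G \<tau>) = (F \<tau>0 = G \<tau>0)"
      using 1(3) 2(4) by (intro exI[of _ "min e e'"]) auto
  qed (use t in auto)
  then show ?thesis using assms by simp
qed

lemma solution_on_right_mult:
  assumes F: "solution_on \<gamma> a q F" and C: "C \<in> fmats \<R>"
  shows "solution_on \<gamma> a q (\<lambda>t. fmat_mult \<R> (F t) C)"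
  unfolding solution_on_def
proof
  fix t assume t: "t \<in> {a..q}"
  obtain U \<Phi> e where U: "open U" "\<gamma> t \<in> U" "U \<subseteq> X" "solves_on \<R> \<omega> U \<Phi>" "e > 0"
    "\<And>\<tau>. \<tau> \<in> {a..q} \<Longrightarrow> dist t \<tau> < e \<Longrightarrow> \<gamma> \<tau> \<in> U \<and> F \<tau> = \<Phi> (\<gamma> \<tau>)"
    by (rule solution_onE[OF F t]) (rule that; assumption)
  show "\<exists>U \<Phi>. open U \<and> \<gamma> t \<in> U \<and> U \<subseteq> X \<and> solves_on \<R> \<omega> U \<Phi> \<and>
     (\<exists>e>0. \<forall>\<tau>\<in>{a..q} \<inter> ball t e. \<gamma> \<tau> \<in> U \<and> fmat_mult \<R> (F \<tau>) C = \<Phi> (\<gamma> \<tau>))"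
    using U solves_on_right_mult[OF U(4) C]
    by (intro exI[of _ U] exI[of _ "\<lambda>x. fmat_mult \<R> (\<Phi> x) C"] conjI exI[of _ e]) auto
qed

lemma solution_on_reparam:
  assumes F: "solution_on \<gamma> a q F" and \<phi>: "continuous_on {c..d} \<phi>" "\<phi> ` {c..d} \<subseteq> {a..q}"
    and eq: "\<And>t. t \<in> {c..d} \<Longrightarrow> \<delta> t = \<gamma> (\<phi> t)" "\<And>t. t \<in> {c..d} \<Longrightarrow> G t = F (\<phi> t)"
  shows "solution_on \<delta> c d G"
  unfolding solution_on_def
proof
  fix t assume t: "t \<in> {c..d}"
  then have \<phi>t: "\<phi> t \<in> {a..q}" using \<phi>(2) t by blast
  obtain U \<Phi> e where U: "open U" "\<gamma> (\<phi> t) \<in> U" "U \<subseteq> X" "solves_on \<R> \<omega> U \<Phi>" "e > 0"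
    "\<And>\<tau>. \<tau> \<in> {a..q} \<Longrightarrow> dist (\<phi> t) \<tau> < e \<Longrightarrow> \<gamma> \<tau> \<in> U \<and> F \<tau> = \<Phi> (\<gamma> \<tau>)"
    by (rule solution_onE[OF F \<phi>t]) (rule that; assumption)
  obtain e' where e': "e' > 0" "\<And>\<tau>. \<tau> \<in> {c..d} \<Longrightarrow> dist \<tau> t < e' \<Longrightarrow> dist (\<phi> \<tau>) (\<phi> t) < e"
    using \<phi>(1)[unfolded continuous_on_iff, rule_format, OF t U(5)] by blast
  have "\<delta> \<tau> \<in> U \<and> G \<tau> = \<Phi> (\<delta> \<tau>)" if \<tau>: "\<tau> \<in> {c..d} \<inter> ball t e'" for \<tau>
  proof -
    have "\<phi> \<tau> \<in> {a..q}" "dist (\<phi> t) (\<phi> \<tau>) < e"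
      using \<tau> \<phi>(2) e'(2)[of \<tau>] by (blast, auto simp: dist_commute)
    then show ?thesis using U(6) eq \<tau> by auto
  qed
  then show "\<exists>U \<Phi>. open U \<and> \<delta> t \<in> U \<and> U \<subseteq> X \<and> solves_on \<R> \<omega> U \<Phi> \<and>
     (\<exists>e>0. \<forall>\<tau>\<in>{c..d} \<inter> ball t e. \<delta> \<tau> \<in> U \<and> G \<tau> = \<Phi> (\<delta> \<tau>))"
    using U(1-4) e'(1) eq(1)[OF t] by (intro exI[of _ U] exI[of _ \<Phi>] conjI exI[of _ e']) auto
qed

lemma solution_on_glue:
  assumes F: "solution_on \<gamma> a q F" and G: "solution_on \<gamma> q c G" and cont: "continuous_on {a..c} \<gamma>"
    and abc: "a \<le> q" "q \<le> c" and eq: "F q = G q"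
  shows "solution_on \<gamma> a c (\<lambda>t. if t \<le> q then F t else G t)" (is "solution_on _ _ _ ?H")
  unfolding solution_on_def
proof
  fix t assume t: "t \<in> {a..c}"
  consider "t < q" | "t > q" | "t = q" by linarith
  then show "\<exists>U \<Phi>. open U \<and> \<gamma> t \<in> U \<and> U \<subseteq> X \<and> solves_on \<R> \<omega> U \<Phi> \<and>
     (\<exists>e>0. \<forall>\<tau>\<in>{a..c} \<inter> ball t e. \<gamma> \<tau> \<in> U \<and> ?H \<tau> = \<Phi> (\<gamma> \<tau>))"
  proof cases
    case 1
    then have t1: "t \<in> {a..q}" using t by simp
    obtain U \<Phi> e where U: "open U" "\<gamma> t \<in> U" "U \<subseteq> X" "solves_on \<R> \<omega> U \<Phi>" "e > 0"
      "\<And>\<tau>. \<tau> \<in> {a..q} \<Longrightarrow> dist t \<tau> < e \<Longrightarrow> \<gamma> \<tau> \<in> U \<and> F \<tau> = \<Phi> (\<gamma> \<tau>)"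
      by (rule solution_onE[OF F t1]) (rule that; assumption)
    show ?thesis
      using 1 U by (intro exI[of _ U] exI[of _ \<Phi>] conjI exI[of _ "min e (q - t)"]) (auto simp: dist_real_def)
  next
    case 2
    then have t2: "t \<in> {q..c}" using t by simp
    obtain U \<Phi> e where U: "open U" "\<gamma> t \<in> U" "U \<subseteq> X" "solves_on \<R> \<omega> U \<Phi>" "e > 0"
      "\<And>\<tau>. \<tau> \<in> {q..c} \<Longrightarrow> dist t \<tau> < e \<Longrightarrow> \<gamma> \<tau> \<in> U \<and> G \<tau> = \<Phi> (\<gamma> \<tau>)"
      by (rule solution_onE[OF G t2]) (rule that; assumption)
    show ?thesis
      using 2 U by (intro exI[of _ U] exI[of _ \<Phi>] conjI exI[of _ "min e (t - q)"]) (auto simp: dist_real_def)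
  next
    case 3
    have cab: "continuous_on {a..q} \<gamma>" "continuous_on {q..c} \<gamma>"
      using cont abc by (auto intro: continuous_on_subset)
    have qI: "q \<in> {a..q}" "q \<in> {q..c}" using abc by auto
    obtain r \<Phi> e where 1: "0 < r" "ball (\<gamma> q) r \<subseteq> X" "solves_on \<R> \<omega> (ball (\<gamma> q) r) \<Phi>" "e > 0"
      "\<And>\<tau>. \<tau> \<in> {a..q} \<Longrightarrow> dist q \<tau> < e \<Longrightarrow> \<gamma> \<tau> \<in> ball (\<gamma> q) r \<and> F \<tau> = \<Phi> (\<gamma> \<tau>)"
      by (rule solution_on_ball[OF F cab(1) qI(1) zero_less_one]) (rule that; assumption)
    obtain r' \<Psi> e' where 2: "0 < r'" "r' \<le> r" "solves_on \<R> \<omega> (ball (\<gamma> q) r') \<Psi>" "e' > 0"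
      "\<And>\<tau>. \<tau> \<in> {q..c} \<Longrightarrow> dist q \<tau> < e' \<Longrightarrow> \<gamma> \<tau> \<in> ball (\<gamma> q) r' \<and> G \<tau> = \<Psi> (\<gamma> \<tau>)"
      by (rule solution_on_ball[OF G cab(2) qI(2) 1(1)]) (rule that; assumption)
    have \<Phi>: "solves_on \<R> \<omega> (ball (\<gamma> q) r') \<Phi>" using solves_on_subset[OF 1(3)] 2(2) by (simp add: subset_ball)
    have q: "\<gamma> q \<in> ball (\<gamma> q) r'" using 2(1) by simp
    \<comment> \<open>The local solutions of both sides agree at the junction, hence on the smaller
      ball, so \<Phi> continues across it.\<close>
    have "\<Phi> (\<gamma> q) = \<Psi> (\<gamma> q)" using 1(4) 1(5)[of q] 2(4) 2(5)[of q] eq abc by simp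
    then have \<Psi>: "\<Psi> x = \<Phi> x" if "x \<in> ball (\<gamma> q) r'" for x
      using solves_on_unique[OF \<Phi> 2(3) q _ that] by simp
    have "\<gamma> \<tau> \<in> ball (\<gamma> q) r \<and> ?H \<tau> = \<Phi> (\<gamma> \<tau>)" if \<tau>: "\<tau> \<in> {a..c} \<inter> ball q (min e e')" for \<tau>
    proof (cases "\<tau> \<le> q")
      case True
      then show ?thesis using 1(5)[of \<tau>] \<tau> by auto
    next
      case False
      then have "\<gamma> \<tau> \<in> ball (\<gamma> q) r'" "G \<tau> = \<Psi> (\<gamma> \<tau>)" using 2(5)[of \<tau>] \<tau> by auto
      then show ?thesis using False \<Psi> 2(2) by auto
    qed
    then show ?thesis unfolding 3
      using 1(1-4) 2(4) by (intro exI[of _ "ball (\<gamma> q) r"] exI[of _ \<Phi>] conjI exI[of _ "min e e'"]) auto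
  qed
qed

lemma solution_on_exists:
  assumes cont: "continuous_on {0..1} \<gamma>" and X: "\<gamma> ` {0..1} \<subseteq> X" and G: "G \<in> fmats \<R>"
  shows "\<exists>F. solution_on \<gamma> 0 1 F \<and> F 0 = G"
proof -
  \<comment> \<open>Existence is asserted for every initial matrix, so that the second of two
    adjacent pieces can start from the endpoint value of the first.\<close>
  define P where "P a q \<longleftrightarrow> (0 \<le> a \<longrightarrow> q \<le> 1 \<longrightarrow> a \<le> q \<longrightarrow>
     (\<forall>G\<in>fmats \<R>. \<exists>F. solution_on \<gamma> a q F \<and> F a = G))" for a q
  have "P 0 1"
  proof (rule Bolzano)
    fix a q c assume P: "P a q" "P q c" and abc: "a \<le> q" "q \<le> c"
    show "P a c"
      unfolding P_def
    proof (intro impI ballI)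
      fix G :: "(complex^'n^'n, complex fps) fmat" assume h: "0 \<le> a" "c \<le> 1" "a \<le> c" "G \<in> fmats \<R>"
      then obtain F where F: "solution_on \<gamma> a q F" "F a = G" using P(1) abc unfolding P_def by auto
      have "F q \<in> fmats \<R>" using solution_on_fmats[OF F(1), of q] abc by simp
      then obtain H where H: "solution_on \<gamma> q c H" "H q = F q" using P(2) abc h unfolding P_def by force
      have "continuous_on {a..c} \<gamma>" using cont h by (auto intro: continuous_on_subset)
      then have "solution_on \<gamma> a c (\<lambda>t. if t \<le> q then F t else H t)"
        using solution_on_glue[OF F(1) H(1)] abc H(2) by simp
      then show "\<exists>F. solution_on \<gamma> a c F \<and> F a = G" using F(2) abc by (intro exI[of _ "\<lambda>t. if t \<le> q then F t else H t"]) simp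
    qed
  next
    fix x :: real assume x: "0 \<le> x" "x \<le> 1"
    then have "\<gamma> x \<in> X" using X by auto
    then obtain r where r: "r > 0" "ball (\<gamma> x) r \<subseteq> X" using ball_in_X by blast
    \<comment> \<open>A quarter of \<open>r\<close> keeps \<open>\<gamma>\<close> on
      \<open>{a..q}\<close> within \<open>r / 2\<close> of \<open>\<gamma> a\<close>, and the ball
      of that radius about \<open>\<gamma> a\<close> inside
      \<open>ball (\<gamma> x) r\<close>.\<close>
    have x01: "x \<in> {0..1}" and r4: "r / 4 > 0" using x r(1) by auto
    obtain d where d: "d > 0" "\<And>\<tau>. \<tau> \<in> {0..1} \<Longrightarrow> dist \<tau> x < d \<Longrightarrow> dist (\<gamma> \<tau>) (\<gamma> x) < r / 4"
      using cont[unfolded continuous_on_iff, rule_format, OF x01 r4] by blast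
    have "P a q" if ab: "a \<le> x" "x \<le> q" "q - a < d" for a q
      unfolding P_def
    proof (intro impI ballI)
      fix G :: "(complex^'n^'n, complex fps) fmat" assume h: "0 \<le> a" "q \<le> 1" "a \<le> q" "G \<in> fmats \<R>"
      have near: "dist (\<gamma> \<tau>) (\<gamma> x) < r / 4" if "\<tau> \<in> {a..q}" for \<tau>
        using d(2)[of \<tau>] that ab h by (auto simp: dist_real_def)
      have sub: "ball (\<gamma> a) (r / 2) \<subseteq> X"
      proof
        fix y assume "y \<in> ball (\<gamma> a) (r / 2)"
        then have "dist (\<gamma> x) y < r" using near[of a] h dist_triangle[of "\<gamma> x" y "\<gamma> a"] r(1) by (simp add: dist_commute)
        then show "y \<in> X" using r(2) by auto
      qed
      obtain \<Phi> where \<Phi>: "solves_on \<R> \<omega> (ball (\<gamma> a) (r / 2)) \<Phi>" "\<Phi> (\<gamma> a) = G"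
        using local_solution[OF sub h(4)] by blast
      have in_ball: "\<gamma> \<tau> \<in> ball (\<gamma> a) (r / 2)" if "\<tau> \<in> {a..q}" for \<tau>
        using near[OF that] near[of a] h dist_triangle[of "\<gamma> a" "\<gamma> \<tau>" "\<gamma> x"] by (simp add: dist_commute)
      have "solution_on \<gamma> a q (\<lambda>t. \<Phi> (\<gamma> t))"
        unfolding solution_on_def
        using in_ball \<Phi>(1) sub
        by (intro ballI exI[of _ "ball (\<gamma> a) (r / 2)"] exI[of _ \<Phi>] conjI exI[of _ 1]) auto
      then show "\<exists>F. solution_on \<gamma> a q F \<and> F a = G" using \<Phi>(2) by (intro exI[of _ "\<lambda>t. \<Phi> (\<gamma> t)"]) simp
    qed
    then show "\<exists>d>0. \<forall>a q. a \<le> x \<and> x \<le> q \<and> q - a < d \<longrightarrow> P a q" using d(1) by blast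
  qed simp
  then show ?thesis using G by (simp add: P_def)
qed

end

section \<open>Transport along paths and its terms of order 0 and 1 in h\<close>

lemma fmat_one_fmats: "fmat_one I \<in> fmats I"
  by (auto simp: fmat_one_def fmats_def)

lemma fmat_mult_one_left:
  assumes "finite I" "M \<in> fmats I"
  shows "fmat_mult I (fmat_one I) M = (M :: ('i, 'a::comm_ring_1) fmat)"
proof (intro ext)
  fix i j
  have "fmat_mult I (fmat_one I) M i j = (\<Sum>k\<in>I. if k = i then M i j else 0)"
    unfolding fmat_mult_def by (intro sum.cong refl) (auto simp: fmat_one_def)
  then show "fmat_mult I (fmat_one I) M i j = M i j" using assms by (auto simp: fmats_def)
qed

lemma fmat_mult_one_right:
  assumes "finite I" "M \<in> fmats I"
  shows "fmat_mult I M (fmat_one I) = (M :: ('i, 'a::comm_ring_1) fmat)"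
proof (intro ext)
  fix i j
  have "fmat_mult I M (fmat_one I) i j = (\<Sum>k\<in>I. if k = j then M i j else 0)"
    unfolding fmat_mult_def by (intro sum.cong refl) (auto simp: fmat_one_def)
  then show "fmat_mult I M (fmat_one I) i j = M i j" using assms by (auto simp: fmats_def)
qed

text \<open>Modulo \<open>h^2\<close> elements \<open>1 + h A\<close> multiply by adding the
  \<open>A\<close>; hence conjugation leaves the first order term of a loop unchanged.\<close>

lemma fmat_mult_first_order:
  fixes A B :: "('i, 'a::comm_ring_1 fps) fmat"
  assumes "finite I" "i \<in> I" "j \<in> I"
    and A: "\<And>i j. fps_nth (A i j) 0 = fmat_one I i j" and B: "\<And>i j. fps_nth (B i j) 0 = fmat_one I i j"
  shows "fps_nth (fmat_mult I A B i j) (Suc 0) = fps_nth (A i j) (Suc 0) + fps_nth (B i j) (Suc 0)"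
proof -
  have "fps_nth (fmat_mult I A B i j) (Suc 0) =
      (\<Sum>k\<in>I. fmat_one I i k * fps_nth (B k j) (Suc 0) + fps_nth (A i k) (Suc 0) * fmat_one I k j)"
    by (simp add: fmat_mult_def fps_sum_nth fps_mult_nth A B)
  also have "\<dots> = (\<Sum>k\<in>I. (if k = i then fps_nth (B i j) (Suc 0) else 0) + (if k = j then fps_nth (A i j) (Suc 0) else 0))"
    by (intro sum.cong refl) (auto simp: fmat_one_def)
  also have "\<dots> = fps_nth (A i j) (Suc 0) + fps_nth (B i j) (Suc 0)"
    using assms(1-3) by (simp add: sum.distrib)
  finally show ?thesis .
qed

context kz_system begin

abbreviation "E \<equiv> fmat_one \<R> :: (complex^'n^'n, complex fps) fmat"

lemma transport_iff: "transport W b m \<gamma> T \<longleftrightarrow> (\<exists>F. solution_on \<gamma> 0 1 F \<and> F 0 = E \<and> F 1 = T)"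
  by (simp add: transport_def solution_along_iff)

lemma transport_exists:
  assumes "path \<gamma>" "path_image \<gamma> \<subseteq> X"
  shows "\<exists>T. transport W b m \<gamma> T"
  using solution_on_exists[of \<gamma> E] assms fmat_one_fmats
  by (auto simp: transport_iff path_def path_image_def)

lemma transport_fmats: "transport W b m \<gamma> T \<Longrightarrow> T \<in> fmats \<R>"
  unfolding transport_iff using solution_on_fmats[of \<gamma> 0 1 _ 1] by auto

lemma transport_join:
  assumes p: "path \<gamma>1" "path \<gamma>2" "pathfinish \<gamma>1 = pathstart \<gamma>2"
    and T: "transport W b m \<gamma>1 T1" "transport W b m \<gamma>2 T2"
  shows "transport W b m (\<gamma>1 +++ \<gamma>2) (fmat_mult \<R> T2 T1)"
proof -
  obtain F1 where F1: "solution_on \<gamma>1 0 1 F1" "F1 0 = E" "F1 1 = T1" using T(1) by (auto simp: transport_iff)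
  obtain F2 where F2: "solution_on \<gamma>2 0 1 F2" "F2 0 = E" "F2 1 = T2" using T(2) by (auto simp: transport_iff)
  have T1: "T1 \<in> fmats \<R>" by (rule transport_fmats[OF T(1)])
  \<comment> \<open>Right multiplication by \<open>T1\<close> makes the second half start at the
    value reached by the first; this puts the later path on the left in the product.\<close>
  define H where "H t = (if t \<le> 1/2 then F1 (2 * t) else fmat_mult \<R> (F2 (2 * t - 1)) T1)" for t
  have 1: "solution_on (\<gamma>1 +++ \<gamma>2) 0 (1/2) (\<lambda>t. F1 (2 * t))"
    by (rule solution_on_reparam[OF F1(1), where \<phi> = "\<lambda>t. 2 * t"])
       (auto simp: joinpaths_def intro!: continuous_intros)
  have 2: "solution_on (\<gamma>1 +++ \<gamma>2) (1/2) 1 (\<lambda>t. fmat_mult \<R> (F2 (2 * t - 1)) T1)"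
  proof (rule solution_on_reparam[OF solution_on_right_mult[OF F2(1) T1], where \<phi> = "\<lambda>t. 2 * t - 1"])
    fix t :: real assume "t \<in> {1/2..1}"
    then consider "t = 1/2" | "t > 1/2" by fastforce
    then show "(\<gamma>1 +++ \<gamma>2) t = \<gamma>2 (2 * t - 1)"
    proof cases
      case 1
      show ?thesis unfolding 1 using p(3) by (simp add: joinpaths_def pathfinish_def pathstart_def)
    qed (simp add: joinpaths_def)
  qed (auto intro!: continuous_intros)
  have "continuous_on {0..1} (\<gamma>1 +++ \<gamma>2)" using path_join_imp[OF p] by (simp add: path_def)
  then have "solution_on (\<gamma>1 +++ \<gamma>2) 0 1 H"
    unfolding H_def
    by (intro solution_on_glue[OF 1 2]) (auto simp: F1 F2 fmat_mult_one_left[OF finite_R T1])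
  then show ?thesis unfolding transport_iff by (intro exI[of _ H]) (simp add: H_def F1 F2)
qed

text \<open>Along the reversed path both the reversed solution and the new solution times
  \<open>T\<close> start at \<open>T\<close>, hence end alike, which gives \<open>T' T = 1\<close>.
  The other order results from exchanging the path and its reverse.\<close>

lemma transport_reverse:
  assumes p: "path \<gamma>" "path_image \<gamma> \<subseteq> X" and T: "transport W b m \<gamma> T"
  shows "\<exists>T'. transport W b m (reversepath \<gamma>) T' \<and> fmat_mult \<R> T' T = E \<and> fmat_mult \<R> T T' = E"
proof -
  have *: "fmat_mult \<R> T' T = E"
    if p: "path \<gamma>" and T: "transport W b m \<gamma> T" and T': "transport W b m (reversepath \<gamma>) T'" for \<gamma> T T'
  proof -
    obtain F where F: "solution_on \<gamma> 0 1 F" "F 0 = E" "F 1 = T" using T by (auto simp: transport_iff)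
    obtain G where G: "solution_on (reversepath \<gamma>) 0 1 G" "G 0 = E" "G 1 = T'" using T' by (auto simp: transport_iff)
    have Tf: "T \<in> fmats \<R>" by (rule transport_fmats[OF T])
    have 1: "solution_on (reversepath \<gamma>) 0 1 (\<lambda>t. F (1 - t))"
      by (rule solution_on_reparam[OF F(1), where \<phi> = "\<lambda>t. 1 - t"]) (auto simp: reversepath_def intro!: continuous_intros)
    have 2: "solution_on (reversepath \<gamma>) 0 1 (\<lambda>t. fmat_mult \<R> (G t) T)" by (rule solution_on_right_mult[OF G(1) Tf])
    have c: "continuous_on {0..1} (reversepath \<gamma>)" using path_reversepath[of \<gamma>] p by (simp add: path_def)
    have "fmat_mult \<R> (G 1) T = F (1 - 1)"
      by (rule solution_on_unique[OF 2 1 c]) (simp_all add: F G fmat_mult_one_left[OF finite_R Tf])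
    then show ?thesis by (simp add: F G)
  qed
  have pr: "path (reversepath \<gamma>)" "path_image (reversepath \<gamma>) \<subseteq> X" using p by auto
  obtain T' where T': "transport W b m (reversepath \<gamma>) T'" using transport_exists[OF pr] by blast
  have "fmat_mult \<R> T T' = E" using *[OF pr(1) T', of T] T by simp
  then show ?thesis using *[OF p(1) T T'] T' by blast
qed

text \<open>\<omega> is divisible by \<open>h\<close>, so the constant term of a solution has
  derivative 0.\<close>

lemma solves_on_coeff0:
  assumes \<Phi>: "solves_on \<R> \<omega> (ball c r) \<Phi>" and xy: "x \<in> ball c r" "y \<in> ball c r"
  shows "fps_nth (\<Phi> x i j) 0 = fps_nth (\<Phi> y i j) 0"
proof (cases "i \<in> \<R> \<and> j \<in> \<R>")
  case True
  show ?thesis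
  proof (rule has_derivative_zero_unique[OF convex_ball _ xy], rule has_derivative_at_withinI)
    fix z assume "z \<in> ball c r"
    then have "((\<lambda>y. fps_nth (\<Phi> y i j) 0) has_derivative (\<lambda>v. fps_nth (fmat_mult \<R> (\<omega> z v) (\<Phi> z) i j) 0)) (at z)"
      using \<Phi> True unfolding solves_on_def by blast
    then show "((\<lambda>y. fps_nth (\<Phi> y i j) 0) has_derivative (\<lambda>v. 0)) (at z)" by (simp add: omega_coeff)
  qed
next
  case False
  then show ?thesis using \<Phi> xy by (auto simp: solves_on_def fmats_def)
qed

lemma solution_on_coeff0:
  assumes F: "solution_on \<gamma> 0 1 F" "F 0 = E" and cont: "continuous_on {0..1} \<gamma>" and t: "t \<in> {0..1}"
  shows "fps_nth (F t i j) 0 = fmat_one \<R> i j"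
proof -
  have "fps_nth (F t i j) 0 = fps_nth (F 0 i j) 0"
  proof (rule locally_constant_interval[where \<phi> = "\<lambda>t. fps_nth (F t i j) 0"])
    fix \<sigma> assume "\<sigma> \<in> {0..t}"
    then have \<sigma>: "\<sigma> \<in> {0..1}" using t by auto
    obtain r \<Phi> e where 1: "0 < r" "solves_on \<R> \<omega> (ball (\<gamma> \<sigma>) r) \<Phi>" "e > 0"
      "\<And>\<tau>. \<tau> \<in> {0..1} \<Longrightarrow> dist \<sigma> \<tau> < e \<Longrightarrow> \<gamma> \<tau> \<in> ball (\<gamma> \<sigma>) r \<and> F \<tau> = \<Phi> (\<gamma> \<tau>)"
      by (rule solution_on_ball[OF F(1) cont \<sigma> zero_less_one]) (rule that; assumption)
    have "fps_nth (F \<tau> i j) 0 = fps_nth (F \<sigma> i j) 0" if "\<tau> \<in> {0..t} \<inter> ball \<sigma> e" for \<tau>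
    proof -
      have h: "\<gamma> \<tau> \<in> ball (\<gamma> \<sigma>) r" "F \<tau> = \<Phi> (\<gamma> \<tau>)" "\<gamma> \<sigma> \<in> ball (\<gamma> \<sigma>) r" "F \<sigma> = \<Phi> (\<gamma> \<sigma>)"
        using 1(4)[of \<tau>] 1(4)[of \<sigma>] 1(1,3) \<sigma> that t by auto
      show ?thesis unfolding h(2,4) by (rule solves_on_coeff0[OF 1(2) h(1,3)])
    qed
    then show "\<exists>e>0. \<forall>\<tau>\<in>{0..t} \<inter> ball \<sigma> e. fps_nth (F \<tau> i j) 0 = fps_nth (F \<sigma> i j) 0" using 1(3) by blast
  qed (use t in auto)
  also have "\<dots> = fmat_one \<R> i j" unfolding F(2) by (auto simp: fmat_one_def)
  finally show ?thesis .
qed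

lemma transport_coeff0: "transport W b m \<gamma> T \<Longrightarrow> path \<gamma> \<Longrightarrow> fps_nth (T i j) 0 = fmat_one \<R> i j"
  unfolding transport_iff path_def using solution_on_coeff0[of \<gamma> _ 1 i j] by auto

text \<open>\<open>ysy\<close> stays in the class of \<open>s\<close>, so neither the permutation
  part nor the count \<alpha> links different classes.\<close>

lemma t_op_block:
  assumes c: "c \<in> reflection_classes W" and s: "s \<in> \<R>" and ij: "(i \<in> c) \<noteq> (j \<in> c)"
  shows "t_op W m s i j = 0"
proof (cases "i \<in> \<R> \<and> j \<in> \<R>")
  case True
  have cls: "y ** x ** y \<in> c \<longleftrightarrow> x \<in> c" if "x \<in> \<R>" "y \<in> \<R>" for x y
    using class_sus[OF c, of x y] class_sus[OF c, of "y ** x ** y" y] that by auto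
  have "i \<noteq> s ** j ** s" using cls[of j s] True s ij by auto
  moreover have "gram m s j = 0" if "i = s"
  proof -
    have "{y \<in> \<R>. y ** s ** y = j} = {}" using cls[OF s] ij that by auto
    then have "\<alpha>_count W s j = 0" unfolding \<alpha>_count_def by (simp only: card.empty)
    then show ?thesis using ij that by (auto simp: gram_def)
  qed
  ultimately show ?thesis using True s by (auto simp: t_op_entry)
next
  case False
  then show ?thesis using s t_op_outside by blast
qed

text \<open>Erasing the entries of a solution that link \<open>c\<close> with its complement gives a
  solution again, by \<open>t_op_block\<close>, with the same initial value; uniqueness identifies
  the two.\<close>

lemma transport_block:
  assumes T: "transport W b m \<gamma> T" and p: "path \<gamma>" and c: "c \<in> reflection_classes W" and ij: "(i \<in> c) \<noteq> (j \<in> c)"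
  shows "T i j = 0"
proof -
  obtain F where F: "solution_on \<gamma> 0 1 F" "F 0 = E" "F 1 = T" using T by (auto simp: transport_iff)
  define B :: "(complex^'n^'n, complex fps) fmat \<Rightarrow> (complex^'n^'n, complex fps) fmat"
    where "B M = (\<lambda>i j. if (i \<in> c) = (j \<in> c) then M i j else 0)" for M
  have kzB: "kz x v i k = 0" if "(i \<in> c) \<noteq> (k \<in> c)" for x v i k
    unfolding kz_form_def by (rule sum.neutral) (use t_op_block[OF c _ that] in auto)
  have solB: "solves_on \<R> \<omega> U (\<lambda>x. B (\<Phi> x))" if \<Phi>: "solves_on \<R> \<omega> U \<Phi>" for U \<Phi>
    unfolding solves_on_def
  proof (intro conjI ballI allI)
    fix x assume x: "x \<in> U"
    show "B (\<Phi> x) \<in> fmats \<R>" using \<Phi> x by (auto simp: solves_on_def B_def fmats_def)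
    fix i j k assume ij: "i \<in> \<R>" "j \<in> \<R>"
    show "((\<lambda>y. fps_nth (B (\<Phi> y) i j) k) has_derivative (\<lambda>v. fps_nth (fmat_mult \<R> (\<omega> x v) (B (\<Phi> x)) i j) k)) (at x)"
    proof (cases "(i \<in> c) = (j \<in> c)")
      case True
      have "fmat_mult \<R> (\<omega> x v) (B (\<Phi> x)) i j = fmat_mult \<R> (\<omega> x v) (\<Phi> x) i j" for v
        unfolding fmat_mult_def using True kzB[of i]
        by (intro sum.cong refl) (auto simp: B_def h_kz_form_def)
      then show ?thesis using \<Phi> x ij True unfolding solves_on_def by (simp add: B_def)
    next
      case False
      have "fmat_mult \<R> (\<omega> x v) (B (\<Phi> x)) i j = 0" for v
        unfolding fmat_mult_def using False kzB[of i]
        by (intro sum.neutral ballI) (auto simp: B_def h_kz_form_def)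
      then show ?thesis using False by (simp add: B_def)
    qed
  qed
  have sol: "solution_on \<gamma> 0 1 (\<lambda>t. B (F t))"
    unfolding solution_on_def
  proof
    fix t :: real assume t: "t \<in> {0..1}"
    obtain U \<Phi> e where U: "open U" "\<gamma> t \<in> U" "U \<subseteq> X" "solves_on \<R> \<omega> U \<Phi>" "e > 0"
      "\<And>\<tau>. \<tau> \<in> {0..1} \<Longrightarrow> dist t \<tau> < e \<Longrightarrow> \<gamma> \<tau> \<in> U \<and> F \<tau> = \<Phi> (\<gamma> \<tau>)"
      by (rule solution_onE[OF F(1) t]) (rule that; assumption)
    show "\<exists>U \<Phi>. open U \<and> \<gamma> t \<in> U \<and> U \<subseteq> X \<and> solves_on \<R> \<omega> U \<Phi> \<and>
       (\<exists>e>0. \<forall>\<tau>\<in>{0..1} \<inter> ball t e. \<gamma> \<tau> \<in> U \<and> B (F \<tau>) = \<Phi> (\<gamma> \<tau>))"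
      using U solB[OF U(4)] by (intro exI[of _ U] exI[of _ "\<lambda>x. B (\<Phi> x)"] conjI exI[of _ e]) auto
  qed
  have "F 0 = B (F 0)" unfolding F(2) by (auto simp: B_def fmat_one_def fun_eq_iff)
  then have "F 1 = B (F 1)"
    by (rule solution_on_unique[OF F(1) sol p[unfolded path_def]]) simp
  then have "F 1 i j = B (F 1) i j" by simp
  also have "\<dots> = 0" using ij by (simp add: B_def)
  finally show ?thesis unfolding F(3) .
qed

text \<open>The first order term is the sum of the \<open>t\<^sub>s\<close> times the integrals of
  \<open>\<omega>\<^sub>s\<close> along \<gamma>. As \<gamma> is merely continuous, these integrals
  are expressed by increments of continuous logarithms \<open>l s\<close>, compared locally with a
  branch of \<open>Ln\<close>.\<close>

lemma transport_first_order:
  assumes T: "transport W b m \<gamma> T" and p: "path \<gamma>" "path_image \<gamma> \<subseteq> X" and ij: "i \<in> \<R>" "j \<in> \<R>"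
    and l: "\<And>s. s \<in> \<R> \<Longrightarrow> continuous_on {0..1} (l s)" "\<And>s t. s \<in> \<R> \<Longrightarrow> t \<in> {0..1} \<Longrightarrow> exp (l s t) = b s (\<gamma> t)"
  shows "fps_nth (T i j) (Suc 0) = (\<Sum>s\<in>\<R>. t_op W m s i j * ((l s 1 - l s 0) / (\<i> * of_real pi)))"
proof -
  obtain F where F: "solution_on \<gamma> 0 1 F" "F 0 = E" "F 1 = T" using T by (auto simp: transport_iff)
  have cont: "continuous_on {0..1} \<gamma>" using p by (simp add: path_def)
  define \<kappa> where "\<kappa> = 1 / (\<i> * complex_of_real pi)"
  define \<phi> where "\<phi> t = fps_nth (F t i j) (Suc 0) - (\<Sum>s\<in>\<R>. t_op W m s i j * (\<kappa> * l s t))" for t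
  have "\<phi> 1 = \<phi> 0"
  proof (rule locally_constant_interval)
    fix \<sigma> :: real assume \<sigma>: "\<sigma> \<in> {0..1}"
    have "\<gamma> \<sigma> \<in> X" using p(2) \<sigma> by (auto simp: path_image_def)
    then have nz: "b s (\<gamma> \<sigma>) \<noteq> 0" if "s \<in> \<R>" for s using that X_iff by blast
    \<comment> \<open>Normalised to 1 at the centre, so that nearby values stay in the right half
      plane, where \<open>Ln\<close> is holomorphic.\<close>
    define q where "q s y = b s y / b s (\<gamma> \<sigma>)" for s y
    have "\<exists>R>0. \<forall>y\<in>ball (\<gamma> \<sigma>) R. \<forall>s\<in>\<R>. Re (q s y) > 0"
    proof -
      have "open (\<Inter>s\<in>\<R>. {y. Re (q s y) > 0})"
        unfolding q_def by (intro open_INT finite_R ballI open_Collect_less continuous_intros b_continuous) (use nz in auto)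
      moreover have "\<gamma> \<sigma> \<in> (\<Inter>s\<in>\<R>. {y. Re (q s y) > 0})" using nz by (auto simp: q_def)
      ultimately obtain R where "R > 0" "ball (\<gamma> \<sigma>) R \<subseteq> (\<Inter>s\<in>\<R>. {y. Re (q s y) > 0})"
        using open_contains_ball by blast
      then show ?thesis by blast
    qed
    then obtain R where R: "R > 0" "\<And>y s. y \<in> ball (\<gamma> \<sigma>) R \<Longrightarrow> s \<in> \<R> \<Longrightarrow> Re (q s y) > 0" by blast
    obtain r \<Phi> e where 1: "0 < r" "r \<le> R" "solves_on \<R> \<omega> (ball (\<gamma> \<sigma>) r) \<Phi>" "e > 0"
      "\<And>\<tau>. \<tau> \<in> {0..1} \<Longrightarrow> dist \<sigma> \<tau> < e \<Longrightarrow> \<gamma> \<tau> \<in> ball (\<gamma> \<sigma>) r \<and> F \<tau> = \<Phi> (\<gamma> \<tau>)"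
      by (rule solution_on_ball[OF F(1) cont \<sigma> R(1)]) (rule that; assumption)
    have \<sigma>ball: "\<gamma> \<sigma> \<in> ball (\<gamma> \<sigma>) r" "F \<sigma> = \<Phi> (\<gamma> \<sigma>)" using 1(5)[OF \<sigma>] 1(1,4) by auto
    define \<psi> where "\<psi> y = fps_nth (\<Phi> y i j) (Suc 0) - (\<Sum>s\<in>\<R>. t_op W m s i j * (\<kappa> * Ln (q s y)))" for y
    have \<psi>: "\<psi> y = \<psi> (\<gamma> \<sigma>)" if y: "y \<in> ball (\<gamma> \<sigma>) r" for y
    proof (rule has_derivative_zero_unique[OF convex_ball _ y \<sigma>ball(1)], rule has_derivative_at_withinI)
      fix z assume z: "z \<in> ball (\<gamma> \<sigma>) r"
      have "((\<lambda>y. Ln (q s y)) has_derivative (\<lambda>v. b s v / b s z)) (at z)" if s: "s \<in> \<R>" for s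
      proof -
        have Re: "Re (q s z) > 0" using R(2)[of z s] z s 1(2) by auto
        have "q s z \<notin> \<real>\<^sub>\<le>\<^sub>0" using Re by (auto simp: complex_nonpos_Reals_iff)
        moreover have "(q s has_derivative (\<lambda>v. b s v / b s (\<gamma> \<sigma>))) (at z)"
          unfolding q_def divide_inverse
          by (intro has_derivative_mult_left bounded_linear_imp_has_derivative b_bounded_linear s)
        moreover have "(Ln has_derivative (\<lambda>h. inverse (q s z) * h)) (at (q s z))" if "q s z \<notin> \<real>\<^sub>\<le>\<^sub>0"
          using has_field_derivative_Ln[OF that] by (simp add: has_field_derivative_def)
        ultimately have "((\<lambda>y. Ln (q s y)) has_derivative (\<lambda>v. inverse (q s z) * (b s v / b s (\<gamma> \<sigma>)))) (at z)"
          using has_derivative_compose[of "q s" _ z UNIV Ln] by blast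
        then show ?thesis using nz[OF s] by (simp add: q_def field_simps)
      qed
      then have dsum: "((\<lambda>y. \<Sum>s\<in>\<R>. t_op W m s i j * (\<kappa> * Ln (q s y))) has_derivative
          (\<lambda>v. \<Sum>s\<in>\<R>. t_op W m s i j * (\<kappa> * (b s v / b s z)))) (at z)"
        by (intro has_derivative_sum has_derivative_mult_right)
      have d\<Phi>: "((\<lambda>y. fps_nth (\<Phi> y i j) (Suc 0)) has_derivative (\<lambda>v. \<Sum>s\<in>\<R>. t_op W m s i j * (\<kappa> * (b s v / b s z)))) (at z)"
      proof -
        have "((\<lambda>y. fps_nth (\<Phi> y i j) (Suc 0)) has_derivative (\<lambda>v. fps_nth (fmat_mult \<R> (\<omega> z v) (\<Phi> z) i j) (Suc 0))) (at z)"
          using 1(3) z ij unfolding solves_on_def by blast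
        moreover have "fps_nth (fmat_mult \<R> (\<omega> z v) (\<Phi> z) i j) (Suc 0) = (\<Sum>s\<in>\<R>. t_op W m s i j * (\<kappa> * (b s v / b s z)))" for v
        proof -
          have "fps_nth (\<Phi> z k j) 0 = fmat_one \<R> k j" for k
            using solves_on_coeff0[OF 1(3) z \<sigma>ball(1), of k j] solution_on_coeff0[OF F(1,2) cont \<sigma>, of k j] \<sigma>ball(2) by simp
          then have "fps_nth (fmat_mult \<R> (\<omega> z v) (\<Phi> z) i j) (Suc 0) = fmat_mult \<R> (kz z v) (fmat_one \<R>) i j"
            by (simp add: omega_coeff) (simp add: fmat_mult_def)
          also have "\<dots> = (\<Sum>k\<in>\<R>. if k = j then kz z v i j else 0)"
            unfolding fmat_mult_def by (intro sum.cong refl) (auto simp: fmat_one_def)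
          also have "\<dots> = kz z v i j" using ij finite_R by simp
          finally show ?thesis by (simp add: kz_form_def log_form_def \<kappa>_def)
        qed
        ultimately show ?thesis by simp
      qed
      show "(\<psi> has_derivative (\<lambda>h. 0)) (at z)"
        unfolding \<psi>_def using has_derivative_diff[OF d\<Phi> dsum] by simp
    qed
    \<comment> \<open>An increment of \<open>l s\<close> below 1, hence below \<pi>, is recovered by
      \<open>Ln\<close> from its exponential.\<close>
    have "\<exists>d>0. \<forall>\<tau>\<in>{0..1}. dist \<tau> \<sigma> < d \<longrightarrow> (\<forall>s\<in>\<R>. dist (l s \<tau>) (l s \<sigma>) < 1)"
    proof -
      have "\<exists>d>0. \<forall>\<tau>\<in>{0..1}. dist \<tau> \<sigma> < d \<longrightarrow> dist (l s \<tau>) (l s \<sigma>) < 1" if "s \<in> \<R>" for s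
        using l(1)[OF that, unfolded continuous_on_iff, rule_format, OF \<sigma> zero_less_one] by blast
      then obtain d where d: "\<And>s. s \<in> \<R> \<Longrightarrow> d s > 0 \<and> (\<forall>\<tau>\<in>{0..1}. dist \<tau> \<sigma> < d s \<longrightarrow> dist (l s \<tau>) (l s \<sigma>) < 1)"
        by metis
      define d0 where "d0 = Min (insert 1 (d ` \<R>))"
      have "d0 > 0" using d finite_R by (auto simp: d0_def)
      moreover have "d0 \<le> d s" if "s \<in> \<R>" for s using that finite_R by (auto simp: d0_def)
      ultimately show ?thesis using d by (intro exI[of _ d0]) (meson less_le_trans)
    qed
    then obtain d where d: "d > 0" "\<And>\<tau> s. \<tau> \<in> {0..1} \<Longrightarrow> dist \<tau> \<sigma> < d \<Longrightarrow> s \<in> \<R> \<Longrightarrow> dist (l s \<tau>) (l s \<sigma>) < 1" by blast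
    have "\<phi> \<tau> = \<phi> \<sigma>" if \<tau>: "\<tau> \<in> {0..1} \<inter> ball \<sigma> (min d e)" for \<tau>
    proof -
      have \<tau>01: "\<tau> \<in> {0..1}" and \<tau>d: "dist \<tau> \<sigma> < d" "dist \<sigma> \<tau> < e" using \<tau> by (auto simp: dist_commute)
      have \<tau>ball: "\<gamma> \<tau> \<in> ball (\<gamma> \<sigma>) r" "F \<tau> = \<Phi> (\<gamma> \<tau>)" using 1(5)[OF \<tau>01 \<tau>d(2)] by auto
      have Ln: "Ln (q s (\<gamma> \<tau>)) = l s \<tau> - l s \<sigma>" if s: "s \<in> \<R>" for s
      proof -
        have "q s (\<gamma> \<tau>) = exp (l s \<tau> - l s \<sigma>)"
          unfolding q_def exp_diff l(2)[OF s \<tau>01] l(2)[OF s \<sigma>] ..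
        moreover have "\<bar>Im (l s \<tau> - l s \<sigma>)\<bar> < pi"
          using d(2)[OF \<tau>01 \<tau>d(1) s] abs_Im_le_cmod[of "l s \<tau> - l s \<sigma>"] pi_gt3 by (simp add: dist_norm)
        ultimately show ?thesis by (simp add: Ln_exp abs_less_iff)
      qed
      have "Ln (q s (\<gamma> \<sigma>)) = 0" if "s \<in> \<R>" for s using nz[OF that] by (simp add: q_def)
      then have "fps_nth (F \<tau> i j) (Suc 0) - (\<Sum>s\<in>\<R>. t_op W m s i j * (\<kappa> * (l s \<tau> - l s \<sigma>))) = fps_nth (F \<sigma> i j) (Suc 0)"
        using \<psi>[OF \<tau>ball(1)] \<tau>ball(2) \<sigma>ball(2) by (simp add: \<psi>_def Ln)
      then show ?thesis by (simp add: \<phi>_def right_diff_distrib sum_subtractf algebra_simps)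
    qed
    then show "\<exists>e>0. \<forall>\<tau>\<in>{0..1} \<inter> ball \<sigma> e. \<phi> \<tau> = \<phi> \<sigma>"
      using d(1) 1(4) by (intro exI[of _ "min d e"]) auto
  qed simp
  then have "fps_nth (T i j) (Suc 0) = fps_nth (E i j) (Suc 0) + (\<Sum>s\<in>\<R>. t_op W m s i j * (\<kappa> * l s 1)) - (\<Sum>s\<in>\<R>. t_op W m s i j * (\<kappa> * l s 0))"
    by (simp add: \<phi>_def F algebra_simps)
  also have "fps_nth (E i j) (Suc 0) = 0" by (simp add: fmat_one_def)
  also have "0 + (\<Sum>s\<in>\<R>. t_op W m s i j * (\<kappa> * l s 1)) - (\<Sum>s\<in>\<R>. t_op W m s i j * (\<kappa> * l s 0)) =
      (\<Sum>s\<in>\<R>. t_op W m s i j * ((l s 1 - l s 0) / (\<i> * of_real pi)))"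
    unfolding add_0 sum_subtractf[symmetric] by (intro sum.cong refl) (simp add: \<kappa>_def diff_divide_distrib right_diff_distrib)
  finally show ?thesis .
qed

end

section \<open>Loops round the hyperplanes\<close>

lemma finite_linear_zeros: "a \<noteq> 0 \<or> c \<noteq> 0 \<Longrightarrow> finite {x::complex. a + x * c = 0}"
proof (cases "c = 0")
  case False
  then have "{x. a + x * c = 0} \<subseteq> {- a / c}" by (auto simp: field_simps add_eq_0_iff)
  then show ?thesis by (rule finite_subset) simp
qed auto

context reflection_arrangement begin

text \<open>Finitely many other hyperplanes do not cover that of \<open>s\<close>: \<open>p\<close>
  is moved within it in a direction transversal to the hyperplane of \<open>u\<close>, avoiding
  finitely many parameters.\<close>

lemma generic_point:
  assumes s: "s \<in> \<R>"
  shows "\<exists>p. b s p = 0 \<and> (\<forall>u\<in>\<R> - {s}. b u p \<noteq> 0)"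
proof -
  have "\<exists>p. b s p = 0 \<and> (\<forall>u\<in>F. b u p \<noteq> 0)" if "finite F" "F \<subseteq> \<R> - {s}" for F
    using that
  proof (induction F rule: finite_induct)
    case empty
    show ?case using s by (intro exI[of _ 0]) (simp add: b_simps)
  next
    case (insert u F)
    then obtain p where p: "b s p = 0" "\<forall>v\<in>F. b v p \<noteq> 0" by auto
    have u: "u \<in> \<R>" "u \<noteq> s" using insert by auto
    obtain e where e: "b u e = 1" "b s e = 0" using distinct_not_subset[OF u(1) s u(2)] .
    define B where "B = (\<Union>v\<in>insert u F. {x. b v p + x * b v e = 0})"
    have "finite B"
      unfolding B_def using insert.hyps(1) p(2) e(1) by (intro finite_UN_I) (auto intro!: finite_linear_zeros)
    then obtain x where x: "x \<notin> B" using ex_new_if_finite infinite_UNIV_char_0 by blast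
    have val: "b v (p + x *s e) = b v p + x * b v e" if "v \<in> \<R>" for v using that by (simp add: b_simps)
    have "b s (p + x *s e) = 0" using val[OF s] p(1) e(2) by simp
    moreover have "b v (p + x *s e) \<noteq> 0" if v: "v \<in> insert u F" for v
      using x v val[of v] insert.prems by (auto simp: B_def)
    ultimately show ?case by blast
  qed
  then show ?thesis using finite_R by blast
qed

end

context kz_system begin

text \<open>The loop is a small circle round the hyperplane of \<open>s\<close> in a complex line
  through \<open>z\<close>, joined to \<open>z\<close> by a path and its reverse. Only
  \<open>b s\<close> winds round 0, once; the increment \<open>2 \<pi> i\<close> of its logarithm,
  divided by the normalising \<open>\<pi> i\<close>, gives the factor 2.\<close>

lemma loop_transport:
  assumes s: "s \<in> \<R>" and z: "z \<in> X"
  shows "\<exists>\<gamma> T. path \<gamma> \<and> path_image \<gamma> \<subseteq> X \<and> pathstart \<gamma> = z \<and> pathfinish \<gamma> = z \<and>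
    transport W b m \<gamma> T \<and> (\<forall>i\<in>\<R>. \<forall>j\<in>\<R>. fps_nth (T i j) (Suc 0) = 2 * t_op W m s i j)"
proof -
  obtain p where p: "b s p = 0" "\<And>u. u \<in> \<R> \<Longrightarrow> u \<noteq> s \<Longrightarrow> b u p \<noteq> 0" using generic_point[OF s] by auto
  have bz: "b u z \<noteq> 0" if "u \<in> \<R>" for u using z X_iff that by blast
  \<comment> \<open>The complex line with \<open>L 0 = z\<close> and \<open>L 1 = p\<close>, on
    which every \<open>b u\<close> is affine in the parameter.\<close>
  define L :: "complex \<Rightarrow> complex^'n" where "L x = (\<chi> k. z $ k + x * (p - z) $ k)" for x
  have L: "L x = z + x *s (p - z)" for x by (simp add: L_def vec_eq_iff algebra_simps)
  have Lc: "continuous_on A L" for A unfolding L_def by (intro continuous_intros)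
  have bL: "b u (L x) = b u z + x * (b u p - b u z)" if "u \<in> \<R>" for u x using that by (simp add: L b_simps right_diff_distrib)
  have bL': "b u (L x) = b u p + (x - 1) * (b u p - b u z)" if "u \<in> \<R>" for u x
    using bL[OF that] by (simp add: algebra_simps)
  define Z where "Z = (\<Union>u\<in>\<R>. {x. b u z + x * (b u p - b u z) = 0})"
  have LX: "L x \<in> X \<longleftrightarrow> x \<notin> Z" for x using bL by (auto simp: X_iff Z_def)
  have "finite Z" unfolding Z_def using finite_R bz by (intro finite_UN_I) (auto intro!: finite_linear_zeros)
  \<comment> \<open>The radius is smaller than the distance from the parameter 1 to the zero of any
    other \<open>b u\<close>; the 1 added in the denominator of \<open>f\<close> covers
    \<open>b u p = b u z\<close>.\<close>
  have "\<exists>r>0. \<forall>u\<in>\<R> - {s}. r * norm (b u p - b u z) < norm (b u p)"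
  proof -
    define f where "f u = norm (b u p) / (norm (b u p - b u z) + 1)" for u
    define r where "r = Min (insert 1 (f ` (\<R> - {s})))"
    have "f u > 0" if "u \<in> \<R> - {s}" for u
      unfolding f_def using p(2)[of u] that by (intro divide_pos_pos) (auto simp: add_nonneg_pos)
    then have "r > 0" using finite_R by (auto simp: r_def)
    moreover have "r * norm (b u p - b u z) < norm (b u p)" if u: "u \<in> \<R> - {s}" for u
    proof -
      have d: "norm (b u p - b u z) + 1 > 0" by (simp add: add_nonneg_pos)
      have "r \<le> f u" using u finite_R by (auto simp: r_def)
      then have "r * (norm (b u p - b u z) + 1) \<le> norm (b u p)"
        using d by (simp add: f_def pos_le_divide_eq)
      then show ?thesis using \<open>r > 0\<close> by (simp add: distrib_left)
    qed
    ultimately show ?thesis by blast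
  qed
  then obtain r where r: "r > 0" "\<And>u. u \<in> \<R> \<Longrightarrow> u \<noteq> s \<Longrightarrow> r * norm (b u p - b u z) < norm (b u p)" by auto
  define c where "c t = 1 + of_real r * exp (2 * of_real pi * \<i> * of_real t)" for t :: real
  have norm_c: "norm (c t - 1) = r" for t
  proof -
    have "norm (c t - 1) = r * norm (exp (\<i> * of_real (2 * pi * t)))" using r(1) by (simp add: c_def norm_mult mult_ac)
    then show ?thesis by simp
  qed
  have cc: "continuous_on A c" for A unfolding c_def by (intro continuous_intros)
  have near: "norm (b u (L (c t)) / b u p - 1) < 1" if u: "u \<in> \<R>" "u \<noteq> s" for u t
  proof -
    have "b u (L (c t)) / b u p - 1 = (c t - 1) * (b u p - b u z) / b u p"
      unfolding bL'[OF u(1)] using p(2)[OF u] by (simp add: field_simps)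
    then have "norm (b u (L (c t)) / b u p - 1) = r * norm (b u p - b u z) / norm (b u p)"
      by (simp add: norm_divide norm_mult norm_c)
    also have "\<dots> < 1" using r(2)[OF u] p(2)[OF u] by (simp add: divide_less_eq)
    finally show ?thesis .
  qed
  have Re_pos: "Re (b u (L (c t)) / b u p) > 0" if u: "u \<in> \<R>" "u \<noteq> s" for u t
    using near[OF u, of t] abs_Re_le_cmod[of "b u (L (c t)) / b u p - 1"] by (simp only: minus_complex.sel one_complex.sel)
  have bs: "b s (L (c t)) = (- b s z * of_real r) * exp (2 * of_real pi * \<i> * of_real t)" for t
    unfolding bL'[OF s] using p(1) by (simp add: c_def)
  define \<kappa> where "\<kappa> = L \<circ> c"
  have \<kappa>X: "\<kappa> t \<in> X" for t
    unfolding X_iff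
  proof
    fix u assume u: "u \<in> \<R>"
    show "b u (\<kappa> t) \<noteq> 0"
    proof (cases "u = s")
      case True
      then show ?thesis using bs[of t] bz[OF s] r(1) by (simp add: \<kappa>_def)
    next
      case False
      then show ?thesis using Re_pos[OF u False, of t] by (auto simp: \<kappa>_def)
    qed
  qed
  have \<kappa>path: "path \<kappa>" unfolding path_def \<kappa>_def by (rule continuous_on_compose[OF cc Lc])
  have \<kappa>img: "path_image \<kappa> \<subseteq> X" using \<kappa>X by (auto simp: path_image_def)
  have c01: "c 0 = 1 + of_real r" "c 1 = 1 + of_real r" by (simp_all add: c_def)
  \<comment> \<open>Along the circle the logarithm of \<open>b s\<close> gains
    \<open>2 \<pi> i\<close>. For the other \<open>u\<close> the quotient \<open>b u / b u p\<close>
    stays in the right half plane, so one branch of \<open>Ln\<close> suffices.\<close>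
  define l where "l u t = (if u = s then Ln (- b s z * of_real r) + 2 * of_real pi * \<i> * of_real t
     else Ln (b u (\<kappa> t) / b u p) + Ln (b u p))" for u t
  have lc: "continuous_on {0..1} (l u)" if u: "u \<in> \<R>" for u
  proof (cases "u = s")
    case True
    then show ?thesis unfolding l_def by (simp) (intro continuous_intros)
  next
    case False
    have "continuous_on {0..1} (\<lambda>t. b u (\<kappa> t))"
      using continuous_on_compose2[OF b_continuous[OF u, of UNIV] \<kappa>path[unfolded path_def]] by simp
    moreover have "b u (\<kappa> t) / b u p \<notin> \<real>\<^sub>\<le>\<^sub>0" for t
      using Re_pos[OF u False, of t] by (auto simp: \<kappa>_def complex_nonpos_Reals_iff)
    ultimately have "continuous_on {0..1} (\<lambda>t. Ln (b u (\<kappa> t) / b u p) + Ln (b u p))"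
      using p(2)[OF u False] by (intro continuous_intros) auto
    then show ?thesis using False by (simp add: l_def)
  qed
  have lexp: "exp (l u t) = b u (\<kappa> t)" if u: "u \<in> \<R>" for u t
  proof (cases "u = s")
    case True
    have "- b s z * of_real r \<noteq> 0" using bz[OF s] r(1) by simp
    then show ?thesis using True bs[of t] by (simp add: l_def exp_add \<kappa>_def)
  next
    case False
    have "b u (\<kappa> t) \<noteq> 0" using \<kappa>X[of t] X_iff u by blast
    then show ?thesis using False p(2)[OF u False] by (simp add: l_def exp_add)
  qed
  obtain T\<kappa> where T\<kappa>: "transport W b m \<kappa> T\<kappa>" using transport_exists[OF \<kappa>path \<kappa>img] by blast
  have T\<kappa>1: "fps_nth (T\<kappa> i j) (Suc 0) = 2 * t_op W m s i j" if ij: "i \<in> \<R>" "j \<in> \<R>" for i j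
  proof -
    have "fps_nth (T\<kappa> i j) (Suc 0) = (\<Sum>u\<in>\<R>. t_op W m u i j * ((l u 1 - l u 0) / (\<i> * of_real pi)))"
      by (rule transport_first_order[OF T\<kappa> \<kappa>path \<kappa>img ij lc lexp])
    also have "\<dots> = (\<Sum>u\<in>\<R>. if u = s then 2 * t_op W m s i j else 0)"
    proof (rule sum.cong[OF refl])
      fix u assume "u \<in> \<R>"
      have \<kappa>01: "\<kappa> 1 = \<kappa> 0" unfolding \<kappa>_def o_def c01 ..
      show "t_op W m u i j * ((l u 1 - l u 0) / (\<i> * of_real pi)) = (if u = s then 2 * t_op W m s i j else 0)"
      proof (cases "u = s")
        case True
        have "l s 1 - l s 0 = 2 * (\<i> * of_real pi)" by (simp add: l_def)
        then show ?thesis using True by simp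
      next
        case False
        have "l u 1 = l u 0" using False \<kappa>01 by (simp add: l_def)
        then show ?thesis using False by simp
      qed
    qed
    finally show ?thesis using s finite_R by simp
  qed
  \<comment> \<open>A path of parameters from \<open>z\<close> to the circle, avoiding the finitely
    many that lie on hyperplanes.\<close>
  have "path_connected (- Z)" using path_connected_complement_countable[of Z] \<open>finite Z\<close> by (simp add: countable_finite)
  moreover have "0 \<in> - Z" using LX[of 0] z by (simp add: L)
  moreover have "1 + of_real r \<in> - Z" using LX[of "c 0"] \<kappa>X[of 0] by (simp add: \<kappa>_def c01)
  ultimately obtain g where g: "path g" "path_image g \<subseteq> - Z" "pathstart g = 0" "pathfinish g = 1 + of_real r"
    unfolding path_connected_def by blast
  define \<delta> where "\<delta> = L \<circ> g"
  have \<delta>: "path \<delta>" "path_image \<delta> \<subseteq> X" "pathstart \<delta> = z" "pathfinish \<delta> = pathstart \<kappa>"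
    using g LX path_continuous_image[OF g(1) Lc]
    by (auto simp: \<delta>_def path_image_def pathstart_def pathfinish_def \<kappa>_def c01 L)
  obtain T\<delta> where T\<delta>: "transport W b m \<delta> T\<delta>" using transport_exists[OF \<delta>(1,2)] by blast
  obtain T' where T': "transport W b m (reversepath \<delta>) T'" "fmat_mult \<R> T' T\<delta> = E"
    using transport_reverse[OF \<delta>(1,2) T\<delta>] by blast
  have \<kappa>loop: "pathfinish \<kappa> = pathstart \<kappa>" by (simp add: \<kappa>_def pathfinish_def pathstart_def c01)
  have p1: "path (\<delta> +++ \<kappa>)" "pathfinish (\<delta> +++ \<kappa>) = pathstart (reversepath \<delta>)" "path (reversepath \<delta>)"
    using \<delta> \<kappa>path \<kappa>loop by (auto intro: path_join_imp)
  have T1: "transport W b m (\<delta> +++ \<kappa>) (fmat_mult \<R> T\<kappa> T\<delta>)"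
    by (rule transport_join[OF \<delta>(1) \<kappa>path \<delta>(4) T\<delta> T\<kappa>])
  have T2: "transport W b m ((\<delta> +++ \<kappa>) +++ reversepath \<delta>) (fmat_mult \<R> T' (fmat_mult \<R> T\<kappa> T\<delta>))"
    by (rule transport_join[OF p1(1,3,2) T1 T'(1)])
  \<comment> \<open>First order terms add, and those of \<open>T'\<close> and
    \<open>T\<delta>\<close> cancel.\<close>
  have "fps_nth (fmat_mult \<R> T' (fmat_mult \<R> T\<kappa> T\<delta>) i j) (Suc 0) = 2 * t_op W m s i j" if ij: "i \<in> \<R>" "j \<in> \<R>" for i j
  proof -
    note c0 = transport_coeff0[OF T'(1) p1(3)] transport_coeff0[OF T1 p1(1)] transport_coeff0[OF T\<kappa> \<kappa>path]
      transport_coeff0[OF T\<delta> \<delta>(1)]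
    have "fps_nth (T' i j) (Suc 0) + fps_nth (T\<delta> i j) (Suc 0) = fps_nth (E i j) (Suc 0)"
      using fmat_mult_first_order[OF finite_R ij c0(1,4)] T'(2) by simp
    then have "fps_nth (T' i j) (Suc 0) + fps_nth (T\<delta> i j) (Suc 0) = 0" by (simp add: fmat_one_def)
    then show ?thesis
      using fmat_mult_first_order[OF finite_R ij c0(1,2)] fmat_mult_first_order[OF finite_R ij c0(3,4)] T\<kappa>1[OF ij]
      by (simp add: algebra_simps add_eq_0_iff)
  qed
  moreover have "path ((\<delta> +++ \<kappa>) +++ reversepath \<delta>)" by (rule path_join_imp[OF p1(1,3,2)])
  moreover have "path_image ((\<delta> +++ \<kappa>) +++ reversepath \<delta>) \<subseteq> X"
    using \<delta>(2) \<kappa>img by (intro subset_path_image_join) auto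
  ultimately show ?thesis using T2 \<delta>(3)
    by (intro exI[of _ "(\<delta> +++ \<kappa>) +++ reversepath \<delta>"] exI[of _ "fmat_mult \<R> T' (fmat_mult \<R> T\<kappa> T\<delta>)"]) simp
qed

end

section \<open>Residual torsion-free nilpotence\<close>

text \<open>The target groups are the quotients by the \<open>N k\<close>. By \<open>comm\<close>
  the \<open>n\<close>-th lower central subgroup of such a quotient lies in the image of
  \<open>N n\<close>, hence is trivial for \<open>n = k\<close>; \<open>root\<close> excludes
  torsion.\<close>

lemma residually_torsion_free_nilpotentI:
  fixes G :: "'g monoid" and N :: "nat \<Rightarrow> 'g set"
  assumes G: "group G" and N: "\<And>k. N k \<lhd> G" and N0: "N 0 = carrier G"
    and comm: "\<And>k x y. x \<in> carrier G \<Longrightarrow> y \<in> N k \<Longrightarrow>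
      x \<otimes>\<^bsub>G\<^esub> y \<otimes>\<^bsub>G\<^esub> inv\<^bsub>G\<^esub> x \<otimes>\<^bsub>G\<^esub> inv\<^bsub>G\<^esub> y \<in> N (Suc k)"
    and root: "\<And>k x n. x \<in> carrier G \<Longrightarrow> (n::nat) > 0 \<Longrightarrow> x [^]\<^bsub>G\<^esub> n \<in> N k \<Longrightarrow> x \<in> N k"
    and sep: "\<And>g. g \<in> carrier G \<Longrightarrow> g \<noteq> \<one>\<^bsub>G\<^esub> \<Longrightarrow> \<exists>k. g \<notin> N k"
  shows "residually_torsion_free_nilpotent G"
  unfolding residually_torsion_free_nilpotent_def
proof (intro conjI ballI G)
  fix g assume "g \<in> carrier G - {\<one>\<^bsub>G\<^esub>}"
  then obtain k where g: "g \<in> carrier G" "g \<notin> N k" using sep by blast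
  interpret G: group G by (rule G)
  interpret N: normal "N k" G by (rule N)
  define H where "H = G Mod N k"
  define \<phi> where "\<phi> = (\<lambda>x. N k #>\<^bsub>G\<^esub> x)"
  have H: "group H" unfolding H_def by (rule N.factorgroup_is_group)
  interpret \<phi>: group_hom G H \<phi>
    by (intro group_hom.intro group_hom_axioms.intro G H) (simp add: H_def \<phi>_def N.r_coset_hom_Mod)
  have surj: "\<phi> ` carrier G = carrier H"
    by (auto simp: \<phi>_def H_def FactGroup_def RCOSETS_def)
  have ker: "\<phi> x = \<one>\<^bsub>H\<^esub> \<longleftrightarrow> x \<in> N k" if "x \<in> carrier G" for x
    using G.coset_join1[OF _ that N.subgroup_axioms] G.coset_join2[OF that N.subgroup_axioms]
    by (auto simp: \<phi>_def H_def FactGroup_def)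
  have central: "lower_central H n \<subseteq> \<phi> ` N n" for n
  proof (induction n)
    case 0
    show ?case using surj N0 by simp
  next
    case (Suc n)
    have NG: "N n \<subseteq> carrier G" for n using normal_imp_subgroup[OF N] subgroup.subset by blast
    have sub: "subgroup (\<phi> ` N (Suc n)) H"
      by (rule \<phi>.subgroup_img_is_subgroup[OF normal_imp_subgroup[OF N]])
    have "{x \<otimes>\<^bsub>H\<^esub> y \<otimes>\<^bsub>H\<^esub> inv\<^bsub>H\<^esub> x \<otimes>\<^bsub>H\<^esub> inv\<^bsub>H\<^esub> y | x y. x \<in> carrier H \<and> y \<in> lower_central H n} \<subseteq> \<phi> ` N (Suc n)"
    proof clarify
      fix x y assume x: "x \<in> carrier H" and y: "y \<in> lower_central H n"
      obtain a where a: "a \<in> carrier G" "x = \<phi> a" using x surj by blast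
      obtain c where c: "c \<in> N n" "y = \<phi> c" using y Suc by blast
      have cG: "c \<in> carrier G" using c NG by blast
      have "x \<otimes>\<^bsub>H\<^esub> y \<otimes>\<^bsub>H\<^esub> inv\<^bsub>H\<^esub> x \<otimes>\<^bsub>H\<^esub> inv\<^bsub>H\<^esub> y = \<phi> (a \<otimes>\<^bsub>G\<^esub> c \<otimes>\<^bsub>G\<^esub> inv\<^bsub>G\<^esub> a \<otimes>\<^bsub>G\<^esub> inv\<^bsub>G\<^esub> c)"
        using a cG by (simp add: c)
      then show "x \<otimes>\<^bsub>H\<^esub> y \<otimes>\<^bsub>H\<^esub> inv\<^bsub>H\<^esub> x \<otimes>\<^bsub>H\<^esub> inv\<^bsub>H\<^esub> y \<in> \<phi> ` N (Suc n)"
        using comm[OF a(1) c(1)] by blast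
    qed
    then show ?case
      unfolding lower_central.simps by (rule group.generate_subgroup_incl[OF H _ sub])
  qed
  have one_central: "\<one>\<^bsub>H\<^esub> \<in> lower_central H n" for n
    by (cases n) (auto intro: generate.one)
  have "\<phi> ` N k \<subseteq> {\<one>\<^bsub>H\<^esub>}" using ker N.subset by blast
  then have "lower_central H k = {\<one>\<^bsub>H\<^esub>}" using central[of k] one_central[of k] by blast
  then have nil: "nilpotent_group H" using H by (auto simp: nilpotent_group_def)
  have "x = \<one>\<^bsub>H\<^esub>" if x: "x \<in> carrier H" and n: "n > 0" "x [^]\<^bsub>H\<^esub> n = \<one>\<^bsub>H\<^esub>" for x and n :: nat
  proof -
    obtain a where a: "a \<in> carrier G" "x = \<phi> a" using x surj by blast
    have "\<phi> (a [^]\<^bsub>G\<^esub> n) = \<one>\<^bsub>H\<^esub>" using n a by (simp add: \<phi>.hom_nat_pow)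
    then have "a [^]\<^bsub>G\<^esub> n \<in> N k" using ker a by simp
    then show ?thesis using root[OF a(1) n(1)] ker a by simp
  qed
  then have tf: "torsion_free_group H" using H by (auto simp: torsion_free_group_def)
  have "\<phi> \<in> epi G H" using surj \<phi>.homh by (simp add: epi_def)
  then show "\<exists>(H :: 'g set monoid) \<phi>. nilpotent_group H \<and> torsion_free_group H \<and> \<phi> \<in> epi G H \<and> \<phi> g \<noteq> \<one>\<^bsub>H\<^esub>"
    using nil tf ker g by blast
qed

lemma scalars_to_fls_mult:
  fixes A B :: "('i, complex fps) fmat"
  shows "scalars_to_fls (fmat_mult I A B) = fmat_mult I (scalars_to_fls A) (scalars_to_fls B)"
proof -
  have "fps_to_fls (\<Sum>k\<in>S. f k) = (\<Sum>k\<in>S. fps_to_fls (f k))" for S and f :: "'i \<Rightarrow> complex fps"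
    by (induction S rule: infinite_finite_induct) simp_all
  then show ?thesis by (simp add: scalars_to_fls_def fmat_mult_def fun_eq_iff fls_times_fps_to_fls)
qed

lemma scalars_to_fls_one: "scalars_to_fls (fmat_one I) = fmat_one I"
  by (auto simp: scalars_to_fls_def fmat_one_def fun_eq_iff)

lemma scalars_to_fls_inj: "scalars_to_fls A = scalars_to_fls B \<longleftrightarrow> A = B"
  by (simp add: scalars_to_fls_def fun_eq_iff)

lemma scalars_to_fls_fmats: "T \<in> fmats I \<Longrightarrow> scalars_to_fls T \<in> fmats I"
  by (auto simp: scalars_to_fls_def fmats_def)

lemma GL_on_simps:
  "monoid.mult (GL_on I) = fmat_mult I" "one (GL_on I) = fmat_one I"
  by (simp_all add: GL_on_def units_of_def)

lemma GL_on_carrierI: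
  assumes "A \<in> fmats I" "B \<in> fmats I" "fmat_mult I A B = fmat_one I" "fmat_mult I B A = fmat_one I"
  shows "A \<in> carrier (GL_on I)"
  using assms by (auto simp: GL_on_def units_of_def Units_def)

definition X_cong :: "nat \<Rightarrow> ('i, complex fps) fmat \<Rightarrow> ('i, complex fps) fmat \<Rightarrow> bool" where
  "X_cong k A B \<longleftrightarrow> (\<forall>i j. fps_X ^ k dvd A i j - B i j)"

lemma X_cong_refl [simp]: "X_cong k A A"
  by (simp add: X_cong_def)

lemma X_cong_sym: "X_cong k A B \<Longrightarrow> X_cong k B A"
  unfolding X_cong_def
proof (intro allI)
  fix i j assume "\<forall>i j. fps_X ^ k dvd A i j - B i j"
  then have "fps_X ^ k dvd - (A i j - B i j)" by (simp only: dvd_minus_iff)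
  then show "fps_X ^ k dvd B i j - A i j" by simp
qed

lemma X_cong_trans: "X_cong k A B \<Longrightarrow> X_cong k B C \<Longrightarrow> X_cong k A C"
  unfolding X_cong_def
proof (intro allI)
  fix i j assume "\<forall>i j. fps_X ^ k dvd A i j - B i j" "\<forall>i j. fps_X ^ k dvd B i j - C i j"
  then have "fps_X ^ k dvd (A i j - B i j) + (B i j - C i j)" by (intro dvd_add) auto
  then show "fps_X ^ k dvd A i j - C i j" by simp
qed

lemma X_cong_mult:
  assumes "X_cong k A A'" "X_cong k B B'"
  shows "X_cong k (fmat_mult I A B) (fmat_mult I A' B')"
  unfolding X_cong_def
proof (intro allI)
  fix i j
  have "fmat_mult I A B i j - fmat_mult I A' B' i j = (\<Sum>l\<in>I. (A i l - A' i l) * B l j + A' i l * (B l j - B' l j))"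
    by (simp add: fmat_mult_def sum_subtractf[symmetric] algebra_simps)
  also have "fps_X ^ k dvd \<dots>"
    using assms unfolding X_cong_def by (intro dvd_sum dvd_add dvd_mult dvd_mult2) auto
  finally show "fps_X ^ k dvd fmat_mult I A B i j - fmat_mult I A' B' i j" .
qed

lemma X_power_dvd_nth: "fps_X ^ k dvd (f :: complex fps) \<Longrightarrow> n < k \<Longrightarrow> fps_nth f n = 0"
  by (auto simp: dvd_def fps_X_power_mult_nth)

lemma X_cong_1: "(\<And>i j. fps_nth (A i j) 0 = fps_nth (B i j) 0) \<Longrightarrow> X_cong 1 A B"
  unfolding X_cong_def
proof (intro allI)
  fix i j assume "\<And>i j. fps_nth (A i j) 0 = fps_nth (B i j) 0"
  then have "A i j - B i j = fps_X * fps_shift 1 (A i j - B i j)" by (intro fps_ext) simp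
  then show "fps_X ^ 1 dvd A i j - B i j" by (metis dvd_triv_left power_one_right)
qed

text \<open>The identity is central, so \<open>AB - BA\<close> is the commutator of
  \<open>A - 1\<close> and \<open>B - 1\<close>, in which the powers of \<open>h\<close> dividing
  the two factors add up.\<close>

lemma fmat_commutator:
  fixes A B :: "('i, 'a::comm_ring_1) fmat"
  assumes "finite I" "A \<in> fmats I" "B \<in> fmats I"
  shows "fmat_mult I A B i j - fmat_mult I B A i j =
    fmat_mult I (\<lambda>i j. A i j - fmat_one I i j) (\<lambda>i j. B i j - fmat_one I i j) i j -
    fmat_mult I (\<lambda>i j. B i j - fmat_one I i j) (\<lambda>i j. A i j - fmat_one I i j) i j"
proof -
  have "fmat_mult I (\<lambda>i j. A i j - fmat_one I i j) (\<lambda>i j. B i j - fmat_one I i j) i j =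
      fmat_mult I A B i j - A i j - B i j + fmat_one I i j"
    if "A \<in> fmats I" "B \<in> fmats I" for A B :: "('i, 'a) fmat"
  proof -
    have "fmat_mult I (\<lambda>i j. A i j - fmat_one I i j) (\<lambda>i j. B i j - fmat_one I i j) i j =
      fmat_mult I A B i j - fmat_mult I A (fmat_one I) i j - fmat_mult I (fmat_one I) B i j + fmat_mult I (fmat_one I) (fmat_one I) i j"
      by (simp add: fmat_mult_def ring_distribs sum.distrib sum_subtractf)
    then show ?thesis using assms(1) that by (simp add: fmat_mult_one_left fmat_mult_one_right fmat_one_fmats)
  qed
  then show ?thesis using assms by simp
qed

lemma X_cong_diff_mult:
  assumes "X_cong k A A'" "X_cong l B B'"
  shows "fps_X ^ (k + l) dvd fmat_mult I (\<lambda>i j. A i j - A' i j) (\<lambda>i j. B i j - B' i j) i j"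
  unfolding fmat_mult_def power_add using assms by (intro dvd_sum mult_dvd_mono) (auto simp: X_cong_def)

text \<open>\<open>P n\<close> is the power \<open>T^n\<close>. If \<open>D = T - 1\<close> is
  divisible by \<open>h^(j+1)\<close>, then \<open>T^n\<close> is \<open>1 + n D\<close> modulo
  \<open>h^(j+2)\<close> because \<open>D^2\<close> is divisible by \<open>h^(2j+2)\<close>. So
  \<open>n D\<close>, and with it \<open>D\<close>, is divisible by \<open>h^(j+2)\<close>: the
  exponent rises by one as long as it is below \<open>k\<close>.\<close>

lemma X_cong_root:
  assumes fin: "finite I" and T: "T \<in> fmats I" "X_cong 1 T (fmat_one I)" and n: "n > 0"
    and P: "P 0 = fmat_one I" "\<And>n. P (Suc n) = fmat_mult I (P n) T" "X_cong k (P n) (fmat_one I)"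
  shows "X_cong k T (fmat_one I)"
proof (cases k)
  case 0
  then show ?thesis by (simp add: X_cong_def)
next
  case (Suc k')
  define D where "D i j = T i j - fmat_one I i j" for i j
  have "X_cong (Suc j) T (fmat_one I)" if "j \<le> k'" for j
    using that
  proof (induction j)
    case 0
    then show ?case using T by simp
  next
    case (Suc j)
    then have cj: "X_cong (Suc j) T (fmat_one I)" by simp
    have pow: "X_cong (Suc (Suc j)) (P n) (\<lambda>i j. fmat_one I i j + of_nat n * D i j)" for n
    proof (induction n)
      case 0
      then show ?case by (simp add: P)
    next
      case (Suc n)
      have "X_cong (Suc (Suc j)) (P (Suc n)) (fmat_mult I (\<lambda>i j. fmat_one I i j + of_nat n * D i j) T)"
        unfolding P(2) by (rule X_cong_mult[OF Suc X_cong_refl])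
      moreover have "X_cong (Suc (Suc j)) (fmat_mult I (\<lambda>i j. fmat_one I i j + of_nat n * D i j) T)
          (\<lambda>i j. fmat_one I i j + of_nat (Suc n) * D i j)"
        unfolding X_cong_def
      proof (intro allI)
        fix i q
        have Deq: "D = (\<lambda>i j. T i j - fmat_one I i j)" by (simp add: D_def fun_eq_iff)
        have "fmat_mult I D D i q = fmat_mult I D T i q - fmat_mult I D (fmat_one I) i q"
          by (simp add: fmat_mult_def Deq right_diff_distrib sum_subtractf)
        moreover have "D \<in> fmats I" using T by (auto simp: Deq fmats_def fmat_one_def)
        ultimately have DT: "fmat_mult I D T i q = fmat_mult I D D i q + D i q" using fin by (simp add: fmat_mult_one_right)
        have "fmat_mult I (\<lambda>i j. fmat_one I i j + of_nat n * D i j) T i q = fmat_mult I (fmat_one I) T i q + of_nat n * fmat_mult I D T i q"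
          by (simp add: fmat_mult_def ring_distribs sum.distrib sum_distrib_left mult.assoc)
        then have "fmat_mult I (\<lambda>i j. fmat_one I i j + of_nat n * D i j) T i q - (fmat_one I i q + of_nat (Suc n) * D i q) =
            of_nat n * fmat_mult I D D i q"
          using fin T by (simp add: fmat_mult_one_left DT D_def algebra_simps)
        moreover have "fps_X ^ Suc (Suc j) dvd fmat_mult I D D i q"
          using X_cong_diff_mult[OF cj cj, of I i q] unfolding Deq
          by (rule dvd_trans[rotated]) (rule le_imp_power_dvd, simp)
        ultimately show "fps_X ^ Suc (Suc j) dvd fmat_mult I (\<lambda>i j. fmat_one I i j + of_nat n * D i j) T i q -
            (fmat_one I i q + of_nat (Suc n) * D i q)" by simp
      qed
      ultimately show ?case by (rule X_cong_trans)
    qed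
    have le: "X_cong (Suc (Suc j)) (P n) (fmat_one I)"
      using P(3) Suc.prems \<open>k = Suc k'\<close> unfolding X_cong_def by (meson Suc_le_mono dvd_trans le_imp_power_dvd)
    have c: "X_cong (Suc (Suc j)) (\<lambda>i j. fmat_one I i j + of_nat n * D i j) (fmat_one I)"
      using X_cong_trans[OF X_cong_sym[OF pow] le] .
    show ?case
      unfolding X_cong_def
    proof (intro allI)
      fix i q
      have "fps_X ^ Suc (Suc j) dvd of_nat n * D i q" using c by (simp add: X_cong_def)
      then have "fps_X ^ Suc (Suc j) dvd fps_const (1 / of_nat n) * (of_nat n * D i q)" by (rule dvd_mult)
      also have "fps_const (1 / of_nat n) * (of_nat n * D i q) = D i q"
        using n by (simp add: fps_of_nat[symmetric] mult.assoc[symmetric])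
      finally show "fps_X ^ Suc (Suc j) dvd T i q - fmat_one I i q" by (simp add: D_def)
    qed
  qed
  then show ?thesis using Suc by simp
qed

theorem residually_torsion_free_nilpotent_congruence:
  fixes \<T> :: "('i, complex fps) fmat set"
  assumes fin: "finite I" and \<T>: "\<T> \<subseteq> fmats I" and one: "fmat_one I \<in> \<T>"
    and mult: "\<And>S T. S \<in> \<T> \<Longrightarrow> T \<in> \<T> \<Longrightarrow> fmat_mult I S T \<in> \<T>"
    and inverse: "\<And>T. T \<in> \<T> \<Longrightarrow> \<exists>T'\<in>\<T>. fmat_mult I T' T = fmat_one I \<and> fmat_mult I T T' = fmat_one I"
    and const: "\<And>T i j. T \<in> \<T> \<Longrightarrow> fps_nth (T i j) 0 = fmat_one I i j"
  shows "residually_torsion_free_nilpotent ((GL_on I)\<lparr>carrier := scalars_to_fls ` \<T>\<rparr>)"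
proof -
  define G :: "('i, complex fls) fmat monoid" where "G = (GL_on I)\<lparr>carrier := scalars_to_fls ` \<T>\<rparr>"
  let ?s = "scalars_to_fls :: ('i, complex fps) fmat \<Rightarrow> _" and ?E = "fmat_one I :: ('i, complex fps) fmat"
  have G_simps: "carrier G = ?s ` \<T>" "\<one>\<^bsub>G\<^esub> = ?s ?E" "?s S \<otimes>\<^bsub>G\<^esub> ?s T = ?s (fmat_mult I S T)" for S T
    by (simp_all add: G_def GL_on_simps scalars_to_fls_mult scalars_to_fls_one)
  have oneL: "fmat_mult I ?E T = T" and oneR: "fmat_mult I T ?E = T" if "T \<in> \<T>" for T
    using fin that \<T> by (auto simp: fmat_mult_one_left fmat_mult_one_right)
  have G: "group G"
  proof (rule groupI)
    fix x assume "x \<in> carrier G"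
    then obtain T where T: "T \<in> \<T>" "x = ?s T" by (auto simp: G_simps)
    then obtain T' where "T' \<in> \<T>" "fmat_mult I T' T = ?E" using inverse by blast
    then show "\<exists>y\<in>carrier G. y \<otimes>\<^bsub>G\<^esub> x = \<one>\<^bsub>G\<^esub>"
      using T by (intro bexI[of _ "?s T'"]) (simp_all add: G_simps)
  qed (auto simp: G_simps mult one oneL fmat_mult_assoc[OF fin])
  have inv: "inv\<^bsub>G\<^esub> (?s T) = ?s T'" if "T \<in> \<T>" "T' \<in> \<T>" "fmat_mult I T' T = ?E" for T T'
    using that by (intro group.inv_equality[OF G]) (auto simp: G_simps)
  have c1: "X_cong 1 T ?E" if "T \<in> \<T>" for T
    by (rule X_cong_1) (use const[OF that] in \<open>auto simp: fmat_one_def\<close>)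
  define N where "N k = ?s ` {T \<in> \<T>. X_cong k T ?E}" for k
  have N_normal: "N k \<lhd> G" for k
    unfolding group.normal_inv_iff[OF G]
  proof (intro conjI ballI)
    show "subgroup (N k) G"
    proof (rule group.subgroupI[OF G])
      show "N k \<subseteq> carrier G" by (auto simp: N_def G_simps)
      show "N k \<noteq> {}" using one by (auto simp: N_def)
      fix x assume "x \<in> N k"
      then obtain T where T: "T \<in> \<T>" "X_cong k T ?E" "x = ?s T" by (auto simp: N_def)
      obtain T' where T': "T' \<in> \<T>" "fmat_mult I T' T = ?E" using inverse T by blast
      have "X_cong k (fmat_mult I T' T) (fmat_mult I T' ?E)" by (rule X_cong_mult[OF X_cong_refl T(2)])
      then have "X_cong k T' ?E" using T' oneR X_cong_sym by simp
      then show "inv\<^bsub>G\<^esub> x \<in> N k" using inv[OF T(1) T'] T' T(3) by (auto simp: N_def)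
      fix y assume "y \<in> N k"
      then obtain U where U: "U \<in> \<T>" "X_cong k U ?E" "y = ?s U" by (auto simp: N_def)
      have "X_cong k (fmat_mult I T U) (fmat_mult I ?E ?E)" by (rule X_cong_mult[OF T(2) U(2)])
      then show "x \<otimes>\<^bsub>G\<^esub> y \<in> N k" using T U mult oneL[OF one] by (auto simp: N_def G_simps)
    qed
    fix x y assume "x \<in> carrier G" "y \<in> N k"
    then obtain T U where T: "T \<in> \<T>" "x = ?s T" and U: "U \<in> \<T>" "X_cong k U ?E" "y = ?s U" by (auto simp: N_def G_simps)
    obtain T' where T': "T' \<in> \<T>" "fmat_mult I T' T = ?E" "fmat_mult I T T' = ?E" using inverse T by blast
    have "X_cong k (fmat_mult I (fmat_mult I T U) T') (fmat_mult I (fmat_mult I T ?E) T')"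
      by (intro X_cong_mult X_cong_refl U)
    then have "X_cong k (fmat_mult I (fmat_mult I T U) T') ?E" using T T' oneR by simp
    then show "x \<otimes>\<^bsub>G\<^esub> y \<otimes>\<^bsub>G\<^esub> inv\<^bsub>G\<^esub> x \<in> N k"
      using inv[OF T(1) T'(1,2)] T U T' mult by (auto simp: N_def G_simps)
  qed
  have "residually_torsion_free_nilpotent G"
  proof (rule residually_torsion_free_nilpotentI[OF G N_normal])
    show "N 0 = carrier G" by (auto simp: N_def G_simps X_cong_def)
  next
    fix k x y assume "x \<in> carrier G" "y \<in> N k"
    then obtain T U where T: "T \<in> \<T>" "x = ?s T" and U: "U \<in> \<T>" "X_cong k U ?E" "y = ?s U" by (auto simp: N_def G_simps)
    obtain T' where T': "T' \<in> \<T>" "fmat_mult I T' T = ?E" "fmat_mult I T T' = ?E" using inverse T by blast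
    obtain U' where U': "U' \<in> \<T>" "fmat_mult I U' U = ?E" "fmat_mult I U U' = ?E" using inverse U by blast
    \<comment> \<open>Every \<open>T\<close> in the group is 1 modulo \<open>h\<close>, which is the
      one power gained over the congruence of \<open>U\<close> modulo \<open>h^k\<close>; in
      particular \<open>N 0 = N 1\<close>.\<close>
    have "X_cong (Suc k) (fmat_mult I T U) (fmat_mult I U T)"
      unfolding X_cong_def
    proof (intro allI)
      fix i j
      have TU: "T \<in> fmats I" "U \<in> fmats I" using T U \<T> by auto
      show "fps_X ^ Suc k dvd fmat_mult I T U i j - fmat_mult I U T i j"
        unfolding fmat_commutator[OF fin TU]
        using X_cong_diff_mult[OF c1[OF T(1)] U(2), of I i j] X_cong_diff_mult[OF U(2) c1[OF T(1)], of I i j]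
        by (intro dvd_diff) (simp_all add: add.commute)
    qed
    then have "X_cong (Suc k) (fmat_mult I (fmat_mult I (fmat_mult I T U) T') U') (fmat_mult I (fmat_mult I (fmat_mult I U T) T') U')"
      by (rule X_cong_mult[OF X_cong_mult[OF _ X_cong_refl] X_cong_refl])
    moreover have "fmat_mult I (fmat_mult I (fmat_mult I U T) T') U' = ?E"
      using T' U' oneR[OF U(1)] by (simp add: fmat_mult_assoc[OF fin, of U T])
    ultimately show "x \<otimes>\<^bsub>G\<^esub> y \<otimes>\<^bsub>G\<^esub> inv\<^bsub>G\<^esub> x \<otimes>\<^bsub>G\<^esub> inv\<^bsub>G\<^esub> y \<in> N (Suc k)"
      using inv[OF T(1) T'(1,2)] inv[OF U(1) U'(1,2)] T U T' U' mult by (auto simp: N_def G_simps)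
  next
    fix k x and n :: nat assume x: "x \<in> carrier G" and n: "n > 0" and pow: "x [^]\<^bsub>G\<^esub> n \<in> N k"
    obtain T where T: "T \<in> \<T>" "x = ?s T" using x by (auto simp: G_simps)
    define P where "P n = ((\<lambda>M. fmat_mult I M T) ^^ n) ?E" for n
    have P: "P 0 = ?E" "P (Suc n) = fmat_mult I (P n) T" for n by (simp_all add: P_def)
    have "x [^]\<^bsub>G\<^esub> n = ?s (P n)" for n :: nat
      by (induction n) (simp_all add: P G_simps T)
    then have "?s (P n) \<in> N k" using pow by simp
    then have "X_cong k (P n) ?E" by (auto simp: N_def scalars_to_fls_inj)
    then have "X_cong k T ?E" using T \<T> by (intro X_cong_root[OF fin _ c1 n, of T P]) (auto simp: P)
    then show "x \<in> N k" using T by (auto simp: N_def)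
  next
    fix g assume "g \<in> carrier G" "g \<noteq> \<one>\<^bsub>G\<^esub>"
    then obtain T where T: "T \<in> \<T>" "g = ?s T" "T \<noteq> ?E" by (auto simp: G_simps)
    then obtain i j n where d: "fps_nth (T i j) n \<noteq> fps_nth (?E i j) n" by (auto simp: fun_eq_iff fps_eq_iff)
    have "\<not> X_cong (Suc n) T ?E"
    proof
      assume "X_cong (Suc n) T ?E"
      then have "fps_nth (T i j - ?E i j) n = 0" by (intro X_power_dvd_nth[of "Suc n"]) (auto simp: X_cong_def)
      then show False using d by simp
    qed
    then show "\<exists>k. g \<notin> N k" using T by (auto simp: N_def scalars_to_fls_inj intro!: exI[of _ "Suc n"])
  qed
  then show ?thesis by (simp add: G_def)
qed

section \<open>The monodromy representation\<close>

lemma basis_expansion: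
  assumes "finite I" "\<And>i. i \<notin> I \<Longrightarrow> x i = (0 :: 'a::field)"
  shows "x = (\<Sum>i\<in>I. fscale (x i) (unit_vec i))"
proof
  fix j
  have "(\<Sum>i\<in>I. fscale (x i) (unit_vec i)) j = (\<Sum>i\<in>I. fscale (x i) (unit_vec i) j)"
    using assms(1) by (induction I rule: finite_induct) auto
  also have "\<dots> = (\<Sum>i\<in>I. if i = j then x j else 0)"
    by (intro sum.cong refl) (auto simp: fscale_def unit_vec_def)
  also have "\<dots> = x j" using assms by auto
  finally show "x j = (\<Sum>i\<in>I. fscale (x i) (unit_vec i)) j" by simp
qed

lemma free_space_iff:
  assumes "finite I"
  shows "x \<in> free_space I \<longleftrightarrow> (\<forall>i. i \<notin> I \<longrightarrow> x i = (0 :: 'a::field))"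
proof
  assume "x \<in> free_space I"
  then show "\<forall>i. i \<notin> I \<longrightarrow> x i = 0"
    unfolding free_space_def
    by (induction rule: fvs.span_induct_alt) (auto simp: fscale_def unit_vec_def split: if_splits)
next
  assume x: "\<forall>i. i \<notin> I \<longrightarrow> x i = 0"
  have "x = (\<Sum>i\<in>I. fscale (x i) (unit_vec i))" using assms x by (intro basis_expansion) auto
  then show "x \<in> free_space I"
    unfolding free_space_def by (metis (no_types, lifting) fvs.span_base fvs.span_scale fvs.span_sum image_eqI)
qed

lemma free_space_subspace: "fvs.subspace (free_space I)"
  by (simp add: free_space_def fvs.subspace_span)

lemma unit_vec_free_space: "finite I \<Longrightarrow> (unit_vec i :: ('i, 'a::field) fvec) \<in> free_space I \<longleftrightarrow> i \<in> I"
  by (auto simp: free_space_iff unit_vec_def)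

text \<open>A linear form with value 1 on \<open>y\<close> and 0 on a basis of \<open>U\<close>,
  written in coordinates.\<close>

lemma separating_functional:
  fixes U :: "('i, 'a::field) fvec set"
  assumes U: "fvs.subspace U" and fin: "finite I" and UI: "U \<subseteq> free_space I" and y: "y \<in> free_space I" "y \<notin> U"
  obtains a where "\<And>u. u \<in> U \<Longrightarrow> (\<Sum>i\<in>I. a i * u i) = 0" "(\<Sum>i\<in>I. a i * y i) \<noteq> 0"
proof -
  interpret vector_space_pair "fscale :: 'a \<Rightarrow> ('i, 'a) fvec \<Rightarrow> _" "(*) :: 'a \<Rightarrow> 'a \<Rightarrow> 'a"
    by unfold_locales (auto simp: algebra_simps)
  obtain B where B: "B \<subseteq> U" "fvs.independent B" "U \<subseteq> fvs.span B" using fvs.maximal_independent_subset[of U] by blast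
  have "fvs.span B \<subseteq> U" using B(1) U by (simp add: fvs.span_minimal)
  then have "y \<notin> fvs.span B" using y by blast
  then have "fvs.independent (insert y B)" using B(2) by (simp add: fvs.independent_insert)
  then obtain g where g: "Vector_Spaces.linear fscale (*) g" "\<And>x. x \<in> insert y B \<Longrightarrow> g x = (if x = y then 1 else 0)"
    using linear_independent_extend[of "insert y B" "\<lambda>x. if x = y then 1 else 0"] by blast
  interpret g: Vector_Spaces.linear "fscale :: 'a \<Rightarrow> ('i, 'a) fvec \<Rightarrow> _" "(*) :: 'a \<Rightarrow> 'a \<Rightarrow> 'a" g by (rule g(1))
  have gB: "g u = 0" if "u \<in> fvs.span B" for u
    using that
  proof (induction rule: fvs.span_induct_alt)
    case base
    show ?case by (rule g.zero)
  next
    case (step c x z)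
    have "x \<noteq> y" using step(1) \<open>y \<notin> fvs.span B\<close> fvs.span_base by blast
    then show ?case unfolding g.add g.scale using g(2)[of x] step by simp
  qed
  have gval: "g x = (\<Sum>i\<in>I. g (unit_vec i) * x i)" if x: "x \<in> free_space I" for x
  proof -
    have "x = (\<Sum>i\<in>I. fscale (x i) (unit_vec i))" using fin x by (intro basis_expansion) (auto simp: free_space_iff)
    then have "g x = g (\<Sum>i\<in>I. fscale (x i) (unit_vec i))" by simp
    then show ?thesis by (simp add: g.sum g.scale mult.commute)
  qed
  show ?thesis
  proof (rule that[of "\<lambda>i. g (unit_vec i)"])
    show "(\<Sum>i\<in>I. g (unit_vec i) * u i) = 0" if "u \<in> U" for u
    proof -
      have "u \<in> free_space I" "u \<in> fvs.span B" using that UI B(3) by (blast, blast)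
      then show ?thesis unfolding gval[OF \<open>u \<in> free_space I\<close>, symmetric] by (intro gB)
    qed
    show "(\<Sum>i\<in>I. g (unit_vec i) * y i) \<noteq> 0" using gval[OF y(1)] g(2)[of y] by simp
  qed
qed

lemma restrict_fmat_fmats: "restrict_fmat J M \<in> fmats J"
  by (auto simp: restrict_fmat_def fmats_def)

lemma restrict_fmat_mult:
  assumes "finite I" "J \<subseteq> I" "\<And>i k. i \<in> J \<Longrightarrow> k \<in> I - J \<Longrightarrow> A i k = 0"
  shows "restrict_fmat J (fmat_mult I A B) = fmat_mult J (restrict_fmat J A) (restrict_fmat J (B :: ('i, 'a::comm_ring_1) fmat))"
proof (intro ext)
  fix i j
  show "restrict_fmat J (fmat_mult I A B) i j = fmat_mult J (restrict_fmat J A) (restrict_fmat J B) i j"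
  proof (cases "i \<in> J \<and> j \<in> J")
    case True
    have "(\<Sum>k\<in>I. A i k * B k j) = (\<Sum>k\<in>J. A i k * B k j)"
      by (rule sum.mono_neutral_right) (use assms True in auto)
    then show ?thesis using True by (simp add: restrict_fmat_def fmat_mult_def)
  next
    case False
    then show ?thesis by (auto simp: restrict_fmat_def fmat_mult_def)
  qed
qed

lemma restrict_fmat_one: "J \<subseteq> I \<Longrightarrow> restrict_fmat J (fmat_one I) = fmat_one J"
  by (auto simp: restrict_fmat_def fmat_one_def fun_eq_iff)

lemma fmat_vec_linear:
  "fmat_vec I M (x + y) = fmat_vec I M x + fmat_vec I M y"
  "fmat_vec I M (fscale c x) = fscale c (fmat_vec I M x)"
  by (auto simp: fmat_vec_def fscale_def fun_eq_iff sum.distrib sum_distrib_left algebra_simps)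

lemma subrep_Int: "subrep I G U \<Longrightarrow> subrep I G V \<Longrightarrow> subrep I G (U \<inter> V)"
  by (auto simp: subrep_def intro: fvs.subspace_inter)

lemma subrep_sum:
  assumes "subrep I G U" "subrep I G V"
  shows "subrep I G {x + y | x y. x \<in> U \<and> y \<in> V}"
  unfolding subrep_def
proof (intro conjI ballI)
  have s: "fvs.subspace U" "fvs.subspace V" using assms by (auto simp: subrep_def)
  show "fvs.subspace {x + y | x y. x \<in> U \<and> y \<in> V}" by (rule fvs.subspace_sums[OF s])
  show "{x + y | x y. x \<in> U \<and> y \<in> V} \<subseteq> free_space I"
  proof clarify
    fix x y assume "x \<in> U" "y \<in> V"
    then have "x \<in> free_space I" "y \<in> free_space I" using assms unfolding subrep_def by (blast, blast)
    then show "x + y \<in> free_space I" by (rule fvs.subspace_add[OF free_space_subspace])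
  qed
  fix g z assume g: "g \<in> G" "z \<in> {x + y | x y. x \<in> U \<and> y \<in> V}"
  then obtain x y where xy: "x \<in> U" "y \<in> V" "z = x + y" by blast
  have "fmat_vec I g x \<in> U" "fmat_vec I g y \<in> V" using assms g(1) xy unfolding subrep_def by (blast, blast)
  then show "fmat_vec I g z \<in> {x + y | x y. x \<in> U \<and> y \<in> V}"
    unfolding xy(3) fmat_vec_linear by blast
qed

section \<open>The decomposition indexed by conjugacy classes\<close>

context reflection_group begin

lemma classes_finite: "finite (reflection_classes W)"
  using finite_R by (simp add: reflection_classes_def)

lemma classes_disjoint: "c \<in> reflection_classes W \<Longrightarrow> d \<in> reflection_classes W \<Longrightarrow> i \<in> c \<Longrightarrow> i \<in> d \<Longrightarrow> c = d"
  using class_orbit by metis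

lemma classes_cover: "i \<in> \<R> \<Longrightarrow> \<exists>c\<in>reflection_classes W. i \<in> c"
  using one_W by (force simp: reflection_classes_def intro: image_eqI[of _ _ "mat 1"])

lemma V_K_iff: "J \<subseteq> \<R> \<Longrightarrow> x \<in> V_K J \<longleftrightarrow> (\<forall>i. i \<notin> J \<longrightarrow> x i = 0)"
  unfolding V_K_def using free_space_iff finite_subset[OF _ finite_R] by blast

lemma V_K_subspace: "fvs.subspace (V_K J)"
  unfolding V_K_def by (rule free_space_subspace)

lemma V_K_span: "V_K \<R> = fvs.span (\<Union>c\<in>reflection_classes W. V_K c)"
proof
  have "unit_vec i \<in> fvs.span (\<Union>c\<in>reflection_classes W. V_K c)" if i: "i \<in> \<R>" for i
  proof -
    obtain c where c: "c \<in> reflection_classes W" "i \<in> c" using classes_cover[OF i] by blast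
    then have "unit_vec i \<in> V_K c" by (simp add: V_K_def free_space_def fvs.span_base)
    then show ?thesis using c(1) by (intro fvs.span_base) blast
  qed
  then show "V_K \<R> \<subseteq> fvs.span (\<Union>c\<in>reflection_classes W. V_K c)"
    unfolding V_K_def[of \<R>] free_space_def by (intro fvs.span_minimal fvs.subspace_span) blast
  show "fvs.span (\<Union>c\<in>reflection_classes W. V_K c) \<subseteq> V_K \<R>"
  proof (rule fvs.span_minimal[OF UN_least V_K_subspace], rule subsetI)
    fix c x assume c: "c \<in> reflection_classes W" and "x \<in> V_K c"
    then have "\<forall>i. i \<notin> c \<longrightarrow> x i = 0" using V_K_iff[OF class_subset[OF c]] by simp
    then show "x \<in> V_K \<R>" using V_K_iff[OF subset_refl] class_subset[OF c] by auto
  qed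
qed

lemma V_K_direct_sum: "internal_direct_sum (V_K \<R>) V_K (reflection_classes W)"
  unfolding internal_direct_sum_def
proof (intro conjI ballI allI impI)
  fix x c assume x: "(\<forall>c\<in>reflection_classes W. x c \<in> V_K c) \<and> (\<Sum>c\<in>reflection_classes W. x c) = 0"
    and c: "c \<in> reflection_classes W"
  have zero: "x d i = 0" if "d \<in> reflection_classes W" "i \<notin> d" for d i
  proof -
    have "x d \<in> V_K d" using x that(1) by simp
    then show ?thesis using V_K_iff[OF class_subset[OF that(1)]] that(2) by simp
  qed
  show "x c = 0"
  proof
    fix i
    show "x c i = 0 i"
    proof (cases "i \<in> c")
      case True
      have "(\<Sum>d\<in>reflection_classes W. x d) i = (\<Sum>d\<in>reflection_classes W. x d i)"
        using classes_finite by (induction rule: finite_induct) auto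
      also have "\<dots> = (\<Sum>d\<in>reflection_classes W. if d = c then x c i else 0)"
        using zero classes_disjoint[OF c _ True] by (intro sum.cong refl) auto
      also have "\<dots> = x c i" using c classes_finite by simp
      finally show ?thesis using x by simp
    qed (use zero c in simp)
  qed
qed (rule classes_finite V_K_subspace V_K_span)+

lemma V_K_inj: "inj_on V_K (reflection_classes W)"
proof (rule inj_onI)
  fix c d assume cd: "c \<in> reflection_classes W" "d \<in> reflection_classes W" "V_K c = V_K d"
  then have "i \<in> c \<longleftrightarrow> i \<in> d" for i
    using unit_vec_free_space[OF class_finite, where ?'a = "complex fls", of c i]
      unit_vec_free_space[OF class_finite, where ?'a = "complex fls", of d i] by (simp add: V_K_def)
  then show "c = d" by blast
qed

lemma W_op_entry: "W_op W w i j = (if j \<in> \<R> \<and> i = conj_by w j then 1 else 0)"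
  by (simp add: W_op_def mat_of_columns_def unit_vec_def)

lemma W_op_fmats: "w \<in> W \<Longrightarrow> W_op W w \<in> fmats \<R>"
  by (auto simp: fmats_def W_op_entry conj_R)

lemma W_op_mult:
  assumes "v \<in> W" "w \<in> W"
  shows "fmat_mult \<R> (W_op W v) (W_op W w) = (W_op W (v ** w) :: (complex^'n^'n, 'a::comm_ring_1) fmat)"
proof (intro ext)
  fix i j
  have "fmat_mult \<R> (W_op W v) (W_op W w) i j =
      (\<Sum>k\<in>\<R>. if k = conj_by w j then (if j \<in> \<R> \<and> i = conj_by v (conj_by w j) then 1 else 0) else (0::'a))"
    unfolding fmat_mult_def by (intro sum.cong refl) (auto simp: W_op_entry)
  also have "\<dots> = W_op W (v ** w) i j"
    using assms finite_R by (auto simp: W_op_entry conj_by_mult conj_R)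
  finally show "fmat_mult \<R> (W_op W v) (W_op W w) i j = (W_op W (v ** w) i j :: 'a)" .
qed

lemma W_op_one: "W_op W (mat 1) = fmat_one \<R>"
  by (auto simp: W_op_entry fmat_one_def fun_eq_iff)

lemma W_op_block:
  assumes "c \<in> reflection_classes W" "w \<in> W" "(i \<in> c) \<noteq> (j \<in> c)"
  shows "W_op W w i j = 0"
  using assms class_conj[OF assms(1), of j w] class_conj[OF assms(1), of "conj_by w j" "matrix_inv w"]
  by (auto simp: W_op_entry inv_W conj_by_inv)

text \<open>A complement of \<open>U\<close> is found among the sums of the \<open>V_K c\<close>:
  take a largest set \<open>D\<close> of classes whose sum meets \<open>U\<close> in 0. An
  irreducible \<open>V_K c\<close> not contained in the sum of \<open>U\<close> and this space meets
  it in 0, and then \<open>c\<close> could be added to \<open>D\<close>.\<close>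

lemma semisimple_from_irreducible:
  assumes sub: "\<And>D. D \<subseteq> reflection_classes W \<Longrightarrow> subrep \<R> G (V_K (\<Union>D))"
    and irr: "\<And>c. c \<in> reflection_classes W \<Longrightarrow> irreducible_subrep \<R> G (V_K c)"
  shows "semisimple_rep \<R> G"
  unfolding semisimple_rep_def
proof (intro allI impI)
  fix U assume U: "subrep \<R> G U"
  have sU: "fvs.subspace U" using U by (simp add: subrep_def)
  define P where "P D \<longleftrightarrow> D \<subseteq> reflection_classes W \<and> U \<inter> V_K (\<Union>D) = {0}" for D
  have VR: "V_K (\<Union>D) = {x. \<forall>i. i \<notin> \<Union>D \<longrightarrow> x i = 0}" if "D \<subseteq> reflection_classes W" for D
    using V_K_iff[of "\<Union>D"] that class_subset by blast
  have "P {}" unfolding P_def VR[OF empty_subsetI] using fvs.subspace_0[OF sU] by (auto simp: fun_eq_iff)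
  moreover have "\<forall>D. P D \<longrightarrow> card D \<le> card (reflection_classes W)"
    using classes_finite by (simp add: P_def card_mono)
  ultimately have "\<exists>D. P D \<and> (\<forall>D'. P D' \<longrightarrow> card D' \<le> card D)"
    by (intro ex_has_greatest_nat[where k = "{}" and b = "Suc (card (reflection_classes W))"]) (auto simp: less_Suc_eq_le)
  then obtain D where D: "P D" "\<And>D'. P D' \<Longrightarrow> card D' \<le> card D" by (elim exE conjE) (rule that, auto)
  have DC: "D \<subseteq> reflection_classes W" using D(1) by (simp add: P_def)
  define S where "S = {x + y | x y. x \<in> U \<and> y \<in> V_K (\<Union>D)}"
  have S: "subrep \<R> G S" unfolding S_def by (rule subrep_sum[OF U sub[OF DC]])
  have "V_K c \<subseteq> S" if c: "c \<in> reflection_classes W" for c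
  proof (rule ccontr)
    assume not: "\<not> V_K c \<subseteq> S"
    have "subrep \<R> G (V_K c \<inter> S)" using irr[OF c] S by (intro subrep_Int) (auto simp: irreducible_subrep_def)
    then have zero: "V_K c \<inter> S = {0}" using irr[OF c] not unfolding irreducible_subrep_def by blast
    have "c \<notin> D"
    proof
      assume "c \<in> D"
      then have "V_K c \<subseteq> V_K (\<Union>D)" unfolding VR[OF DC] using V_K_iff[OF class_subset[OF c]] by blast
      also have "\<dots> \<subseteq> S" unfolding S_def using fvs.subspace_0[OF sU] by force
      finally show False using not by blast
    qed
    have "P (insert c D)"
      unfolding P_def
    proof (intro conjI subset_antisym subsetI)
      show cD: "x \<in> reflection_classes W" if "x \<in> insert c D" for x using that c DC by blast
      fix u assume u: "u \<in> U \<inter> V_K (\<Union>(insert c D))"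
      \<comment> \<open>\<open>v\<close> is the component of \<open>u\<close> in
        \<open>V_K c\<close> and \<open>d\<close> the one along \<open>D\<close>. Since
        \<open>v = u - d\<close> lies in \<open>S\<close>, it is 0, and \<open>u = d\<close> is then
        0 by the choice of \<open>D\<close>.\<close>
      define v where "v i = (if i \<in> c then u i else 0)" for i
      define d where "d = u - v"
      have "v \<in> V_K c" using V_K_iff[OF class_subset[OF c]] by (simp add: v_def)
      moreover have dD: "d \<in> V_K (\<Union>D)"
        unfolding VR[OF DC] using u VR[of "insert c D"] c DC by (auto simp: d_def v_def)
      moreover have "v = u + (- d)" by (simp add: d_def)
      moreover have "- d \<in> V_K (\<Union>D)" by (rule fvs.subspace_neg[OF V_K_subspace dD])
      ultimately have "v \<in> V_K c \<inter> S" unfolding S_def using u by blast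
      then have "v = 0" using zero by blast
      then have "u = d" by (simp add: d_def)
      then show "u \<in> {0}" using dD u D(1) by (auto simp: P_def)
    next
      fix u assume "u \<in> {0 :: (complex^'n^'n, complex fls) fvec}"
      then show "u \<in> U \<inter> V_K (\<Union>(insert c D))"
        using fvs.subspace_0[OF sU] fvs.subspace_0[OF V_K_subspace] by blast
    qed
    then have "card (insert c D) \<le> card D" by (rule D(2))
    then show False using \<open>c \<notin> D\<close> finite_subset[OF DC classes_finite] by simp
  qed
  then have "V_K \<R> \<subseteq> S"
    unfolding V_K_span using S by (intro fvs.span_minimal) (auto simp: subrep_def)
  then have "S = free_space \<R>" using S by (auto simp: subrep_def V_K_def)
  then show "\<exists>U'. subrep \<R> G U' \<and> U \<inter> U' = {0} \<and> {x + y | x y. x \<in> U \<and> y \<in> U'} = free_space \<R>"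
    using sub[OF DC] D(1) by (intro exI[of _ "V_K (\<Union>D)"]) (simp add: P_def S_def)
qed

end

section \<open>The images of the braid group and of the pure braid group\<close>

locale pointed_kz_system = kz_system W b m
  for W :: "(complex^'n^'n) set" and b :: "complex^'n^'n \<Rightarrow> complex^'n \<Rightarrow> complex" and m :: complex +
  fixes z :: "complex^'n"
  assumes z: "z \<in> hyperplane_complement W"
begin

text \<open>The image of \<open>P\<close> before the passage to Laurent series, where congruences
  modulo powers of \<open>h\<close> make sense.\<close>

definition loop_transports :: "(complex^'n^'n, complex fps) fmat set" where
  "loop_transports = {T. \<exists>\<gamma>. path \<gamma> \<and> path_image \<gamma> \<subseteq> X \<and> pathstart \<gamma> = z \<and> pathfinish \<gamma> = z \<and> transport W b m \<gamma> T}"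

abbreviation "RB \<equiv> monodromy_rep W b m z `` carrier (braid_group W z)"
abbreviation "RP \<equiv> pure_monodromy_rep W b m z `` carrier (pure_braid_group W z)"

lemma pathin_X: "pathin (top_of_set X) \<gamma> \<longleftrightarrow> path \<gamma> \<and> path_image \<gamma> \<subseteq> X"
  by (auto simp: pathin_canon_iff path_image_def)

lemma RP_eq: "RP = scalars_to_fls ` loop_transports"
proof (intro subset_antisym subsetI)
  fix x assume "x \<in> RP"
  then show "x \<in> scalars_to_fls ` loop_transports"
    by (auto simp: pure_monodromy_rep_def loop_transports_def pathin_X pathstart_def pathfinish_def)
next
  fix x assume "x \<in> scalars_to_fls ` loop_transports"
  then obtain \<gamma> T where T: "path \<gamma>" "path_image \<gamma> \<subseteq> X" "\<gamma> 0 = z" "\<gamma> 1 = z" "transport W b m \<gamma> T" "x = scalars_to_fls T"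
    by (auto simp: loop_transports_def pathstart_def pathfinish_def)
  then have "path_class (top_of_set X) \<gamma> \<in> carrier (pure_braid_group W z)"
    by (auto simp: pure_braid_group_def fundamental_group_def pathin_X)
  moreover have "(path_class (top_of_set X) \<gamma>, x) \<in> pure_monodromy_rep W b m z"
    using T by (auto simp: pure_monodromy_rep_def pathin_X)
  ultimately show "x \<in> RP" by blast
qed

lemma RB_elem:
  assumes "g \<in> RB"
  obtains w \<gamma> T where "w \<in> W" "path \<gamma>" "path_image \<gamma> \<subseteq> X" "transport W b m \<gamma> T"
    "g = fmat_mult \<R> (W_op W w) (scalars_to_fls T)"
  using assms by (auto simp: monodromy_rep_def pathin_X)

lemma loop_transports_fmats: "loop_transports \<subseteq> fmats \<R>"
  using transport_fmats by (auto simp: loop_transports_def)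

lemma loop_transports_one: "E \<in> loop_transports"
proof -
  have p: "path (\<lambda>_. z)" "path_image (\<lambda>_::real. z) \<subseteq> X" using z by (auto simp: path_def path_image_def)
  obtain T where T: "transport W b m (\<lambda>_. z) T" using transport_exists[OF p] by blast
  then obtain F where F: "solution_on (\<lambda>_. z) 0 1 F" "F 0 = E" "F 1 = T" by (auto simp: transport_iff)
  have "solution_on (\<lambda>_. z) 0 1 (\<lambda>_. F 0)"
    by (rule solution_on_reparam[OF F(1), where \<phi> = "\<lambda>_. 0"]) auto
  then have "transport W b m (\<lambda>_. z) E" unfolding transport_iff using F(2) by (intro exI[of _ "\<lambda>_. F 0"]) simp
  then show ?thesis using p by (auto simp: loop_transports_def pathstart_def pathfinish_def)
qed

lemma loop_transports_mult:
  assumes "S \<in> loop_transports" "T \<in> loop_transports"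
  shows "fmat_mult \<R> S T \<in> loop_transports"
proof -
  obtain \<gamma> where \<gamma>: "path \<gamma>" "path_image \<gamma> \<subseteq> X" "pathstart \<gamma> = z" "pathfinish \<gamma> = z" "transport W b m \<gamma> S"
    using assms(1) by (auto simp: loop_transports_def)
  obtain \<delta> where \<delta>: "path \<delta>" "path_image \<delta> \<subseteq> X" "pathstart \<delta> = z" "pathfinish \<delta> = z" "transport W b m \<delta> T"
    using assms(2) by (auto simp: loop_transports_def)
  have "pathfinish \<delta> = pathstart \<gamma>" using \<gamma> \<delta> by simp
  then have "transport W b m (\<delta> +++ \<gamma>) (fmat_mult \<R> S T)" by (rule transport_join[OF \<delta>(1) \<gamma>(1) _ \<delta>(5) \<gamma>(5)])
  moreover have "path (\<delta> +++ \<gamma>)" "path_image (\<delta> +++ \<gamma>) \<subseteq> X" using \<gamma> \<delta> by (simp_all add: subset_path_image_join)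
  ultimately show ?thesis using \<gamma> \<delta> unfolding loop_transports_def by (auto intro!: exI[of _ "\<delta> +++ \<gamma>"])
qed

lemma loop_transports_inverse:
  assumes "T \<in> loop_transports"
  shows "\<exists>T'\<in>loop_transports. fmat_mult \<R> T' T = E \<and> fmat_mult \<R> T T' = E"
proof -
  obtain \<gamma> where \<gamma>: "path \<gamma>" "path_image \<gamma> \<subseteq> X" "pathstart \<gamma> = z" "pathfinish \<gamma> = z" "transport W b m \<gamma> T"
    using assms by (auto simp: loop_transports_def)
  obtain T' where T': "transport W b m (reversepath \<gamma>) T'" "fmat_mult \<R> T' T = E" "fmat_mult \<R> T T' = E"
    using transport_reverse[OF \<gamma>(1,2,5)] by blast
  have "T' \<in> loop_transports"
    unfolding loop_transports_def using T'(1) \<gamma> by (intro CollectI exI[of _ "reversepath \<gamma>"]) simp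
  then show ?thesis using T' by blast
qed

lemma loop_transports_const: "T \<in> loop_transports \<Longrightarrow> fps_nth (T i j) 0 = fmat_one \<R> i j"
  using transport_coeff0 by (auto simp: loop_transports_def)

text \<open>A loop in \<open>X\<close> projects to a loop in the orbit space, with
  \<open>w = 1\<close>. Thus vanishing on the image of \<open>B\<close> can be tested on that of
  \<open>P\<close>.\<close>

lemma RP_subset_RB: "RP \<subseteq> RB"
proof
  fix x assume "x \<in> RP"
  then obtain \<gamma> T where T: "path \<gamma>" "path_image \<gamma> \<subseteq> X" "\<gamma> 0 = z" "\<gamma> 1 = z" "transport W b m \<gamma> T" "x = scalars_to_fls T"
    unfolding RP_eq by (auto simp: loop_transports_def pathstart_def pathfinish_def)
  have pin: "pathin (top_of_set X) \<gamma>" using T by (simp add: pathin_X)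
  have "continuous_map (top_of_set X) (orbit_space W) (orbit_of W)"
    unfolding orbit_space_def by (rule quotient_imp_continuous_map[OF quotient_map_quotient_topology])
  then have "pathin (orbit_space W) (orbit_of W \<circ> \<gamma>)"
    using pin unfolding pathin_def by (rule continuous_map_compose[rotated])
  then have "path_class (orbit_space W) (orbit_of W \<circ> \<gamma>) \<in> carrier (braid_group W z)"
    using T(3,4) by (auto simp: braid_group_def fundamental_group_def)
  moreover have "(path_class (orbit_space W) (orbit_of W \<circ> \<gamma>), x) \<in> monodromy_rep W b m z"
  proof -
    have "scalars_to_fls T \<in> fmats \<R>" by (rule scalars_to_fls_fmats[OF transport_fmats[OF T(5)]])
    then have "x = fmat_mult \<R> (W_op W (mat 1)) (scalars_to_fls T)"
      by (simp add: T(6) W_op_one fmat_mult_one_left finite_R)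
    moreover have "\<gamma> 1 = matrix_inv (mat 1) *v z" by (simp add: T(4) matrix_inv_one)
    ultimately show ?thesis unfolding monodromy_rep_def using T(3,5) pin one_W by blast
  qed
  ultimately show "x \<in> RB" by blast
qed

lemma RB_block:
  assumes g: "g \<in> RB" and c: "c \<in> reflection_classes W" and ij: "(i \<in> c) \<noteq> (j \<in> c)"
  shows "g i j = 0"
proof -
  obtain w \<gamma> T where h: "w \<in> W" "path \<gamma>" "path_image \<gamma> \<subseteq> X" "transport W b m \<gamma> T"
    "g = fmat_mult \<R> (W_op W w) (scalars_to_fls T)" using RB_elem[OF g] .
  have zero: "W_op W w i k * scalars_to_fls T k j = 0" for k
  proof (cases "(i \<in> c) = (k \<in> c)")
    case True
    then have "T k j = 0" using transport_block[OF h(4,2) c, of k j] ij by simp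
    then show ?thesis by (simp add: scalars_to_fls_def)
  next
    case False
    then show ?thesis by (simp add: W_op_block[OF c h(1) False])
  qed
  show ?thesis unfolding h(5) fmat_mult_def by (rule sum.neutral) (use zero in blast)
qed

lemma RB_restrict_GL:
  assumes g: "g \<in> RB" and c: "c \<in> reflection_classes W"
  shows "restrict_fmat c g \<in> carrier (GL_on c)"
proof -
  obtain w \<gamma> T where h: "w \<in> W" "path \<gamma>" "path_image \<gamma> \<subseteq> X" "transport W b m \<gamma> T"
    "g = fmat_mult \<R> (W_op W w) (scalars_to_fls T)" using RB_elem[OF g] .
  obtain T' where T': "transport W b m (reversepath \<gamma>) T'" "fmat_mult \<R> T' T = E" "fmat_mult \<R> T T' = E"
    using transport_reverse[OF h(2,3,4)] by blast
  let ?V = "W_op W w :: (complex^'n^'n, complex fls) fmat" and ?V' = "W_op W (matrix_inv w) :: (complex^'n^'n, complex fls) fmat"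
  \<comment> \<open>The inverse of \<open>g\<close>. It is block diagonal as well, so its
    restriction inverts that of \<open>g\<close>.\<close>
  define g' where "g' = fmat_mult \<R> (scalars_to_fls T') ?V'"
  have wi: "matrix_inv w \<in> W" by (rule inv_W[OF h(1)])
  have V: "fmat_mult \<R> ?V ?V' = fmat_one \<R>" "fmat_mult \<R> ?V' ?V = fmat_one \<R>"
    using h(1) wi by (simp_all add: W_op_mult W_op_one)
  have TT: "fmat_mult \<R> (scalars_to_fls T) (scalars_to_fls T') = fmat_one \<R>"
    "fmat_mult \<R> (scalars_to_fls T') (scalars_to_fls T) = fmat_one \<R>"
    using T'(2,3) by (simp_all add: scalars_to_fls_mult[symmetric] scalars_to_fls_one)
  have f: "scalars_to_fls T \<in> fmats \<R>" "scalars_to_fls T' \<in> fmats \<R>" "?V \<in> fmats \<R>" "?V' \<in> fmats \<R>"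
    using transport_fmats[OF h(4)] transport_fmats[OF T'(1)] W_op_fmats[OF h(1)] W_op_fmats[OF wi]
    by (simp_all add: scalars_to_fls_fmats)
  have "fmat_mult \<R> g g' = fmat_mult \<R> (fmat_mult \<R> ?V (fmat_mult \<R> (scalars_to_fls T) (scalars_to_fls T'))) ?V'"
    by (simp add: h(5) g'_def fmat_mult_assoc[OF finite_R])
  then have gg': "fmat_mult \<R> g g' = fmat_one \<R>" by (simp add: TT V fmat_mult_one_right[OF finite_R f(3)])
  have "fmat_mult \<R> g' g = fmat_mult \<R> (fmat_mult \<R> (scalars_to_fls T') (fmat_mult \<R> ?V' ?V)) (scalars_to_fls T)"
    by (simp add: h(5) g'_def fmat_mult_assoc[OF finite_R])
  then have g'g: "fmat_mult \<R> g' g = fmat_one \<R>" by (simp add: TT V fmat_mult_one_right[OF finite_R f(2)])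
  have g'_block: "g' i j = 0" if ij: "(i \<in> c) \<noteq> (j \<in> c)" for i j
  proof -
    have zero: "scalars_to_fls T' i k * ?V' k j = 0" for k
    proof (cases "(i \<in> c) = (k \<in> c)")
      case True
      then have "(k \<in> c) \<noteq> (j \<in> c)" using ij by simp
      then show ?thesis by (simp add: W_op_block[OF c wi])
    next
      case False
      have "path (reversepath \<gamma>)" using h(2) by simp
      then have "T' i k = 0" using transport_block[OF T'(1) _ c False] by simp
      then show ?thesis by (simp add: scalars_to_fls_def)
    qed
    show ?thesis unfolding g'_def fmat_mult_def by (rule sum.neutral) (use zero in blast)
  qed
  have cR: "c \<subseteq> \<R>" by (rule class_subset[OF c])
  have "restrict_fmat c (fmat_mult \<R> g g') = fmat_mult c (restrict_fmat c g) (restrict_fmat c g')"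
    by (rule restrict_fmat_mult[OF finite_R cR]) (use RB_block[OF g c] in auto)
  then have "fmat_mult c (restrict_fmat c g) (restrict_fmat c g') = fmat_one c"
    unfolding gg' restrict_fmat_one[OF cR] by simp
  moreover have "restrict_fmat c (fmat_mult \<R> g' g) = fmat_mult c (restrict_fmat c g') (restrict_fmat c g)"
    by (rule restrict_fmat_mult[OF finite_R cR]) (use g'_block in auto)
  then have "fmat_mult c (restrict_fmat c g') (restrict_fmat c g) = fmat_one c"
    unfolding g'g restrict_fmat_one[OF cR] by simp
  ultimately show ?thesis by (rule GL_on_carrierI[OF restrict_fmat_fmats restrict_fmat_fmats])
qed

text \<open>Loops round the hyperplanes provide elements \<open>1 + 2 h t\<^sub>s + O(h\<^sup>2)\<close> of the image of \<open>P\<close>.\<close>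

lemma poly_functions_vanish_RP:
  assumes c: "c \<in> reflection_classes W"
    and lie: "\<And>L. lie_subalgebra c L \<Longrightarrow> (\<forall>s\<in>\<R>. restrict_fmat c (t_op W m s) \<in> L) \<Longrightarrow> fmats c \<subseteq> L"
    and p: "p \<in> poly_functions c" "\<And>g. g \<in> RP \<Longrightarrow> p (restrict_fmat c g) = 0"
  shows "p M = 0"
proof (rule zariski_vanish[where I = c and p = p and M = M and S = "restrict_fmat c ` RP" and
      G = "(\<lambda>s. (\<lambda>i j. 2 * restrict_fmat c (t_op W m s) i j)) ` \<R>"])
  have cR: "c \<subseteq> \<R>" by (rule class_subset[OF c])
  show "finite c" by (rule class_finite[OF c])
  have "scalars_to_fls E \<in> RP" unfolding RP_eq using loop_transports_one by blast
  then have "restrict_fmat c (fmat_one \<R>) \<in> restrict_fmat c ` RP" unfolding scalars_to_fls_one by (rule imageI)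
  then show "fmat_one c \<in> restrict_fmat c ` RP" unfolding restrict_fmat_one[OF cR] .
  show "p \<in> poly_functions c" by (rule p)
  show "p M = 0" if "M \<in> restrict_fmat c ` RP" for M using p(2) that by blast
  show "fmats c \<subseteq> L" if L: "lie_subalgebra c L" and G: "(\<lambda>s. (\<lambda>i j. 2 * restrict_fmat c (t_op W m s) i j)) ` \<R> \<subseteq> L" for L
  proof (rule lie[OF L], rule ballI)
    fix s assume "s \<in> \<R>"
    then have "(\<lambda>i j. 2 * restrict_fmat c (t_op W m s) i j) \<in> L" using G by blast
    from lie_subalgebraD(2)[OF L this, of "1/2"] show "restrict_fmat c (t_op W m s) \<in> L" by simp
  qed
  fix g :: "(complex^'n^'n, complex) fmat"
  assume "g \<in> (\<lambda>s. (\<lambda>i j. 2 * restrict_fmat c (t_op W m s) i j)) ` \<R>"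
  then obtain s where s: "s \<in> \<R>" "g = (\<lambda>i j. 2 * restrict_fmat c (t_op W m s) i j)" by blast
  obtain \<gamma> T where T: "path \<gamma>" "path_image \<gamma> \<subseteq> X" "pathstart \<gamma> = z" "pathfinish \<gamma> = z" "transport W b m \<gamma> T"
    "\<And>i j. i \<in> \<R> \<Longrightarrow> j \<in> \<R> \<Longrightarrow> fps_nth (T i j) (Suc 0) = 2 * t_op W m s i j"
    using loop_transport[OF s(1) z] by auto
  have T\<T>: "T \<in> loop_transports" using T(1-5) by (auto simp: loop_transports_def)
  \<comment> \<open>Shifting removes the constant term 1 and divides by \<open>h\<close>, so that
    the block of \<open>T\<close> is \<open>1 + h N\<close>.\<close>
  define N where "N i j = (if i \<in> c \<and> j \<in> c then fps_shift 1 (T i j) else 0)" for i j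
  have "fps_nth (N i j) 0 = g i j" for i j
    using T(6)[of i j] cR by (auto simp: N_def s(2) restrict_fmat_def)
  moreover have "restrict_fmat c (scalars_to_fls T) = (\<lambda>i j. fmat_one c i j + fls_X * fps_to_fls (N i j))"
  proof (intro ext)
    fix i j
    show "restrict_fmat c (scalars_to_fls T) i j = fmat_one c i j + fls_X * fps_to_fls (N i j)"
    proof (cases "i \<in> c \<and> j \<in> c")
      case True
      have "T i j = fmat_one c i j + fps_X * N i j"
      proof (rule fps_ext)
        fix n
        show "fps_nth (T i j) n = fps_nth (fmat_one c i j + fps_X * N i j) n"
          using True loop_transports_const[OF T\<T>, of i j] cR
          by (cases n) (auto simp: N_def fmat_one_def)
      qed
      then have "fps_to_fls (T i j) = fps_to_fls (fmat_one c i j) + fls_X * fps_to_fls (N i j)"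
        by (simp only: fps_to_fls_plus fls_times_fps_to_fls fps_X_to_fls)
      then show ?thesis using True by (auto simp: restrict_fmat_def scalars_to_fls_def fmat_one_def)
    next
      case False
      then show ?thesis by (auto simp: restrict_fmat_def N_def fmat_one_def)
    qed
  qed
  moreover have "fmat_mult c M (restrict_fmat c (scalars_to_fls T)) \<in> restrict_fmat c ` RP" if "M \<in> restrict_fmat c ` RP" for M
  proof -
    obtain U where U: "U \<in> loop_transports" "M = restrict_fmat c (scalars_to_fls U)" using \<open>M \<in> restrict_fmat c ` RP\<close> unfolding RP_eq by blast
    have "scalars_to_fls U \<in> RB" using U(1) RP_subset_RB unfolding RP_eq by blast
    then have "restrict_fmat c (fmat_mult \<R> (scalars_to_fls U) (scalars_to_fls T)) = fmat_mult c M (restrict_fmat c (scalars_to_fls T))"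
      unfolding U(2) using RB_block[OF _ c] by (intro restrict_fmat_mult[OF finite_R cR]) auto
    moreover have "fmat_mult \<R> (scalars_to_fls U) (scalars_to_fls T) \<in> RP"
      unfolding RP_eq scalars_to_fls_mult[symmetric] using loop_transports_mult[OF U(1) T\<T>] by blast
    ultimately show ?thesis by (metis image_eqI)
  qed
  ultimately show "\<exists>N. (\<forall>i j. fps_nth (N i j) 0 = g i j) \<and> (\<forall>M\<in>restrict_fmat c ` RP.
      fmat_mult c M (\<lambda>i j. fmat_one c i j + fls_X * fps_to_fls (N i j)) \<in> restrict_fmat c ` RP)"
    by (intro exI[of _ N]) simp
qed

text \<open>Equations of a closed set containing the image of \<open>B\<close> vanish on that of
  \<open>P\<close>, hence are identically 0 by \<open>poly_functions_vanish_RP\<close>, and exclude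
  no invertible matrix.\<close>

lemma RB_zariski_dense:
  assumes c: "c \<in> reflection_classes W"
    and lie: "\<And>L. lie_subalgebra c L \<Longrightarrow> (\<forall>s\<in>\<R>. restrict_fmat c (t_op W m s) \<in> L) \<Longrightarrow> fmats c \<subseteq> L"
  shows "zariski_dense c (restrict_fmat c ` RB)"
  unfolding zariski_dense_def
proof (intro conjI allI impI)
  show "restrict_fmat c ` RB \<subseteq> carrier (GL_on c)" using RB_restrict_GL[OF _ c] by blast
  fix Z assume "zariski_closed c Z \<and> restrict_fmat c ` RB \<subseteq> Z"
  then obtain Q where Q: "Q \<subseteq> poly_functions c" "Z = {M \<in> carrier (GL_on c). \<forall>q\<in>Q. q M = 0}"
    and sub: "restrict_fmat c ` RB \<subseteq> Z" by (auto simp: zariski_closed_def)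
  have "q M = 0" if q: "q \<in> Q" for q M
  proof (rule poly_functions_vanish_RP[where c = c and p = q and M = M, OF c])
    show "fmats c \<subseteq> L" if "lie_subalgebra c L" "\<forall>s\<in>\<R>. restrict_fmat c (t_op W m s) \<in> L" for L
      by (rule lie[OF that])
    show "q \<in> poly_functions c" using Q(1) q by blast
    fix g assume "g \<in> RP"
    then have "restrict_fmat c g \<in> Z" using RP_subset_RB sub by blast
    then show "q (restrict_fmat c g) = 0" using Q(2) q by blast
  qed
  then show "Z = carrier (GL_on c)" using Q(2) by blast
qed

lemma RB_subrep:
  assumes D: "D \<subseteq> reflection_classes W"
  shows "subrep \<R> RB (V_K (\<Union>D))"
proof -
  have DR: "\<Union>D \<subseteq> \<R>" using D class_subset by blast
  have "V_K (\<Union>D) \<subseteq> free_space \<R>"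
  proof
    fix x assume "x \<in> V_K (\<Union>D)"
    then show "x \<in> free_space \<R>" using V_K_iff[OF DR, of x] DR V_K_iff[OF subset_refl, of x] by (auto simp: V_K_def)
  qed
  moreover have "fmat_vec \<R> g x \<in> V_K (\<Union>D)" if g: "g \<in> RB" and x: "x \<in> V_K (\<Union>D)" for g x
    unfolding V_K_iff[OF DR]
  proof (intro allI impI)
    fix i assume i: "i \<notin> \<Union>D"
    have zero: "g i j * x j = 0" for j
    proof (cases "j \<in> \<Union>D")
      case True
      then obtain c where "c \<in> D" "j \<in> c" by blast
      then have "g i j = 0" using i D by (intro RB_block[OF g, of c]) auto
      then show ?thesis by simp
    next
      case False
      then show ?thesis using x V_K_iff[OF DR] by simp
    qed
    show "fmat_vec \<R> g x i = 0" unfolding fmat_vec_def by (rule sum.neutral) (use zero in blast)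
  qed
  ultimately show ?thesis using V_K_subspace unfolding subrep_def by blast
qed

text \<open>For \<open>x \<noteq> 0\<close> in a subrepresentation \<open>U\<close> the functions \<open>M \<mapsto> a (M x)\<close>, with \<open>a\<close> a linear form
  vanishing on \<open>U\<close>, vanish on the image of \<open>P\<close>, hence identically.\<close>

lemma RB_irreducible:
  assumes c: "c \<in> reflection_classes W"
    and lie: "\<And>L. lie_subalgebra c L \<Longrightarrow> (\<forall>s\<in>\<R>. restrict_fmat c (t_op W m s) \<in> L) \<Longrightarrow> fmats c \<subseteq> L"
  shows "irreducible_subrep \<R> RB (V_K c)"
  unfolding irreducible_subrep_def
proof (intro conjI allI impI)
  show "subrep \<R> RB (V_K c)" using RB_subrep[of "{c}"] c by simp
  have cR: "c \<subseteq> \<R>" and fin: "finite c" using class_subset[OF c] class_finite[OF c] by auto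
  obtain a where a: "a \<in> c" using class_nonempty[OF c] by blast
  have "(unit_vec a :: (complex^'n^'n, complex fls) fvec) \<in> V_K c"
    using a by (simp add: V_K_def unit_vec_free_space[OF fin])
  moreover have "(unit_vec a :: (complex^'n^'n, complex fls) fvec) \<noteq> 0" by (auto simp: unit_vec_def fun_eq_iff)
  ultimately show "V_K c \<noteq> {0}" by blast
  fix U assume "subrep \<R> RB U \<and> U \<subseteq> V_K c"
  then have U: "subrep \<R> RB U" "U \<subseteq> V_K c" by auto
  have sU: "fvs.subspace U" using U(1) by (simp add: subrep_def)
  show "U = {0} \<or> U = V_K c"
  proof (rule ccontr)
    assume contra: "\<not> (U = {0} \<or> U = V_K c)"
    then obtain x where x: "x \<in> U" "x \<noteq> 0" using fvs.subspace_0[OF sU] by blast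
    obtain y where y: "y \<in> V_K c" "y \<notin> U" using contra U(2) by blast
    obtain \<alpha> where \<alpha>: "\<And>u. u \<in> U \<Longrightarrow> (\<Sum>i\<in>c. \<alpha> i * u i) = 0" "(\<Sum>i\<in>c. \<alpha> i * y i) \<noteq> 0"
      using separating_functional[OF sU fin U(2)[unfolded V_K_def] y(1)[unfolded V_K_def] y(2)] by blast
    have xc: "x j = 0" if "j \<notin> c" for j using x(1) U(2) V_K_iff[OF cR] that by blast
    obtain k where k: "x k \<noteq> 0" using x(2) by (auto simp: fun_eq_iff)
    then have kc: "k \<in> c" using xc by blast
    define p where "p M = (\<Sum>i\<in>c. \<alpha> i * (\<Sum>j\<in>c. M i j * x j))" for M :: "(complex^'n^'n, complex fls) fmat"
    have pc: "p \<in> poly_functions c"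
      unfolding p_def by (intro poly_functions_sum fin poly_functions.mult poly_functions.const poly_functions.entry)
    have pRP: "p (restrict_fmat c g) = 0" if g: "g \<in> RP" for g
    proof -
      have "fmat_vec \<R> g x \<in> U" using U(1) x(1) g RP_subset_RB unfolding subrep_def by blast
      then have "(\<Sum>i\<in>c. \<alpha> i * fmat_vec \<R> g x i) = 0" by (rule \<alpha>(1))
      moreover have "fmat_vec \<R> g x i = (\<Sum>j\<in>c. restrict_fmat c g i j * x j)" if "i \<in> c" for i
      proof -
        have "fmat_vec \<R> g x i = (\<Sum>j\<in>c. g i j * x j)"
          unfolding fmat_vec_def by (rule sum.mono_neutral_right[OF finite_R cR]) (use xc in auto)
        then show ?thesis using that by (simp add: restrict_fmat_def)
      qed
      ultimately show ?thesis by (simp add: p_def)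
    qed
    have "p M = 0" for M
    proof (rule poly_functions_vanish_RP[where c = c and p = p and M = M, OF c])
      show "fmats c \<subseteq> L" if "lie_subalgebra c L" "\<forall>s\<in>\<R>. restrict_fmat c (t_op W m s) \<in> L" for L
        by (rule lie[OF that])
    qed (use pc pRP in auto)
    \<comment> \<open>This matrix, concentrated in column \<open>k\<close>, maps \<open>x\<close> to
      \<open>y\<close>, where the linear form \<alpha> does not vanish.\<close>
    moreover have "p (\<lambda>i j. if j = k then y i / x k else 0) = (\<Sum>i\<in>c. \<alpha> i * y i)"
    proof -
      have "(\<Sum>j\<in>c. (if j = k then y i / x k else 0) * x j) = (\<Sum>j\<in>c. if j = k then y i else 0)" for i
        using k by (intro sum.cong refl) auto
      then show ?thesis using kc fin by (simp add: p_def)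
    qed
    ultimately show False using \<alpha>(2) by metis
  qed
qed

theorem RP_residually_torsion_free_nilpotent:
  "residually_torsion_free_nilpotent ((GL_on \<R>)\<lparr>carrier := RP\<rparr>)"
  unfolding RP_eq
  by (rule residually_torsion_free_nilpotent_congruence[OF finite_R loop_transports_fmats loop_transports_one
        loop_transports_mult loop_transports_inverse])
     (simp_all add: loop_transports_const fmat_one_def)

end

theorem theorem2:
  fixes W :: "(complex^'n^'n) set"
    and b :: "complex^'n^'n \<Rightarrow> complex^'n \<Rightarrow> complex"
    and z :: "complex^'n"
  assumes "complex_reflection_group W"
    and "\<And>s. s \<in> reflections W \<Longrightarrow> defining_form s (b s)"
    and "z \<in> hyperplane_complement W"
  shows "(\<forall>m. integrable_form (reflections W) (hyperplane_complement W) (kz_form W b m)) \<and>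
    (\<exists>M. finite M \<and> (\<forall>m. m \<notin> M \<longrightarrow>
       (let RB = monodromy_rep W b m z `` carrier (braid_group W z);
            RP = pure_monodromy_rep W b m z `` carrier (pure_braid_group W z)
        in semisimple_rep (reflections W) RB \<and>
           (internal_direct_sum (V_K (reflections W)) V_K (reflection_classes W) \<and>
            inj_on V_K (reflection_classes W) \<and>
            (\<forall>c\<in>reflection_classes W.
               irreducible_subrep (reflections W) RB (V_K c))) \<and>
           (\<forall>c\<in>reflection_classes W. zariski_dense c (restrict_fmat c ` RB)) \<and>
           residually_torsion_free_nilpotent ((GL_on (reflections W))\<lparr>carrier := RP\<rparr>))))"
proof -
  interpret reflection_arrangement W b
    by unfold_locales (rule assms(1), rule assms(2))
  define good where "good c m \<longleftrightarrow> (\<forall>L. lie_subalgebra c L \<and>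
    (\<forall>s\<in>\<R>. restrict_fmat c (t_op W m s) \<in> L) \<longrightarrow> fmats c \<subseteq> L)" for c m
  have "\<forall>c\<in>reflection_classes W. \<exists>M. finite M \<and> (\<forall>m. m \<notin> M \<longrightarrow> good c m)"
    unfolding good_def using generic_lie_generation by blast
  then obtain M where M: "\<And>c. c \<in> reflection_classes W \<Longrightarrow> finite (M c)"
    "\<And>c m. c \<in> reflection_classes W \<Longrightarrow> m \<notin> M c \<Longrightarrow> good c m" by metis
  \<comment> \<open>Irreducibility and density are proved class by class, so the exceptional values
    of the finitely many classes are collected.\<close>
  have "finite (\<Union>c\<in>reflection_classes W. M c)" using M(1) classes_finite by blast
  moreover have "semisimple_rep \<R> (monodromy_rep W b m z `` carrier (braid_group W z)) \<and>
      (internal_direct_sum (V_K \<R>) V_K (reflection_classes W) \<and> inj_on V_K (reflection_classes W) \<and>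
        (\<forall>c\<in>reflection_classes W. irreducible_subrep \<R> (monodromy_rep W b m z `` carrier (braid_group W z)) (V_K c))) \<and>
      (\<forall>c\<in>reflection_classes W. zariski_dense c (restrict_fmat c ` (monodromy_rep W b m z `` carrier (braid_group W z)))) \<and>
      residually_torsion_free_nilpotent
        ((GL_on \<R>)\<lparr>carrier := pure_monodromy_rep W b m z `` carrier (pure_braid_group W z)\<rparr>)"
    if m: "m \<notin> (\<Union>c\<in>reflection_classes W. M c)" for m
  proof -
    interpret pointed_kz_system W b m z by unfold_locales (rule assms(3))
    have lie: "fmats c \<subseteq> L" if "c \<in> reflection_classes W" "lie_subalgebra c L"
      "\<forall>s\<in>\<R>. restrict_fmat c (t_op W m s) \<in> L" for c L
      using M(2)[OF that(1), of m] m that unfolding good_def by blast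
    have irr: "irreducible_subrep \<R> RB (V_K c)" if "c \<in> reflection_classes W" for c
      by (rule RB_irreducible[OF that lie[OF that]])
    have dense: "zariski_dense c (restrict_fmat c ` RB)" if "c \<in> reflection_classes W" for c
      by (rule RB_zariski_dense[OF that lie[OF that]])
    show ?thesis
      using semisimple_from_irreducible[OF RB_subrep irr] V_K_direct_sum V_K_inj irr dense
        RP_residually_torsion_free_nilpotent by blast
  qed
  ultimately show ?thesis
    unfolding Let_def using kz_integrable by blast
qed

end
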